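(* Let $(\rho^{\rm opt}(\boldsymbol{x},t),\boldsymbol{u}^{\rm opt}(\boldsymbol{x},t))$ be a pair that solves the variational problem $$\inf_{(\rho,\boldsymbol{u})\in\mathcal{P}(\mathbb{R}^n)\times\mathcal{U}}\ \frac12\int_0^1\int_{\mathbb{R}^n}\|\boldsymbol{u}(\boldsymbol{x},t)\|_2^2\,\rho(\boldsymbol{x},t)\,d\boldsymbol{x}\,dt$$ subject to $$\frac{\partial\rho}{\partial t}+\nabla\cdot\big(\rho(\boldsymbol{f}+\boldsymbol{B}(t)\boldsymbol{u})\big)=\epsilon\langle\boldsymbol{D}(t),\mathbf{Hess}(\rho)\rangle,\qquad \rho(\boldsymbol{x},0)=\rho_0(\boldsymbol{x}),\quad \rho(\boldsymbol{x},1)=\rho_1(\boldsymbol{x}).$$ Then there is a scalar function $\psi(\boldsymbol{x},t)$ (the Lagrange multiplier associated with the PDE constraint) such that the pair satisfies the system of coupled PDEs $$\frac{\partial\psi}{\partial t}+\frac12\|\boldsymbol{B}(t)^{\top}\nabla\psi\|_2^2+\langle\nabla\psi,\boldsymbol{f}\rangle=-\epsilon\langle\boldsymbol{D}(t),\mathbf{Hess}(\psi)\rangle,$$ $$\frac{\partial}{\partial t}\rho^{\rm opt}+\nabla\cdot\big(\rho^{\rm opt}(\boldsymbol{f}+\boldsymbol{B}(t)\boldsymbol{B}(t)^{\top}\nabla\psi)\big)=\epsilon\langle\boldsymbol{D}(t),\mathbf{Hess}(\rho^{\rm opt})\rangle,$$ with boundary conditions $$\rho^{\rm opt}(\boldsymbol{x},0)=\rho_0(\boldsymbol{x}),\qquad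 \rho^{\rm opt}(\boldsymbol{x},1)=\rho_1(\boldsymbol{x}),$$ and $$\boldsymbol{u}^{\rm opt}(\boldsymbol{x},t)=\boldsymbol{B}(t)^{\top}\nabla\psi(\boldsymbol{x},t).$$
   Context: Setting: $\epsilon>0$; $\boldsymbol{f}(\boldsymbol{x},t)\in\mathbb{R}^n$ is a given deterministic vector field, $\boldsymbol{x}\in\mathbb{R}^n$, $t\in[0,1]$; $\boldsymbol{B}(t)\in\mathbb{R}^{n\times m}$; $\boldsymbol{D}(t):=\boldsymbol{B}(t)\boldsymbol{B}(t)^{\top}$; $\rho_0,\rho_1$ are prescribed probability density functions (PDFs) on $\mathbb{R}^n$. Standing assumptions: (i) there exist constants $c_1,c_2$ with $\|\boldsymbol{f}(\boldsymbol{x},t)\|_2+\|\boldsymbol{B}(t)\|_2\le c_1(1+\|\boldsymbol{x}\|_2)$ and $\|\boldsymbol{f}(\boldsymbol{x},t)-\boldsymbol{f}(\boldsymbol{y},t)\|_2\le c_2\|\boldsymbol{x}-\boldsymbol{y}\|_2$ for all $\boldsymbol{x},\boldsymbol{y}\in\mathbb{R}^n$, $t\in[0,1]$; (ii) there exists a constant $c_3>0$ with $\langle\boldsymbol{x},\boldsymbol{D}(t)\boldsymbol{x}\rangle\ge c_3\|\boldsymbol{x}\|_2^2$ for all $\boldsymbol{x}\in\mathbb{R}^n$, $t\in[0,1]$. $\mathcal{P}(\mathbb{R}^n)$ is the collection of joint PDFs on $\mathbb{R}^n$, and $\rho(\cdot,t)\in\mathcal{P}(\mathbb{R}^n)$ for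 each $t$. $\mathcal{U}$ is the set of finite energy inputs $\boldsymbol{u}:\mathbb{R}^n\times[0,1]\to\mathbb{R}^m$, $\langle\boldsymbol{u},\boldsymbol{u}\rangle<\infty$. $\nabla$, $\nabla\cdot$ and $\mathbf{Hess}$ are the Euclidean gradient, divergence and Hessian with respect to $\boldsymbol{x}$. For vectors $\langle\boldsymbol{a},\boldsymbol{b}\rangle=\boldsymbol{a}^{\top}\boldsymbol{b}$; for matrices $\langle\boldsymbol{A},\boldsymbol{C}\rangle=\mathrm{trace}(\boldsymbol{A}^{\top}\boldsymbol{C})$; $\|\cdot\|_2$ is the Euclidean norm of vectors and the spectral norm of matrices. The Lagrangian associated with the problem is $$\mathcal{L}(\rho,\boldsymbol{u},\psi):=\int_0^1\!\int_{\mathbb{R}^n}\Big\{\tfrac12\|\boldsymbol{u}\|_2^2\rho+\psi\Big(\frac{\partial\rho}{\partial t}+\nabla\cdot\big((\boldsymbol{f}+\boldsymbol{B}(t)\boldsymbol{u})\rho\big)-\epsilon\langle\boldsymbol{D}(t),\mathbf{Hess}(\rho)\rangle\Big)\Big\}\,d\boldsymbol{x}\,dt,$$ minimized (unconstrained) over $\mathcal{U}$ and over densities $\rho(\boldsymbol{x},t)\ge0$ with $\int_{\mathbb{R}^n}\rho\,d\boldsymbol{x}=1$, $\rho(\boldsymbol{x},0)=\rho_0$, $\rho(\boldsymbol{x},1)=\rho_1$; $\psi(\boldsymbol{x},t)$ is the Lagrange multiplier. Smoothness is understood to be such that the derivatives appearing make sense. *)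

theory Defs
  imports "HOL-Analysis.Analysis"
begin

text \<open>
  Functions of space and time are curried, space first. All differential operators below are total
  and only meaningful where the required derivatives exist; this is guaranteed by the predicates
  \<open>C1_in_space\<close> and \<open>C2_in_space_C1_in_time\<close>. Regularity and the differential equations are
  imposed on the open time interval, since an optimal control may be singular at the
  endpoint times (e.g. when the terminal density is compactly supported).
\<close>

definition gradient :: "(real^'n \<Rightarrow> real) \<Rightarrow> real^'n \<Rightarrow> real^'n" where
  "gradient g x = (\<chi> i. frechet_derivative g (at x) (axis i 1))"

definition divergence :: "(real^'n \<Rightarrow> real^'n) \<Rightarrow> real^'n \<Rightarrow> real" where
  "divergence F x = trace (jacobian F (at x))"

definition Hess :: "(real^'n \<Rightarrow> real) \<Rightarrow> real^'n \<Rightarrow> real^'n^'n" where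
  "Hess g x = jacobian (gradient g) (at x)"

definition time_deriv :: "(real^'n \<Rightarrow> real \<Rightarrow> real) \<Rightarrow> real^'n \<Rightarrow> real \<Rightarrow> real" where
  "time_deriv g x t = deriv (\<lambda>s. g x s) t"

definition matrix_inner :: "real^'n^'m \<Rightarrow> real^'n^'m \<Rightarrow> real" where
  "matrix_inner A C = trace (transpose A ** C)"

definition spectral_norm :: "real^'m^'n \<Rightarrow> real" where
  "spectral_norm A = onorm (\<lambda>v. A *v v)"

definition diffusion :: "(real \<Rightarrow> real^'m^'n) \<Rightarrow> real \<Rightarrow> real^'n^'n" where
  "diffusion B t = B t ** transpose (B t)"

definition C1_in_space :: "(real^'n \<Rightarrow> real \<Rightarrow> real^'k) \<Rightarrow> bool" where
  "C1_in_space F \<longleftrightarrow>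
     (\<forall>x. \<forall>t\<in>{0<..<1}. (\<lambda>y. F y t) differentiable at x) \<and>
     continuous_on (UNIV \<times> {0<..<1}) (\<lambda>(x, t). F x t) \<and>
     continuous_on (UNIV \<times> {0<..<1}) (\<lambda>(x, t). jacobian (\<lambda>y. F y t) (at x))"

definition C2_in_space_C1_in_time :: "(real^'n \<Rightarrow> real \<Rightarrow> real) \<Rightarrow> bool" where
  "C2_in_space_C1_in_time g \<longleftrightarrow>
     (\<forall>x. \<forall>t\<in>{0<..<1}. (\<lambda>y. g y t) differentiable at x) \<and>
     (\<forall>x. \<forall>t\<in>{0<..<1}. (\<lambda>s. g x s) differentiable at t) \<and>
     continuous_on (UNIV \<times> {0<..<1}) (\<lambda>(x, t). g x t) \<and>
     continuous_on (UNIV \<times> {0<..<1}) (\<lambda>(x, t). time_deriv g x t) \<and>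
     C1_in_space (\<lambda>x t. gradient (\<lambda>y. g y t) x)"

definition is_pdf :: "(real^'n \<Rightarrow> real) \<Rightarrow> bool" where
  "is_pdf p \<longleftrightarrow> (\<forall>x. 0 \<le> p x) \<and> has_bochner_integral lborel p 1"

text \<open>
  Densities are identified up to null sets, so the endpoint values are attained in \<open>L\<^sup>1\<close>; without
  the two limits the prescribed endpoint densities would be unrelated to the
  evolution on the open time interval. No continuity of the endpoint densities is needed.
\<close>

definition density_path ::
  "(real^'n \<Rightarrow> real) \<Rightarrow> (real^'n \<Rightarrow> real) \<Rightarrow> (real^'n \<Rightarrow> real \<Rightarrow> real) \<Rightarrow> bool" where
  "density_path \<rho>0 \<rho>1 \<rho> \<longleftrightarrow>
     (\<forall>t\<in>{0..1}. is_pdf (\<lambda>x. \<rho> x t)) \<and>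
     C2_in_space_C1_in_time \<rho> \<and>
     (\<forall>x. \<rho> x 0 = \<rho>0 x) \<and> (\<forall>x. \<rho> x 1 = \<rho>1 x) \<and>
     ((\<lambda>t. LINT x|lborel. \<bar>\<rho> x t - \<rho> x 0\<bar>) \<longlongrightarrow> 0) (at_right 0) \<and>
     ((\<lambda>t. LINT x|lborel. \<bar>\<rho> x t - \<rho> x 1\<bar>) \<longlongrightarrow> 0) (at_left 1)"

definition control_cost ::
  "(real^'n \<Rightarrow> real \<Rightarrow> real) \<Rightarrow> (real^'n \<Rightarrow> real \<Rightarrow> real^'m) \<Rightarrow> ennreal" where
  "control_cost \<rho> u =
     1 / 2 * (\<integral>\<^sup>+t\<in>{0..1}. (\<integral>\<^sup>+x. ennreal ((norm (u x t))\<^sup>2 * \<rho> x t) \<partial>lborel) \<partial>lborel)"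

text \<open>The energy of an input is its expected energy along the controlled state density.\<close>

definition finite_energy_input ::
  "(real^'n \<Rightarrow> real \<Rightarrow> real) \<Rightarrow> (real^'n \<Rightarrow> real \<Rightarrow> real^'m) \<Rightarrow> bool" where
  "finite_energy_input \<rho> u \<longleftrightarrow> C1_in_space u \<and> control_cost \<rho> u < \<infinity>"

definition admissible ::
  "(real^'n \<Rightarrow> real) \<Rightarrow> (real^'n \<Rightarrow> real) \<Rightarrow>
   (real^'n \<Rightarrow> real \<Rightarrow> real) \<Rightarrow> (real^'n \<Rightarrow> real \<Rightarrow> real^'m) \<Rightarrow> bool" where
  "admissible \<rho>0 \<rho>1 \<rho> u \<longleftrightarrow> density_path \<rho>0 \<rho>1 \<rho> \<and> finite_energy_input \<rho> u"

definition fokker_planck ::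
  "real \<Rightarrow> (real^'n \<Rightarrow> real \<Rightarrow> real^'n) \<Rightarrow> (real \<Rightarrow> real^'m^'n) \<Rightarrow>
   (real^'n \<Rightarrow> real \<Rightarrow> real) \<Rightarrow> (real^'n \<Rightarrow> real \<Rightarrow> real^'m) \<Rightarrow> bool" where
  "fokker_planck \<epsilon> f B \<rho> u \<longleftrightarrow>
     (\<forall>x. \<forall>t\<in>{0<..<1}.
        time_deriv \<rho> x t + divergence (\<lambda>y. \<rho> y t *\<^sub>R (f y t + B t *v u y t)) x
        = \<epsilon> * matrix_inner (diffusion B t) (Hess (\<lambda>y. \<rho> y t) x))"

definition solves_variational_problem ::
  "real \<Rightarrow> (real^'n \<Rightarrow> real \<Rightarrow> real^'n) \<Rightarrow> (real \<Rightarrow> real^'m^'n) \<Rightarrow>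
   (real^'n \<Rightarrow> real) \<Rightarrow> (real^'n \<Rightarrow> real) \<Rightarrow>
   (real^'n \<Rightarrow> real \<Rightarrow> real) \<Rightarrow> (real^'n \<Rightarrow> real \<Rightarrow> real^'m) \<Rightarrow> bool" where
  "solves_variational_problem \<epsilon> f B \<rho>0 \<rho>1 \<rho> u \<longleftrightarrow>
     is_arg_min (\<lambda>(\<rho>', u'). control_cost \<rho>' u')
       (\<lambda>(\<rho>', u'). admissible \<rho>0 \<rho>1 \<rho>' u' \<and> fokker_planck \<epsilon> f B \<rho>' u') (\<rho>, u)"

definition lagrangian ::
  "real \<Rightarrow> (real^'n \<Rightarrow> real \<Rightarrow> real^'n) \<Rightarrow> (real \<Rightarrow> real^'m^'n) \<Rightarrow>
   (real^'n \<Rightarrow> real \<Rightarrow> real) \<Rightarrow> (real^'n \<Rightarrow> real \<Rightarrow> real^'m) \<Rightarrow>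
   (real^'n \<Rightarrow> real \<Rightarrow> real) \<Rightarrow> real" where
  "lagrangian \<epsilon> f B \<rho> u \<psi> =
     (LINT t:{0..1}|lborel. LINT x|lborel.
        1 / 2 * (norm (u x t))\<^sup>2 * \<rho> x t +
        \<psi> x t * (time_deriv \<rho> x t
                 + divergence (\<lambda>y. \<rho> y t *\<^sub>R (f y t + B t *v u y t)) x
                 - \<epsilon> * matrix_inner (diffusion B t) (Hess (\<lambda>y. \<rho> y t) x)))"

text \<open>
  \<open>\<psi>\<close> is a Lagrange multiplier for the differential constraint at \<open>(\<rho>, u)\<close> if \<open>(\<rho>, u)\<close> minimizes
  the Lagrangian without that constraint. The competitors agree with \<open>(\<rho>, u)\<close> outside a compact
  subset of space times the open time interval: for arbitrary competitors the Lagrangian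
  integrand need not be integrable, as nothing bounds \<open>\<psi>\<close> at infinity or near the endpoint times.
\<close>

definition equal_off_compact ::
  "(real^'n \<Rightarrow> real \<Rightarrow> 'a) \<Rightarrow> (real^'n \<Rightarrow> real \<Rightarrow> 'b) \<Rightarrow>
   (real^'n \<Rightarrow> real \<Rightarrow> 'a) \<Rightarrow> (real^'n \<Rightarrow> real \<Rightarrow> 'b) \<Rightarrow> bool" where
  "equal_off_compact \<rho> u \<rho>' u' \<longleftrightarrow>
     (\<exists>K. compact K \<and> K \<subseteq> UNIV \<times> {0<..<1} \<and>
        (\<forall>x. \<forall>t\<in>{0..1}. (x, t) \<notin> K \<longrightarrow> \<rho>' x t = \<rho> x t \<and> u' x t = u x t))"

definition lagrange_multiplier ::
  "real \<Rightarrow> (real^'n \<Rightarrow> real \<Rightarrow> real^'n) \<Rightarrow> (real \<Rightarrow> real^'m^'n) \<Rightarrow>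
   (real^'n \<Rightarrow> real) \<Rightarrow> (real^'n \<Rightarrow> real) \<Rightarrow>
   (real^'n \<Rightarrow> real \<Rightarrow> real) \<Rightarrow> (real^'n \<Rightarrow> real \<Rightarrow> real^'m) \<Rightarrow>
   (real^'n \<Rightarrow> real \<Rightarrow> real) \<Rightarrow> bool" where
  "lagrange_multiplier \<epsilon> f B \<rho>0 \<rho>1 \<rho> u \<psi> \<longleftrightarrow>
     is_arg_min (\<lambda>(\<rho>', u'). lagrangian \<epsilon> f B \<rho>' u' \<psi>)
       (\<lambda>(\<rho>', u'). admissible \<rho>0 \<rho>1 \<rho>' u' \<and> equal_off_compact \<rho> u \<rho>' u') (\<rho>, u)"

end

theory Submission
  imports Defs
begin

text \<open>
  In the variables density \<open>\<rho>\<close> and momentum \<open>w = \<rho> u\<close> the Fokker-Planck constraint is linear and the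
  energy \<open>\<bar>w\<bar>\<^sup>2 / (2 \<rho>)\<close> is convex, so the conditions of the theorem are the first-order conditions of a convex
  problem. The multiplier is not obtained from an abstract multiplier rule but constructed, as the
  potential of a field on space-time.

  The optimal density is positive on the open time interval by the strong maximum principle
  (\<open>parabolic_positivity\<close>). Hence every compactly supported perturbation \<open>(\<eta>, \<xi>)\<close> of density and momentum that
  satisfies the linear constraint and has total mass zero can be added with a small factor of either sign, and
  the linear term of the energy, the integral of \<open>2 u \<bullet> \<xi> - \<bar>u\<bar>\<^sup>2 \<eta>\<close>, vanishes (\<open>first_variation\<close>).

  Three families of perturbations built from bump functions exploit this. Momenta in the kernel of \<open>B\<close>
  show that \<open>u = B\<^sup>T v\<close> with \<open>v = D\<^sup>-\<^sup>1 B u\<close> (\<open>optimal_control_range\<close>). Momenta with \<open>\<eta> = 0\<close> and \<open>B \<xi>\<close>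
  divergence-free show that \<open>v\<close> is weakly curl-free in space (\<open>weak_curl_space\<close>). Density perturbations
  that are spatial derivatives of a bump, for which a compensating momentum can be written down
  explicitly, show that the time derivative of \<open>v\<close> is weakly minus the gradient of
  \<open>H = v \<bullet> f + \<bar>u\<bar>\<^sup>2 / 2 + \<epsilon> div (D v)\<close> (\<open>weak_curl_time\<close>). Together, the field \<open>(v, - H)\<close> on the open
  slab is continuous and weakly curl-free, and the Poincare lemma for such fields (\<open>weak_Poincare\<close>, by
  mollification) gives \<open>\<psi>\<close> with gradient \<open>v\<close> and time derivative \<open>- H\<close>. This is the
  Hamilton-Jacobi-Bellman equation, together with \<open>u = B\<^sup>T\<close> applied to the gradient of \<open>\<psi>\<close>.

  Finally, integration by parts shows that the Lagrangian of a competitor exceeds that of the optimal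
  pair by a weighted square, so \<open>\<psi>\<close> is a Lagrange multiplier (\<open>potential_is_lagrange_multiplier\<close>).
\<close>

section \<open>Integrals of compactly supported functions\<close>

lemma compact_continuous_bound:
  fixes f :: "'a::topological_space \<Rightarrow> real"
  assumes "compact Q" "continuous_on Q f"
  obtains M where "0 < M" "\<And>p. p \<in> Q \<Longrightarrow> \<bar>f p\<bar> \<le> M"
proof -
  have "bounded (f ` Q)" by (intro compact_imp_bounded compact_continuous_image assms)
  then obtain M where "0 < M" "\<forall>v\<in>f ` Q. norm v \<le> M" unfolding bounded_pos by blast
  then show thesis by (intro that[of M]) auto
qed

lemma line_derivative_shift:
  fixes g :: "'a::real_vector \<Rightarrow> real"
  assumes "\<And>p. ((\<lambda>s. g (p + s *\<^sub>R v)) has_real_derivative g' p) (at 0)"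
  shows "((\<lambda>s. g (p + s *\<^sub>R v)) has_real_derivative g' (p + r *\<^sub>R v)) (at r)"
proof -
  have "((\<lambda>s. g ((p + r *\<^sub>R v) + (s - r) *\<^sub>R v)) has_real_derivative g' (p + r *\<^sub>R v) * 1) (at r)"
    by (rule DERIV_chain2[where g = "\<lambda>s. s - r" and f = "\<lambda>s. g ((p + r *\<^sub>R v) + s *\<^sub>R v)"])
       (use assms[of "p + r *\<^sub>R v"] in \<open>auto intro!: derivative_eq_intros\<close>)
  then show ?thesis by (simp add: algebra_simps)
qed

lemma compact_support_integrable:
  fixes g :: "'a::euclidean_space \<Rightarrow> real"
  assumes "compact K" "K \<subseteq> \<Omega>" "continuous_on \<Omega> g" "\<And>p. p \<in> \<Omega> - K \<Longrightarrow> g p = 0"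
  shows "integrable lborel (\<lambda>p. indicator \<Omega> p *\<^sub>R g p)"
proof -
  have "(\<lambda>p. indicator \<Omega> p *\<^sub>R g p) = (\<lambda>p. indicator K p *\<^sub>R g p)"
    using assms by (auto simp: indicator_def fun_eq_iff)
  moreover have "continuous_on K g"
    using assms continuous_on_subset by blast
  ultimately show ?thesis
    using borel_integrable_compact[OF \<open>compact K\<close>] by metis
qed

lemma compact_support_extension_continuous:
  fixes g :: "'a::euclidean_space \<Rightarrow> real"
  assumes "open \<Omega>" "compact K" "K \<subseteq> \<Omega>" "continuous_on \<Omega> g" "\<And>p. p \<in> \<Omega> - K \<Longrightarrow> g p = 0"
  shows "continuous_on UNIV (\<lambda>p. indicator \<Omega> p *\<^sub>R g p)"
proof -
  have "continuous_on (\<Omega> \<union> - K) (\<lambda>p. indicator \<Omega> p *\<^sub>R g p)"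
  proof (rule continuous_on_open_Un)
    show "open (- K)" using assms by (simp add: compact_imp_closed open_Compl)
    show "continuous_on \<Omega> (\<lambda>p. indicator \<Omega> p *\<^sub>R g p)"
      using assms(4) by (rule continuous_on_eq) auto
    show "continuous_on (- K) (\<lambda>p. indicator \<Omega> p *\<^sub>R g p)"
      by (rule continuous_on_eq[of _ "\<lambda>_. 0"]) (use assms in \<open>auto simp: indicator_def\<close>)
  qed (use assms in auto)
  moreover have "\<Omega> \<union> - K = UNIV" using assms by auto
  ultimately show ?thesis by simp
qed

text \<open>
  The integral of a directional derivative of a compactly supported function vanishes: the
  difference quotients integrate to zero because Lebesgue measure is translation invariant, and
  they converge dominatedly. Only the derivative along the one direction \<open>v\<close> is needed.
\<close>

lemma integral_directional_derivative_UNIV: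
  fixes g :: "'a::euclidean_space \<Rightarrow> real"
  assumes K: "compact K" "\<And>p. p \<notin> K \<Longrightarrow> g p = 0" "\<And>p. p \<notin> K \<Longrightarrow> g' p = 0"
    and cg: "continuous_on UNIV g" and cg': "continuous_on UNIV g'"
    and der: "\<And>p. ((\<lambda>s. g (p + s *\<^sub>R v)) has_real_derivative g' p) (at 0)"
  shows "(LINT p|lborel. g' p) = 0"
proof -
  define s :: "nat \<Rightarrow> real" where "s n = inverse (real (Suc n))" for n
  have s: "0 < s n" "s n \<le> 1" for n
    unfolding s_def by (auto simp: field_simps)
  define F where "F n p = (g (p + s n *\<^sub>R v) - g p) / s n" for n p
  have gint: "integrable lborel g" for v
    using compact_support_integrable[of K UNIV g] K cg by auto
  have trans: "integrable lborel (\<lambda>p. g (p + w))" "(LINT p|lborel. g (p + w)) = (LINT p|lborel. g p)" for w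
  proof -
    have [measurable]: "g \<in> borel_measurable borel" using cg by (rule borel_measurable_continuous_onI)
    have "integrable (distr lborel borel ((+) w)) g" using gint by (simp add: lborel_distr_plus)
    then show "integrable lborel (\<lambda>p. g (p + w))" 
      by (subst (asm) integrable_distr_eq) (auto simp: add.commute)
    have "(LINT p|lborel. g p) = (LINT p|distr lborel borel ((+) w). g p)" by (simp add: lborel_distr_plus)
    also have "\<dots> = (LINT p|lborel. g (w + p))" by (subst integral_distr) auto
    finally show "(LINT p|lborel. g (p + w)) = (LINT p|lborel. g p)" by (simp add: add.commute)
  qed
  have Fint: "(LINT p|lborel. F n p) = 0" for n
    unfolding F_def using trans[of "s n *\<^sub>R v"] gint s[of n] by simp
  have line: "((\<lambda>r. g (p + r *\<^sub>R v)) has_real_derivative g' (p + r *\<^sub>R v)) (at r)" for p r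
    by (rule line_derivative_shift[OF der])
  obtain M where M: "0 < M" "\<And>p. \<bar>g' p\<bar> \<le> M"
  proof -
    obtain M where M: "0 < M" "\<And>p. p \<in> K \<Longrightarrow> \<bar>g' p\<bar> \<le> M"
      using compact_continuous_bound[OF K(1) continuous_on_subset[OF cg' subset_UNIV]] by metis
    have "\<bar>g' p\<bar> \<le> M" for p using M K(3)[of p] by (cases "p \<in> K") auto
    with M(1) show thesis by (rule that)
  qed
  \<comment> \<open>\<open>K1\<close> contains the supports of all difference quotients with step at most 1\<close>
  define K1 where "K1 = (\<lambda>(k, r). k - r *\<^sub>R v) ` (K \<times> {0..1::real})"
  have K1: "compact K1"
    unfolding K1_def by (intro compact_continuous_image compact_Times K)
      (auto intro!: continuous_intros simp: case_prod_beta)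
  have bound: "norm (F n p) \<le> M * indicator K1 p" for n p
  proof (cases "p \<in> K1")
    case True
    obtain z where z: "0 < z" "z < s n" "g (p + s n *\<^sub>R v) - g (p + 0 *\<^sub>R v) = (s n - 0) * g' (p + z *\<^sub>R v)"
      using MVT2[of 0 "s n" "\<lambda>r. g (p + r *\<^sub>R v)" "\<lambda>r. g' (p + r *\<^sub>R v)"] line s by auto
    then have "F n p = g' (p + z *\<^sub>R v)" unfolding F_def using s[of n] by simp
    then show ?thesis using M True by simp
  next
    case False
    have "p \<notin> K" "p + s n *\<^sub>R v \<notin> K"
    proof -
      show "p \<notin> K"
      proof
        assume "p \<in> K" then have "(\<lambda>(k, r). k - r *\<^sub>R v) (p, 0::real) \<in> K1" unfolding K1_def by (intro imageI) auto
        with False show False by simp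
      qed
      show "p + s n *\<^sub>R v \<notin> K"
      proof
        assume "p + s n *\<^sub>R v \<in> K" then have "(\<lambda>(k, r). k - r *\<^sub>R v) (p + s n *\<^sub>R v, s n) \<in> K1"
          unfolding K1_def using s[of n] by (intro imageI) auto
        with False show False by simp
      qed
    qed
    then show ?thesis unfolding F_def using K False by simp
  qed
  have lim: "(\<lambda>n. F n p) \<longlonglongrightarrow> g' p" for p
  proof -
    have "(\<lambda>h. (g (p + h *\<^sub>R v) - g p) / h) \<midarrow>0\<rightarrow> g' p"
      using der[of p] unfolding DERIV_def by simp
    moreover have "filterlim s (at 0) sequentially"
      unfolding filterlim_at using LIMSEQ_inverse_real_of_nat s(1) unfolding s_def by auto
    ultimately have "((\<lambda>n. (g (p + s n *\<^sub>R v) - g p) / s n) \<longlongrightarrow> g' p) sequentially"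
      by (rule filterlim_compose)
    then show ?thesis unfolding F_def .
  qed
  have "(\<lambda>n. LINT p|lborel. F n p) \<longlonglongrightarrow> (LINT p|lborel. g' p)"
  proof (rule integral_dominated_convergence[where w = "\<lambda>p. M * indicator K1 p"])
    show "g' \<in> borel_measurable lborel" using cg' by (simp add: borel_measurable_continuous_onI)
    show "F n \<in> borel_measurable lborel" for n unfolding F_def
      by (simp, rule borel_measurable_continuous_onI)
         (use s[of n] in \<open>auto intro!: continuous_intros continuous_on_compose2[OF cg]\<close>)
    show "integrable lborel (\<lambda>p. M * indicator K1 p)"
      using borel_integrable_compact[OF K1, of "\<lambda>_. M"] by (simp add: mult.commute)
  qed (use bound lim in auto)
  then show ?thesis using Fint LIMSEQ_const_iff[of 0 "LINT p|lborel. g' p"] by simp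
qed

text \<open>
  The same on an open set \<open>\<Omega>\<close>. The function need not make sense outside \<open>\<Omega>\<close>, so the integral is
  written with an indicator; the statement includes integrability, which makes such identities
  additive.
\<close>

lemma integral_directional_derivative:
  fixes G :: "'a::euclidean_space \<Rightarrow> real"
  assumes \<Omega>: "open \<Omega>" and K: "compact K" "K \<subseteq> \<Omega>" "\<And>p. p \<in> \<Omega> - K \<Longrightarrow> G p = 0"
    and cG: "continuous_on \<Omega> G" and cG': "continuous_on \<Omega> G'"
    and der: "\<And>p. p \<in> \<Omega> \<Longrightarrow> ((\<lambda>s. G (p + s *\<^sub>R v)) has_real_derivative G' p) (at 0)"
  shows "has_bochner_integral lborel (\<lambda>p. indicator \<Omega> p *\<^sub>R G' p) 0"
proof -
  define g where "g p = indicator \<Omega> p *\<^sub>R G p" for p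
  define g' where "g' p = indicator \<Omega> p *\<^sub>R G' p" for p
  have near: "\<forall>\<^sub>F s in nhds 0. p + s *\<^sub>R v \<in> U" if "open U" "p \<in> U" for p U
  proof -
    have "isCont (\<lambda>s::real. p + s *\<^sub>R v) 0" by (intro continuous_intros)
    then have "((\<lambda>s::real. p + s *\<^sub>R v) \<longlongrightarrow> p) (nhds 0)"
      unfolding continuous_within by (simp add: tendsto_nhds_iff)
    then show ?thesis using that by (simp add: topological_tendstoD)
  qed
  have zero: "G' p = 0" if "p \<in> \<Omega> - K" for p
  proof -
    have "open (\<Omega> - K)" using \<Omega> K by (simp add: compact_imp_closed open_Diff)
    from near[OF this that] have "\<forall>\<^sub>F s in nhds 0. G (p + s *\<^sub>R v) = 0"
      by eventually_elim (use K in auto)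
    then have "((\<lambda>s. G (p + s *\<^sub>R v)) has_real_derivative 0) (at 0)"
      using DERIV_cong_ev[OF refl, of "\<lambda>s. G (p + s *\<^sub>R v)" "\<lambda>_. 0"] by simp
    then show ?thesis using der[of p] that DERIV_unique by blast
  qed
  have der': "((\<lambda>s. g (p + s *\<^sub>R v)) has_real_derivative g' p) (at 0)" for p
  proof (cases "p \<in> \<Omega>")
    case True
    have "\<forall>\<^sub>F s in nhds 0. g (p + s *\<^sub>R v) = G (p + s *\<^sub>R v)"
      using near[OF \<Omega> True] by eventually_elim (auto simp: g_def)
    then show ?thesis using der[OF True] True
      DERIV_cong_ev[OF refl, of "\<lambda>s. g (p + s *\<^sub>R v)" "\<lambda>s. G (p + s *\<^sub>R v)"] by (simp add: g'_def)
  next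
    case False
    have "open (- K)" "p \<in> - K" using K False by (auto simp: compact_imp_closed open_Compl)
    from near[OF this] have "\<forall>\<^sub>F s in nhds 0. g (p + s *\<^sub>R v) = 0"
      by eventually_elim (use K in \<open>auto simp: g_def indicator_def\<close>)
    then show ?thesis using False
      DERIV_cong_ev[OF refl, of "\<lambda>s. g (p + s *\<^sub>R v)" "\<lambda>s. 0"] by (simp add: g'_def)
  qed
  have "(LINT p|lborel. g' p) = 0"
  proof (rule integral_directional_derivative_UNIV[where g = g and v = v])
    show "continuous_on UNIV g" "continuous_on UNIV g'" unfolding g_def g'_def
      by (rule compact_support_extension_continuous[OF \<Omega> K(1,2)]; use cG cG' K zero in auto)+
  qed (use K zero der' in \<open>auto simp: g_def g'_def indicator_def\<close>)
  moreover have "integrable lborel g'" unfolding g'_def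
    by (rule compact_support_integrable[OF K(1,2) cG' zero])
  ultimately show ?thesis unfolding g'_def[symmetric] has_bochner_integral_iff by simp
qed

section \<open>Bump functions and mollification\<close>

text \<open>
  The radial bump \<open>max 0 (r\<^sup>2 - \<bar>p - a\<bar>\<^sup>2) ^ k\<close>, supported for \<open>k > 0\<close> in the ball of radius \<open>r\<close> around \<open>a\<close>. It is
  \<open>k - 1\<close> times continuously differentiable, and differentiating it lowers the exponent by one. This explicit
  family serves as the test functions and as the mollifier; the exponent 4 leaves enough
  derivatives for both purposes.
\<close>

definition bump :: "nat \<Rightarrow> 'a::real_inner \<Rightarrow> real \<Rightarrow> 'a \<Rightarrow> real" where
  "bump k a r p = (max 0 (r\<^sup>2 - (p - a) \<bullet> (p - a))) ^ k"

lemma bump_nonneg: "0 \<le> bump k a r p"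
  by (simp add: bump_def)

lemma bump_commute: "bump k a r p = bump k p r a"
  unfolding bump_def by (metis inner_minus_left inner_minus_right minus_diff_eq minus_minus)

lemma bump_pos: "0 < r \<Longrightarrow> dist a p < r \<Longrightarrow> 0 < bump k a r p"
  unfolding bump_def dist_norm
  by (metis norm_minus_commute dot_square_norm diff_gt_0_iff_gt max.strict_coboundedI2 norm_ge_zero power_strict_mono zero_less_numeral zero_less_power)

lemma bump_eq_0: "0 < r \<Longrightarrow> 0 < k \<Longrightarrow> p \<notin> cball a r \<Longrightarrow> bump k a r p = 0"
proof -
  assume "0 < r" "0 < k" "p \<notin> cball a r"
  then have "r\<^sup>2 \<le> (norm (p - a))\<^sup>2" 
    by (intro power_mono) (auto simp: dist_norm norm_minus_commute)
  then show ?thesis using \<open>0 < k\<close> by (simp add: bump_def power2_norm_eq_inner)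
qed

lemma continuous_on_bump [continuous_intros]:
  assumes "continuous_on S f" "continuous_on S g"
  shows "continuous_on S (\<lambda>x. bump k (f x) r (g x))"
  unfolding bump_def by (intro continuous_intros assms)

lemma max_power_has_derivative:
  "((\<lambda>s. max 0 s ^ Suc (Suc k)) has_real_derivative real (Suc (Suc k)) * max 0 s ^ Suc k) (at s)" for s :: real
proof -
  consider "s < 0" | "s > 0" | "s = 0" by linarith
  then show ?thesis
  proof cases
    case 1
    then have "\<forall>\<^sub>F x in nhds s. max 0 x ^ Suc (Suc k) = 0"
      using eventually_nhds_in_open[of "{..<0}" s] by (auto elim!: eventually_mono)
    from DERIV_cong_ev[OF refl this refl] show ?thesis using 1 by simp
  next
    case 2
    then have "\<forall>\<^sub>F x in nhds s. max 0 x ^ Suc (Suc k) = x ^ Suc (Suc k)"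
      using eventually_nhds_in_open[of "{0<..}" s] by (auto elim!: eventually_mono simp del: power_Suc)
    moreover have "((\<lambda>s. s ^ Suc (Suc k)) has_real_derivative real (Suc (Suc k)) * max 0 s ^ Suc k) (at s)"
      using 2 DERIV_pow[of "Suc (Suc k)" s] by (simp add: max_def)
    ultimately show ?thesis
      by (rule DERIV_cong_ev[OF refl _ refl, THEN iffD2])
  next
    case 3
    show ?thesis unfolding CARAT_DERIV
    proof (intro exI[of _ "\<lambda>z. max 0 z ^ Suc k"] conjI allI)
      show "max 0 z ^ Suc (Suc k) - max 0 s ^ Suc (Suc k) = max 0 z ^ Suc k * (z - s)" for z
        using 3 by (auto simp: max_def)
      show "isCont (\<lambda>z. max 0 z ^ Suc k) s" by (intro continuous_intros)
    qed (use 3 in auto)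
  qed
qed

lemma bump_has_derivative:
  "((\<lambda>p. bump (Suc (Suc k)) a r p) has_derivative
      (\<lambda>h. - 2 * real (Suc (Suc k)) * ((p - a) \<bullet> h) * bump (Suc k) a r p)) (at p)"
proof -
  have 1: "((\<lambda>p. r\<^sup>2 - (p - a) \<bullet> (p - a)) has_derivative (\<lambda>h. - 2 * ((p - a) \<bullet> h))) (at p)"
    by (auto intro!: derivative_eq_intros simp: inner_commute)
  have 2: "((\<lambda>s. max 0 s ^ Suc (Suc k)) has_derivative
      (\<lambda>h. h * (real (Suc (Suc k)) * max 0 (r\<^sup>2 - (p - a) \<bullet> (p - a)) ^ Suc k))) (at (r\<^sup>2 - (p - a) \<bullet> (p - a)))"
    using max_power_has_derivative[of k "r\<^sup>2 - (p - a) \<bullet> (p - a)"] 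
    unfolding has_field_derivative_def
    by (rule has_derivative_eq_rhs) (auto simp: fun_eq_iff simp del: power_Suc)
  show ?thesis
    using has_derivative_compose[OF 1 2] unfolding bump_def
    by (rule has_derivative_eq_rhs) (simp add: fun_eq_iff algebra_simps del: power_Suc)
qed

lemma bump_line_derivative:
  "((\<lambda>s. bump (Suc (Suc k)) a r (p + s *\<^sub>R h)) has_real_derivative
      - 2 * real (Suc (Suc k)) * ((p + s *\<^sub>R h - a) \<bullet> h) * bump (Suc k) a r (p + s *\<^sub>R h)) (at s)"
proof -
  have "((\<lambda>s. p + s *\<^sub>R h) has_derivative (\<lambda>s. s *\<^sub>R h)) (at s)"
    by (auto intro!: derivative_eq_intros)
  from has_derivative_compose[OF this bump_has_derivative[of k a r "p + s *\<^sub>R h"]] show ?thesis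
    unfolding has_field_derivative_def by (rule has_derivative_eq_rhs) (auto simp: fun_eq_iff)
qed

lemma pos_Lebesgue_integral_bump:
  assumes "0 < r" "0 < k"
  shows "0 < (LINT p|lborel. bump k (a::'a::euclidean_space) r p)"
    and "integrable lborel (\<lambda>p. bump k (a::'a) r p)"
proof -
  show i: "integrable lborel (\<lambda>p. bump k (a::'a) r p)"
    using compact_support_integrable[of "cball a r" UNIV "bump k a r"] bump_eq_0[OF assms, of _ a]
      continuous_on_bump[OF continuous_on_const continuous_on_id, of UNIV k a r] by auto
  have "0 \<le> (LINT p|lborel. bump k a r p)" by (intro integral_nonneg_AE) (simp add: bump_nonneg)
  moreover have "(LINT p|lborel. bump k a r p) \<noteq> 0"
  proof
    assume "(LINT p|lborel. bump k a r p) = 0"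
    then have "AE p in lborel. bump k a r p = 0"
      using integral_nonneg_eq_0_iff_AE[OF i] by (simp add: bump_nonneg)
    moreover have "bump k a r p \<noteq> 0" if "p \<in> ball a r" for p
      using bump_pos[OF assms(1), of a p k] that by auto
    ultimately have "AE p in lborel. p \<notin> ball a r" by (auto elim!: eventually_mono)
    then have "emeasure lborel (ball a r) = 0" by (subst (asm) AE_iff_measurable[OF _ refl]) (auto simp: ball_def)
    then have "measure lborel (ball a r) = 0" by (simp add: measure_def)
    then have "measure lebesgue (ball a r) = 0" by simp
    then show False using assms content_ball_pos[of r a] by simp
  qed
  ultimately show "0 < (LINT p|lborel. bump k a r p)" by simp
qed

lemma fundamental_lemma_bump:
  fixes g :: "'a::euclidean_space \<Rightarrow> real"
  assumes "open \<Omega>" "continuous_on \<Omega> g"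
    and z: "\<And>a r. 0 < r \<Longrightarrow> cball a r \<subseteq> \<Omega> \<Longrightarrow> (LINT p|lborel. bump k a r p * g p) = 0" "0 < k"
    and a: "a \<in> \<Omega>"
  shows "g a = 0"
proof (rule ccontr)
  assume ne: "g a \<noteq> 0"
  have "isCont g a" using assms(1,2) a by (simp add: continuous_on_eq_continuous_at)
  then obtain d where d: "0 < d" "\<And>p. dist p a < d \<Longrightarrow> dist (g p) (g a) < \<bar>g a\<bar> / 2"
    using ne unfolding continuous_at_eps_delta by (metis half_gt_zero zero_less_abs_iff)
  obtain e where e: "0 < e" "ball a e \<subseteq> \<Omega>" using assms(1) a openE by blast
  define r where "r = min d e / 2"
  have r: "0 < r" "cball a r \<subseteq> \<Omega>" "r < d" using d e unfolding r_def by (auto simp: subset_eq)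
  have int: "integrable lborel (\<lambda>p. bump k a r p * g p)"
  proof -
    have "integrable lborel (\<lambda>p. indicator \<Omega> p *\<^sub>R (bump k a r p * g p))"
      by (rule compact_support_integrable[of "cball a r"])
         (use r bump_eq_0[OF r(1) z(2), of _ a] in \<open>auto intro!: continuous_intros assms\<close>)
    moreover have "(\<lambda>p. indicator \<Omega> p *\<^sub>R (bump k a r p * g p)) = (\<lambda>p. bump k a r p * g p)"
    proof
      fix p
      show "indicator \<Omega> p *\<^sub>R (bump k a r p * g p) = bump k a r p * g p"
        using bump_eq_0[OF r(1) z(2), of p a] r(2) by (cases "p \<in> cball a r") (auto simp: indicator_def)
    qed
    ultimately show ?thesis by simp
  qed
  have "(g a)\<^sup>2 / 2 * (LINT p|lborel. bump k a r p) = (LINT p|lborel. (g a)\<^sup>2 / 2 * bump k a r p)" by simp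
  also have "\<dots> \<le> (LINT p|lborel. g a * (bump k a r p * g p))"
  proof (rule integral_mono)
    fix p
    show "(g a)\<^sup>2 / 2 * bump k a r p \<le> g a * (bump k a r p * g p)"
    proof (cases "p \<in> cball a r")
      case True
      then have *: "\<bar>g p - g a\<bar> < \<bar>g a\<bar> / 2" using d(2)[of p] r(3) by (auto simp: dist_real_def dist_commute)
      have "g a * (g a - g p) \<le> \<bar>g a\<bar> * \<bar>g p - g a\<bar>" by (metis abs_ge_self abs_minus_commute abs_mult)
      also have "\<dots> \<le> \<bar>g a\<bar> * (\<bar>g a\<bar> / 2)" using * by (intro mult_left_mono) auto
      finally have "(g a)\<^sup>2 / 2 \<le> g a * g p" by (simp add: power2_eq_square algebra_simps abs_mult_self_eq flip: abs_mult)
      then have "(g a)\<^sup>2 / 2 * bump k a r p \<le> g a * g p * bump k a r p" by (rule mult_right_mono[OF _ bump_nonneg])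
      then show ?thesis by (simp add: mult_ac)
    qed (use bump_eq_0[OF r(1) z(2), of p a] in auto)
  qed (intro integrable_mult_right int pos_Lebesgue_integral_bump(2)[OF r(1) z(2)])+
  also have "\<dots> = 0" using z(1)[OF r(1,2)] by simp
  finally have "(g a)\<^sup>2 / 2 * (LINT p|lborel. bump k a r p) \<le> 0" .
  moreover have "0 < (g a)\<^sup>2 / 2 * (LINT p|lborel. bump k a r p)"
    using ne pos_Lebesgue_integral_bump(1)[OF r(1) z(2), of a] by (intro mult_pos_pos) auto
  ultimately show False by simp
qed

lemma integral_cbox_eq_Lebesgue:
  fixes f :: "'a::euclidean_space \<Rightarrow> real"
  assumes "continuous_on (cbox a b) f" "\<And>p. p \<notin> cbox a b \<Longrightarrow> f p = 0"
  shows "integral (cbox a b) f = (LINT p|lborel. f p)"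
proof -
  have "set_integrable lborel (cbox a b) f"
    unfolding set_integrable_def by (rule borel_integrable_compact[OF compact_cbox assms(1)])
  then have "(LINT p:cbox a b|lborel. f p) = integral (cbox a b) f"
    by (rule set_borel_integral_eq_integral(2))
  moreover have "(LINT p:cbox a b|lborel. f p) = (LINT p|lborel. f p)"
    unfolding set_lebesgue_integral_def using assms(2) by (intro Bochner_Integration.integral_cong) (auto simp: indicator_def)
  ultimately show ?thesis by simp
qed

text \<open>
  The convolution of \<open>w\<close>, restricted to the box \<open>cbox a b\<close>, with the bump of radius \<open>r\<close>, not normalised to
  total mass one, and its derivative at \<open>y\<close> in direction \<open>h\<close>. A Henstock-Kurzweil integral
  over the box is used, so that differentiation under the integral sign applies directly.
\<close>

definition mollify :: "'a \<Rightarrow> 'a \<Rightarrow> real \<Rightarrow> ('a::euclidean_space \<Rightarrow> real) \<Rightarrow> 'a \<Rightarrow> real" where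
  "mollify a b r w y = integral (cbox a b) (\<lambda>z. bump 4 z r y * w z)"

definition mollify_deriv :: "'a \<Rightarrow> 'a \<Rightarrow> real \<Rightarrow> ('a::euclidean_space \<Rightarrow> real) \<Rightarrow> 'a \<Rightarrow> 'a \<Rightarrow> real" where
  "mollify_deriv a b r w y h = integral (cbox a b) (\<lambda>z. - 8 * ((y - z) \<bullet> h) * bump 3 z r y * w z)"

lemma mollify_line_derivative:
  fixes w :: "'a::euclidean_space \<Rightarrow> real"
  assumes w: "continuous_on (cbox a b) w"
  shows "((\<lambda>s. mollify a b r w (y + s *\<^sub>R h)) has_real_derivative mollify_deriv a b r w (y + s *\<^sub>R h) h) (at s)"
  unfolding mollify_def mollify_deriv_def
proof (rule leibniz_rule_field_derivative[where U = UNIV])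
  show "((\<lambda>s. bump 4 z r (y + s *\<^sub>R h) * w z) has_real_derivative
         - 8 * ((y + s *\<^sub>R h - z) \<bullet> h) * bump 3 z r (y + s *\<^sub>R h) * w z) (at s)" for s z
    using bump_line_derivative[of 2 z r y h s]
    by (auto intro!: derivative_eq_intros simp: numeral_eq_Suc)
  show "(\<lambda>z. bump 4 z r (y + s *\<^sub>R h) * w z) integrable_on cbox a b" for s
    by (intro integrable_continuous continuous_intros w)
  show "continuous_on (UNIV \<times> cbox a b) (\<lambda>(s, z). - 8 * ((y + s *\<^sub>R h - z) \<bullet> h) * bump 3 z r (y + s *\<^sub>R h) * w z)"
    unfolding case_prod_beta
    by (intro continuous_intros continuous_on_compose2[OF w]) auto
qed auto

lemma continuous_on_mollify_deriv:
  assumes w: "continuous_on (cbox a b) w" and "continuous_on S g"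
  shows "continuous_on S (\<lambda>x. mollify_deriv a b r w (g x) h)"
proof -
  have "continuous_on UNIV (\<lambda>y. mollify_deriv a b r w y h)"
    unfolding mollify_deriv_def
    by (rule integral_continuous_on_param)
       (unfold case_prod_beta, auto intro!: continuous_intros continuous_on_compose2[OF w])
  from continuous_on_compose2[OF this assms(2)] show ?thesis by auto
qed

lemma continuous_on_mollify:
  assumes w: "continuous_on (cbox a b) w" and "continuous_on S g"
  shows "continuous_on S (\<lambda>x. mollify a b r w (g x))"
proof -
  have "continuous_on UNIV (\<lambda>y. mollify a b r w y)"
    unfolding mollify_def
    by (rule integral_continuous_on_param)
       (unfold case_prod_beta, auto intro!: continuous_intros continuous_on_compose2[OF w])
  from continuous_on_compose2[OF this assms(2)] show ?thesis by auto
qed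

text \<open>
  Since the mollifier is not normalised, \<open>mollify a b r w y\<close> approximates \<open>w y\<close> times the mass of
  the bump.
\<close>

lemma mollify_error:
  fixes w :: "'a::euclidean_space \<Rightarrow> real"
  assumes w: "continuous_on (cbox a b) w" and y: "cball y r \<subseteq> cbox a b" and r: "0 < r"
    and e: "\<And>z. z \<in> cball y r \<Longrightarrow> \<bar>w z - w y\<bar> \<le> e"
  shows "\<bar>mollify a b r w y - (LINT p|lborel. bump 4 (0::'a) r p) * w y\<bar> \<le> e * (LINT p|lborel. bump 4 (0::'a) r p)"
proof -
  have c: "(LINT z|lborel. bump 4 z r y) = (LINT p|lborel. bump 4 (0::'a) r p)"
  proof -
    have "(LINT p|lborel. bump 4 (0::'a) r p) = (LINT p|distr lborel borel ((+) (- y)). bump 4 0 r p)"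
      by (simp add: lborel_distr_plus)
    also have "\<dots> = (LINT p|lborel. bump 4 0 r (- y + p))"
      by (subst integral_distr) (auto intro!: borel_measurable_continuous_onI continuous_intros)
    also have "\<dots> = (LINT z|lborel. bump 4 z r y)"
      by (subst bump_commute) (simp add: bump_def algebra_simps)
    finally show ?thesis by simp
  qed
  have z0: "bump 4 z r y = 0" if "z \<notin> cbox a b" for z
  proof -
    have "z \<notin> cball y r" using that y by blast
    then show ?thesis using bump_eq_0[OF r, of 4 z y] bump_commute[of 4 z r y] by simp
  qed
  have ib: "integrable lborel (\<lambda>z. bump 4 z r y)"
    by (subst bump_commute) (use pos_Lebesgue_integral_bump(2)[OF r, of 4 y] in auto)
  have m: "mollify a b r w y = (LINT z|lborel. bump 4 z r y * w z)"
    unfolding mollify_def by (rule integral_cbox_eq_Lebesgue) (auto intro!: continuous_intros w simp: z0)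
  have im: "integrable lborel (\<lambda>z. bump 4 z r y * w z)"
  proof -
    have "integrable lborel (\<lambda>z. indicator (cbox a b) z *\<^sub>R (bump 4 z r y * w z))"
      by (intro borel_integrable_compact compact_cbox continuous_intros w)
    moreover have "(\<lambda>z. indicator (cbox a b) z *\<^sub>R (bump 4 z r y * w z)) = (\<lambda>z. bump 4 z r y * w z)"
      using z0 by (auto simp: indicator_def fun_eq_iff)
    ultimately show ?thesis by simp
  qed
  have "mollify a b r w y - (LINT p|lborel. bump 4 (0::'a) r p) * w y
      = (LINT z|lborel. bump 4 z r y * w z - bump 4 z r y * w y)"
    unfolding m using im ib by (subst Bochner_Integration.integral_diff) (auto simp: c)
  moreover have "\<bar>\<dots>\<bar> \<le> (LINT z|lborel. e * bump 4 z r y)"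
  proof (rule order_trans[OF integral_abs_bound integral_mono])
    fix z
    show "\<bar>bump 4 z r y * w z - bump 4 z r y * w y\<bar> \<le> e * bump 4 z r y"
    proof (cases "z \<in> cball y r")
      case True
      have "\<bar>bump 4 z r y * w z - bump 4 z r y * w y\<bar> = bump 4 z r y * \<bar>w z - w y\<bar>"
        using bump_nonneg[of 4 z r y] by (simp add: abs_mult flip: right_diff_distrib)
      also have "\<dots> \<le> bump 4 z r y * e" by (intro mult_left_mono e True bump_nonneg)
      finally show ?thesis by (simp add: mult.commute)
    qed (use bump_eq_0[OF r, of 4 z y] bump_commute[of 4 z r y] in auto)
  qed (use im ib in auto)
  ultimately show ?thesis by (simp add: c)
qed

section \<open>A Poincare lemma for continuous, weakly curl-free fields\<close>

text \<open>
  The integral of the field \<open>W\<close> along the segment from \<open>p\<close> to \<open>q\<close>.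
\<close>

definition line_integral :: "('a::real_inner \<Rightarrow> 'a) \<Rightarrow> 'a \<Rightarrow> 'a \<Rightarrow> real" where
  "line_integral W p q = integral {0..1} (\<lambda>s. W (p + s *\<^sub>R (q - p)) \<bullet> (q - p))"

text \<open>
  For a differentiable field with symmetric derivative, the integrals along the sides of a triangle
  add up. The field is given by its components \<open>w y h\<close> in direction \<open>h\<close> at \<open>y\<close>, and \<open>w' k y h\<close> is the
  derivative of \<open>\<lambda>y. w y k\<close> in direction \<open>h\<close>.
\<close>

lemma triangle_C1:
  fixes w :: "'a::real_inner \<Rightarrow> 'a \<Rightarrow> real"
  assumes S: "convex S" "p0 \<in> S" "p \<in> S" "q \<in> S"
    and cw: "\<And>h. continuous_on UNIV (\<lambda>y. w y h)"
    and lw: "\<And>y. linear (w y)"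
    and der: "\<And>y h k. ((\<lambda>s. w (y + s *\<^sub>R h) k) has_real_derivative w' k y h) (at 0)"
    and lw': "\<And>k y. linear (w' k y)"
    and cw': "\<And>k h. continuous_on UNIV (\<lambda>y. w' k y h)"
    and sym: "\<And>y h k. y \<in> S \<Longrightarrow> w' k y h = w' h y k"
  shows "integral {0..1} (\<lambda>s. w (p0 + s *\<^sub>R (q - p0)) (q - p0)) - integral {0..1} (\<lambda>s. w (p0 + s *\<^sub>R (p - p0)) (p - p0))
       = integral {0..1} (\<lambda>s. w (p + s *\<^sub>R (q - p)) (q - p))"
proof -
  define d where "d = q - p"
  define e where "e = p - p0"
  define f where "f \<tau> t = w (p0 + t *\<^sub>R (e + \<tau> *\<^sub>R d)) (e + \<tau> *\<^sub>R d)" for \<tau> t :: real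
  define ft where "ft \<tau> t = t * (w' e (p0 + t *\<^sub>R (e + \<tau> *\<^sub>R d)) d + \<tau> * w' d (p0 + t *\<^sub>R (e + \<tau> *\<^sub>R d)) d)
      + w (p0 + t *\<^sub>R (e + \<tau> *\<^sub>R d)) d" for \<tau> t :: real
  have line: "((\<lambda>s. w (y + s *\<^sub>R h) k) has_real_derivative w' k (y + s *\<^sub>R h) h) (at s)" for y h k s
    by (rule line_derivative_shift[where g = "\<lambda>y. w y k" and g' = "\<lambda>y. w' k y h", OF der])
  have fsplit: "f \<tau> t = w (p0 + t *\<^sub>R (e + \<tau> *\<^sub>R d)) e + \<tau> * w (p0 + t *\<^sub>R (e + \<tau> *\<^sub>R d)) d" for \<tau> t
    unfolding f_def by (simp add: linear_add[OF lw] linear_scale[OF lw])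
  have cont: "continuous_on (UNIV \<times> cbox 0 1) (\<lambda>x. w (p0 + snd x *\<^sub>R (e + fst x *\<^sub>R d)) k)" for k
    by (rule continuous_on_compose2[OF cw]) (auto intro!: continuous_intros)
  have cont': "continuous_on (UNIV \<times> cbox 0 1) (\<lambda>x. w' k (p0 + snd x *\<^sub>R (e + fst x *\<^sub>R d)) h)" for k h
    by (rule continuous_on_compose2[OF cw']) (auto intro!: continuous_intros)
  have derf: "((\<lambda>\<tau>. f \<tau> t) has_real_derivative ft \<tau> t) (at \<tau>)" for \<tau> t
  proof -
    have 1: "((\<lambda>\<tau>. w (p0 + t *\<^sub>R (e + \<tau> *\<^sub>R d)) k) has_real_derivative t * w' k (p0 + t *\<^sub>R (e + \<tau> *\<^sub>R d)) d) (at \<tau>)" for k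
      using line[of "p0 + t *\<^sub>R e" "t *\<^sub>R d" k \<tau>]
      by (simp add: linear_scale[OF lw'] algebra_simps)
    show ?thesis unfolding fsplit ft_def
      by (rule derivative_eq_intros 1 refl | simp add: algebra_simps)+
  qed
  have Gder: "((\<lambda>\<tau>. integral (cbox 0 1) (f \<tau>)) has_real_derivative integral (cbox 0 1) (ft \<tau>)) (at \<tau>)" for \<tau>
  proof (rule leibniz_rule_field_derivative[where U = UNIV])
    show "f \<tau> integrable_on cbox 0 1" for \<tau>
      unfolding fsplit 
      by (intro integrable_continuous continuous_intros continuous_on_compose2[OF cw]) auto
    show "continuous_on (UNIV \<times> cbox 0 1) (\<lambda>(x, t). ft x t)"
      unfolding ft_def case_prod_beta by (intro continuous_intros cont cont')
  qed (use derf in auto)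
  \<comment> \<open>by symmetry of \<open>w'\<close> the integrand is the \<open>t\<close>-derivative of \<open>t\<close> times the component along \<open>d\<close>\<close>
  have ftint: "integral (cbox 0 1) (ft \<tau>) = w (p + \<tau> *\<^sub>R d) d" if \<tau>: "0 \<le> \<tau>" "\<tau> \<le> 1" for \<tau>
  proof -
    have "(ft \<tau> has_integral (1 * w (p0 + 1 *\<^sub>R (e + \<tau> *\<^sub>R d)) d - 0 * w (p0 + 0 *\<^sub>R (e + \<tau> *\<^sub>R d)) d)) {0..1}"
    proof (rule fundamental_theorem_of_calculus)
      fix t :: real assume t: "t \<in> {0..1}"
      define y where "y = p0 + t *\<^sub>R (e + \<tau> *\<^sub>R d)"
      have "(1 - \<tau>) *\<^sub>R p + \<tau> *\<^sub>R q \<in> S" using S(1,3,4) \<tau> unfolding convex_alt by auto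
      then have pq: "p + \<tau> *\<^sub>R d \<in> S" unfolding d_def by (simp add: algebra_simps)
      have "y = (1 - t) *\<^sub>R p0 + t *\<^sub>R (p + \<tau> *\<^sub>R d)" unfolding y_def e_def by (simp add: algebra_simps)
      then have yS: "y \<in> S" using S(1,2) pq t unfolding convex_alt by auto
      have "((\<lambda>t. t * w (p0 + t *\<^sub>R (e + \<tau> *\<^sub>R d)) d) has_real_derivative
          w y d + t * w' d y (e + \<tau> *\<^sub>R d)) (at t)"
        by (rule derivative_eq_intros line refl | simp add: y_def)+
      moreover have "w' d y (e + \<tau> *\<^sub>R d) = w' e y d + \<tau> * w' d y d"
        by (simp add: linear_add[OF lw'] linear_scale[OF lw'] sym[OF yS, of d e])
      ultimately show "((\<lambda>t. t * w (p0 + t *\<^sub>R (e + \<tau> *\<^sub>R d)) d) has_vector_derivative ft \<tau> t) (at t within {0..1})"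
        unfolding ft_def y_def
        by (simp add: has_real_derivative_iff_has_vector_derivative[symmetric] has_field_derivative_at_within algebra_simps)
    qed simp
    then show ?thesis unfolding e_def by (simp add: integral_unique algebra_simps)
  qed
  have "((\<lambda>\<tau>. w (p + \<tau> *\<^sub>R d) d) has_integral (integral (cbox 0 1) (f 1) - integral (cbox 0 1) (f 0))) {0..1}"
  proof (rule fundamental_theorem_of_calculus)
    fix \<tau> :: real assume "\<tau> \<in> {0..1}"
    then show "((\<lambda>\<tau>. integral (cbox 0 1) (f \<tau>)) has_vector_derivative w (p + \<tau> *\<^sub>R d) d) (at \<tau> within {0..1})"
      using Gder[of \<tau>] ftint[of \<tau>]
      by (simp add: has_real_derivative_iff_has_vector_derivative[symmetric] has_field_derivative_at_within)
  qed simp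
  from integral_unique[OF this] show ?thesis
    unfolding f_def d_def e_def by simp
qed

lemma segment_integral_close:
  fixes f g :: "real \<Rightarrow> real"
  assumes "continuous_on {0..1} f" "continuous_on {0..1} g"
    and "\<And>s. s \<in> {0..1} \<Longrightarrow> \<bar>f s - c * g s\<bar> \<le> B"
  shows "\<bar>integral {0..1} f - c * integral {0..1} g\<bar> \<le> B"
proof -
  have i: "f integrable_on {0..1}" "(\<lambda>s. c * g s) integrable_on {0..1}"
    by (auto intro!: integrable_continuous_interval continuous_intros assms)
  have "integral {0..1} f - c * integral {0..1} g = integral {0..1} (\<lambda>s. f s - c * g s)"
    using i by (subst Henstock_Kurzweil_Integration.integral_diff) auto
  moreover have "norm (integral {0..1} (\<lambda>s. f s - c * g s)) \<le> B * (1 - 0)"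
    by (rule integral_bound) (auto intro!: continuous_intros assms)
  ultimately show ?thesis by simp
qed

text \<open>
  The hypothesis says that the curl of \<open>W\<close> vanishes when tested against \<open>bump 4 c r\<close>, whose gradient
  is \<open>- 8 * bump 3 c r p\<close> times \<open>p - c\<close>. It makes the mollification of \<open>W\<close> curl-free, so the triangle
  identity holds for the mollification, and for \<open>W\<close> in the limit.
\<close>

lemma weakly_curl_free_triangle:
  fixes W :: "'a::euclidean_space \<Rightarrow> 'a"
  assumes W: "continuous_on (cbox a b) W"
    and wcf: "\<And>c r u v. 0 < r \<Longrightarrow> cball c r \<subseteq> cbox a b \<Longrightarrow>
        (LINT p|lborel. ((W p \<bullet> u) * ((p - c) \<bullet> v) - (W p \<bullet> v) * ((p - c) \<bullet> u)) * bump 3 c r p) = 0"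
    and pts: "p0 \<in> box a b" "p \<in> box a b" "q \<in> box a b"
  shows "line_integral W p0 q - line_integral W p0 p = line_integral W p q"
proof -
  define T where "T = convex hull {p0, p, q}"
  have T: "compact T" "convex T" "p0 \<in> T" "p \<in> T" "q \<in> T" "T \<subseteq> box a b"
  proof -
    show "compact T" unfolding T_def by (intro finite_imp_compact_convex_hull) simp
    show "convex T" unfolding T_def by (rule convex_convex_hull)
    show "p0 \<in> T" "p \<in> T" "q \<in> T" unfolding T_def by (simp_all add: hull_inc)
    show "T \<subseteq> box a b" unfolding T_def using pts by (intro hull_minimal convex_box) simp
  qed
  obtain r0 where r0: "0 < r0" "{x. infdist x T \<le> r0} \<subseteq> box a b"
    using compact_in_open_separated[OF _ T(1) open_box T(6)] T(3) by blast
  have ball: "cball y r \<subseteq> cbox a b" if "y \<in> T" "r \<le> r0" for y r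
  proof
    fix z assume "z \<in> cball y r"
    then have "infdist z T \<le> r0" using infdist_le[OF that(1), of z] that by (auto simp: dist_commute)
    then show "z \<in> cbox a b" using r0(2) box_subset_cbox by blast
  qed
  have seg: "x + s *\<^sub>R (y - x) \<in> T" if "x \<in> T" "y \<in> T" "s \<in> {0..1}" for x y s
  proof -
    have "(1 - s) *\<^sub>R x + s *\<^sub>R y \<in> T" using T(2) that unfolding convex_alt by auto
    then show ?thesis by (simp add: algebra_simps)
  qed
  have TW: "continuous_on T W" using W T(6) box_subset_cbox by (metis continuous_on_subset)
  define L where "L = norm (q - p0) + norm (p - p0) + norm (q - p)"
  have key: "\<bar>line_integral W p0 q - line_integral W p0 p - line_integral W p q\<bar> \<le> e * L" if e: "0 < e" for e
  proof -
    obtain d where d: "0 < d" "\<And>y z. y \<in> cbox a b \<Longrightarrow> z \<in> cbox a b \<Longrightarrow> dist z y < d \<Longrightarrow> dist (W z) (W y) < e"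
      using compact_uniformly_continuous[OF W compact_cbox] e unfolding uniformly_continuous_on_def by metis
    define r where "r = min r0 (d / 2)"
    have r: "0 < r" "r \<le> r0" "r < d" using r0(1) d(1) by (auto simp: r_def)
    define c where "c = (LINT p|lborel. bump 4 (0::'a) r p)"
    have c: "0 < c" unfolding c_def by (intro pos_Lebesgue_integral_bump(1) r(1)) simp
    define w where "w y h = mollify a b r (\<lambda>z. W z \<bullet> h) y" for y h
    define w' where "w' k y h = mollify_deriv a b r (\<lambda>z. W z \<bullet> k) y h" for k y h
    have Wk: "continuous_on (cbox a b) (\<lambda>z. W z \<bullet> k)" for k by (intro continuous_intros W)
    have int1: "(\<lambda>z. bump 4 z r y * (W z \<bullet> h)) integrable_on cbox a b" for y h
      by (intro integrable_continuous continuous_intros W)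
    have int2: "(\<lambda>z. - 8 * ((y - z) \<bullet> h) * bump 3 z r y * (W z \<bullet> k)) integrable_on cbox a b" for y h k
      by (intro integrable_continuous continuous_intros W)
    have lw: "linear (w y)" for y
    proof (rule linearI)
      show "w y (u + v) = w y u + w y v" for u v
        unfolding w_def mollify_def using int1
        by (subst Henstock_Kurzweil_Integration.integral_add[symmetric]) (auto simp: algebra_simps inner_add_right)
      show "w y (s *\<^sub>R u) = s *\<^sub>R w y u" for s u
        unfolding w_def mollify_def real_scaleR_def integral_mult_right[symmetric]
        by (rule Henstock_Kurzweil_Integration.integral_cong) simp
    qed
    have lw': "linear (w' k y)" for k y
    proof (rule linearI)
      show "w' k y (u + v) = w' k y u + w' k y v" for u v
        unfolding w'_def mollify_deriv_def using int2
        by (subst Henstock_Kurzweil_Integration.integral_add[symmetric]) (auto simp: algebra_simps inner_add_right)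
      show "w' k y (s *\<^sub>R u) = s *\<^sub>R w' k y u" for s u
        unfolding w'_def mollify_deriv_def real_scaleR_def integral_mult_right[symmetric]
        by (rule Henstock_Kurzweil_Integration.integral_cong) simp
    qed
    have sym: "w' k y h = w' h y k" if y: "y \<in> T" for y h k
    proof -
      have b: "cball y r \<subseteq> cbox a b" using ball[OF y r(2)] .
      have "w' k y h - w' h y k = integral (cbox a b) (\<lambda>z. 8 * (((W z \<bullet> k) * ((z - y) \<bullet> h) - (W z \<bullet> h) * ((z - y) \<bullet> k)) * bump 3 y r z))"
        unfolding w'_def mollify_deriv_def
        by (subst Henstock_Kurzweil_Integration.integral_diff[symmetric, OF int2 int2],
            rule Henstock_Kurzweil_Integration.integral_cong)
           (simp add: bump_commute[of 3 y] inner_diff_left algebra_simps)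
      also have "\<dots> = (LINT z|lborel. 8 * (((W z \<bullet> k) * ((z - y) \<bullet> h) - (W z \<bullet> h) * ((z - y) \<bullet> k)) * bump 3 y r z))"
      proof (rule integral_cbox_eq_Lebesgue)
        fix z assume "z \<notin> cbox a b"
        then have "z \<notin> cball y r" using b by blast
        then show "8 * (((W z \<bullet> k) * ((z - y) \<bullet> h) - (W z \<bullet> h) * ((z - y) \<bullet> k)) * bump 3 y r z) = 0"
          using bump_eq_0[OF r(1), of 3 z y] by simp
      qed (intro continuous_intros W)
      also have "\<dots> = 0" using wcf[OF r(1) b, of k h] by simp
      finally show ?thesis by simp
    qed
    have eq: "integral {0..1} (\<lambda>s. w (p0 + s *\<^sub>R (q - p0)) (q - p0)) - integral {0..1} (\<lambda>s. w (p0 + s *\<^sub>R (p - p0)) (p - p0))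
       = integral {0..1} (\<lambda>s. w (p + s *\<^sub>R (q - p)) (q - p))"
    proof (rule triangle_C1[OF T(2-5), where w' = w'])
      show "continuous_on UNIV (\<lambda>y. w y h)" for h unfolding w_def by (rule continuous_on_mollify[OF Wk]) (rule continuous_on_id)
      show "continuous_on UNIV (\<lambda>y. w' k y h)" for k h unfolding w'_def by (rule continuous_on_mollify_deriv[OF Wk]) (rule continuous_on_id)
      show "((\<lambda>s. w (y + s *\<^sub>R h) k) has_real_derivative w' k y h) (at 0)" for y h k
        unfolding w_def w'_def using mollify_line_derivative[OF Wk[of k], where r = r and y = y and h = h and s = 0] by simp
    qed (use lw lw' sym in auto)
    have close: "\<bar>integral {0..1} (\<lambda>s. w (x + s *\<^sub>R (y - x)) (y - x)) - c * line_integral W x y\<bar> \<le> e * norm (y - x) * c"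
      if xy: "x \<in> T" "y \<in> T" for x y
      unfolding line_integral_def
    proof (rule segment_integral_close)
      show "continuous_on {0..1} (\<lambda>s. w (x + s *\<^sub>R (y - x)) (y - x))"
        unfolding w_def by (rule continuous_on_mollify[OF Wk]) (intro continuous_intros)
      show "continuous_on {0..1} (\<lambda>s. W (x + s *\<^sub>R (y - x)) \<bullet> (y - x))"
        by (intro continuous_intros continuous_on_compose2[OF TW]) (use seg[OF xy] in auto)
      fix s :: real assume s: "s \<in> {0..1}"
      define z where "z = x + s *\<^sub>R (y - x)"
      have z: "z \<in> T" unfolding z_def by (rule seg[OF xy s])
      show "\<bar>w z (y - x) - c * (W z \<bullet> (y - x))\<bar> \<le> e * norm (y - x) * c"
        unfolding w_def c_def
      proof (rule mollify_error[OF Wk ball[OF z r(2)] r(1)])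
        fix v assume "v \<in> cball z r"
        then have "v \<in> cbox a b" "z \<in> cbox a b" "dist v z < d"
          using ball[OF z r(2)] r(1,3) by (auto simp: dist_commute)
        then have "norm (W v - W z) < e" using d(2) by (simp add: dist_norm)
        moreover have "\<bar>W v \<bullet> (y - x) - W z \<bullet> (y - x)\<bar> \<le> norm (W v - W z) * norm (y - x)"
          unfolding inner_diff_left[symmetric] by (rule Cauchy_Schwarz_ineq2)
        ultimately show "\<bar>W v \<bullet> (y - x) - W z \<bullet> (y - x)\<bar> \<le> e * norm (y - x)"
          by (meson less_eq_real_def mult_right_mono norm_ge_zero order_trans)
      qed
    qed
    have "c * \<bar>line_integral W p0 q - line_integral W p0 p - line_integral W p q\<bar>
        = \<bar>c * line_integral W p0 q - c * line_integral W p0 p - c * line_integral W p q\<bar>"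
      using c by (simp add: abs_mult flip: right_diff_distrib)
    also have "\<dots> \<le> e * norm (q - p0) * c + e * norm (p - p0) * c + e * norm (q - p) * c"
      using close[OF T(3,5)] close[OF T(3,4)] close[OF T(4,5)] eq by linarith
    also have "\<dots> = c * (e * L)" unfolding L_def by (simp add: algebra_simps)
    finally show ?thesis using c by simp
  qed
  have "L \<ge> 0" unfolding L_def by simp
  have "\<bar>line_integral W p0 q - line_integral W p0 p - line_integral W p q\<bar> \<le> 0 + e" if "0 < e" for e
  proof -
    have "0 < e / (L + 1)" using that \<open>L \<ge> 0\<close> by simp
    from key[OF this] have "\<bar>line_integral W p0 q - line_integral W p0 p - line_integral W p q\<bar> \<le> e * (L / (L + 1))" by simp
    also have "\<dots> \<le> e * 1" using that \<open>L \<ge> 0\<close> by (intro mult_left_mono) auto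
    finally show ?thesis by simp
  qed
  then have "\<bar>line_integral W p0 q - line_integral W p0 p - line_integral W p q\<bar> \<le> 0"
    by (rule field_le_epsilon)
  then show ?thesis by simp
qed

text \<open>
  A continuous, weakly curl-free field is a gradient. The box condition says that every point of \<open>\<Omega>\<close>
  lies with the base point \<open>p0\<close> in a common box inside \<open>\<Omega>\<close>; it holds for the slab below.
\<close>

lemma weak_Poincare:
  fixes W :: "'a::euclidean_space \<Rightarrow> 'a"
  assumes W: "continuous_on \<Omega> W"
    and box: "\<And>p. p \<in> \<Omega> \<Longrightarrow> \<exists>a b. p0 \<in> box a b \<and> p \<in> box a b \<and> cbox a b \<subseteq> \<Omega>"
    and wcf: "\<And>c r u v. 0 < r \<Longrightarrow> cball c r \<subseteq> \<Omega> \<Longrightarrow>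
        (LINT p|lborel. ((W p \<bullet> u) * ((p - c) \<bullet> v) - (W p \<bullet> v) * ((p - c) \<bullet> u)) * bump 3 c r p) = 0"
    and p: "p \<in> \<Omega>"
  shows "((\<lambda>p. line_integral W p0 p) has_derivative (\<lambda>h. W p \<bullet> h)) (at p)"
proof -
  obtain a b where ab: "p0 \<in> box a b" "p \<in> box a b" "cbox a b \<subseteq> \<Omega>" using box[OF p] by blast
  have Wab: "continuous_on (cbox a b) W" using W ab(3) continuous_on_subset by blast
  have tri: "line_integral W p0 q - line_integral W p0 p = line_integral W p q" if "q \<in> box a b" for q
    by (rule weakly_curl_free_triangle[OF Wab _ ab(1,2) that]) (use wcf ab(3) in blast)
  show ?thesis
    unfolding has_derivative_at_alt
  proof (intro conjI allI impI)
    show "bounded_linear (\<lambda>h. W p \<bullet> h)" by (rule bounded_linear_inner_right)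
    fix e :: real assume e: "0 < e"
    have "continuous_on (box a b) W" using Wab box_subset_cbox continuous_on_subset by blast
    then have "isCont W p" using ab(2) by (simp add: continuous_on_eq_continuous_at[OF open_box])
    then obtain d where d: "0 < d" "\<And>z. dist z p < d \<Longrightarrow> dist (W z) (W p) < e"
      using e unfolding continuous_at_eps_delta by metis
    obtain d' where d': "0 < d'" "ball p d' \<subseteq> box a b" using open_box ab(2) openE by blast
    show "\<exists>d>0. \<forall>q. norm (q - p) < d \<longrightarrow>
        norm (line_integral W p0 q - line_integral W p0 p - W p \<bullet> (q - p)) \<le> e * norm (q - p)"
    proof (intro exI[of _ "min d d'"] conjI allI impI)
      show "0 < min d d'" using d d' by simp
      fix q assume q: "norm (q - p) < min d d'"
      then have qb: "q \<in> box a b" using d'(2) by (auto simp: dist_norm norm_minus_commute subset_eq)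
      have "\<bar>integral {0..1} (\<lambda>s. W (p + s *\<^sub>R (q - p)) \<bullet> (q - p)) - (W p \<bullet> (q - p)) * integral {0..1} (\<lambda>s::real. 1::real)\<bar>
          \<le> e * norm (q - p)"
      proof (rule segment_integral_close)
        show "continuous_on {0..1} (\<lambda>s. W (p + s *\<^sub>R (q - p)) \<bullet> (q - p))"
        proof (intro continuous_intros continuous_on_compose2[OF Wab])
          show "(\<lambda>s. p + s *\<^sub>R (q - p)) ` {0..1} \<subseteq> cbox a b"
          proof clarify
            fix s :: real assume "s \<in> {0..1}"
            then have "(1 - s) *\<^sub>R p + s *\<^sub>R q \<in> box a b"
              using convex_box(2)[of a b] ab(2) qb unfolding convex_alt by auto
            then show "p + s *\<^sub>R (q - p) \<in> cbox a b" using box_subset_cbox by (auto simp: algebra_simps)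
          qed
        qed
        fix s :: real assume s: "s \<in> {0..1}"
        have "norm (s *\<^sub>R (q - p)) \<le> norm (q - p)" using s by (simp add: mult_left_le_one_le)
        then have "dist (p + s *\<^sub>R (q - p)) p < d" using q by (simp add: dist_norm)
        then have "norm (W (p + s *\<^sub>R (q - p)) - W p) \<le> e" using d(2) by (simp add: dist_norm less_imp_le)
        moreover have "\<bar>W (p + s *\<^sub>R (q - p)) \<bullet> (q - p) - W p \<bullet> (q - p)\<bar> \<le> norm (W (p + s *\<^sub>R (q - p)) - W p) * norm (q - p)"
          unfolding inner_diff_left[symmetric] by (rule Cauchy_Schwarz_ineq2)
        ultimately show "\<bar>W (p + s *\<^sub>R (q - p)) \<bullet> (q - p) - W p \<bullet> (q - p) * 1\<bar> \<le> e * norm (q - p)"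
          by (simp add: mult_right_mono order_trans)
      qed simp
      then show "norm (line_integral W p0 q - line_integral W p0 p - W p \<bullet> (q - p)) \<le> e * norm (q - p)"
        unfolding line_integral_def[symmetric] tri[OF qb, symmetric] by simp
    qed
  qed
qed

section \<open>Calculus of fields on the open space-time slab\<close>

lemma continuous_on_matrix_vector_mult [continuous_intros]:
  fixes A :: "'a::topological_space \<Rightarrow> real^'n^'m"
  assumes "continuous_on S A" "continuous_on S x"
  shows "continuous_on S (\<lambda>s. A s *v x s)"
  unfolding matrix_vector_mult_def by (intro continuous_intros assms)

lemma continuous_on_matrix_mult [continuous_intros]:
  fixes A :: "'a::topological_space \<Rightarrow> real^'n^'m" and C :: "'a \<Rightarrow> real^'k^'n"
  assumes "continuous_on S A" "continuous_on S C"
  shows "continuous_on S (\<lambda>s. A s ** C s)"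
  unfolding matrix_matrix_mult_def by (intro continuous_intros assms)

lemma continuous_on_transpose [continuous_intros]:
  fixes A :: "'a::topological_space \<Rightarrow> real^'n^'m"
  assumes "continuous_on S A"
  shows "continuous_on S (\<lambda>s. transpose (A s))"
  unfolding transpose_def by (intro continuous_intros assms)

text \<open>
  All of space times the open unit time interval.
\<close>

abbreviation slab :: "((real^'n) \<times> real) set" where
  "slab \<equiv> UNIV \<times> {0<..<1}"

lemma open_slab [simp]: "open slab"
  by (intro open_Times) auto

text \<open>
  Joint continuity in space and time, for curried fields.
\<close>

definition continuous_on_slab :: "(real^'n \<Rightarrow> real \<Rightarrow> 'b::topological_space) \<Rightarrow> bool" where
  "continuous_on_slab F \<longleftrightarrow> continuous_on slab (\<lambda>p. F (fst p) (snd p))"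

lemma continuous_on_slab_const: "continuous_on_slab (\<lambda>x t. c)"
  unfolding continuous_on_slab_def by (intro continuous_intros)

lemma continuous_on_slab_time: "continuous_on {0<..<1} c \<Longrightarrow> continuous_on_slab (\<lambda>x t. c t)"
  unfolding continuous_on_slab_def by (rule continuous_on_compose2) (auto intro!: continuous_intros)

lemma continuous_on_slab_cong:
  "continuous_on_slab F \<Longrightarrow> (\<And>x t. t \<in> {0<..<1} \<Longrightarrow> G x t = F x t) \<Longrightarrow> continuous_on_slab G"
  unfolding continuous_on_slab_def by (subst continuous_on_cong[OF refl, of _ _ "\<lambda>p. F (fst p) (snd p)"]) auto

text \<open>
  \<open>F' x t\<close> is the derivative of \<open>F\<close> in space at \<open>(x, t)\<close>, and both are jointly continuous on the slab.
  Continuity of \<open>F'\<close> is required for each direction \<open>h\<close> separately, which in finite dimension is the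
  same as continuity of the Jacobian matrix.
\<close>

definition has_space_derivative ::
  "(real^'n \<Rightarrow> real \<Rightarrow> 'b::real_normed_vector) \<Rightarrow> (real^'n \<Rightarrow> real \<Rightarrow> real^'n \<Rightarrow> 'b) \<Rightarrow> bool" where
  "has_space_derivative F F' \<longleftrightarrow>
     (\<forall>x. \<forall>t\<in>{0<..<1}. ((\<lambda>y. F y t) has_derivative F' x t) (at x)) \<and>
     continuous_on_slab F \<and> (\<forall>h. continuous_on_slab (\<lambda>x t. F' x t h))"

lemma has_space_derivativeD:
  assumes "has_space_derivative F F'"
  shows "t \<in> {0<..<1} \<Longrightarrow> ((\<lambda>y. F y t) has_derivative F' x t) (at x)"
    and "continuous_on_slab F" and "continuous_on_slab (\<lambda>x t. F' x t h)"
    and "t \<in> {0<..<1} \<Longrightarrow> linear (F' x t)"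
  using assms has_derivative_linear unfolding has_space_derivative_def by blast+

lemma has_space_derivativeI:
  assumes "\<And>x t. t \<in> {0<..<1} \<Longrightarrow> ((\<lambda>y. F y t) has_derivative F' x t) (at x)"
    and "continuous_on_slab F" and "\<And>h. continuous_on_slab (\<lambda>x t. F' x t h)"
  shows "has_space_derivative F F'"
  using assms unfolding has_space_derivative_def by auto

lemma has_space_derivative_cong:
  assumes "has_space_derivative F F'"
    and "\<And>x t. t \<in> {0<..<1} \<Longrightarrow> G x t = F x t"
    and "\<And>x t h. t \<in> {0<..<1} \<Longrightarrow> G' x t h = F' x t h"
  shows "has_space_derivative G G'"
proof (rule has_space_derivativeI)
  fix x t assume t: "t \<in> {0<..<1::real}"
  have "(\<lambda>y. G y t) = (\<lambda>y. F y t)" "G' x t = F' x t" using assms(2,3) t by auto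
  then show "((\<lambda>y. G y t) has_derivative G' x t) (at x)"
    using has_space_derivativeD(1)[OF assms(1) t] by simp
next
  show "continuous_on_slab G"
    by (rule continuous_on_slab_cong[OF has_space_derivativeD(2)[OF assms(1)] assms(2)])
  show "continuous_on_slab (\<lambda>x t. G' x t h)" for h
    by (rule continuous_on_slab_cong[OF has_space_derivativeD(3)[OF assms(1)] assms(3)])
qed

lemma has_space_derivative_time:
  assumes "continuous_on {0<..<1} c"
  shows "has_space_derivative (\<lambda>x t. c t) (\<lambda>x t h. 0)"
  by (rule has_space_derivativeI) (auto intro: continuous_on_slab_time assms continuous_on_slab_const)

lemma has_space_derivative_add:
  assumes "has_space_derivative F F'" "has_space_derivative G G'"
  shows "has_space_derivative (\<lambda>x t. F x t + G x t) (\<lambda>x t h. F' x t h + G' x t h)"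
  using assms unfolding has_space_derivative_def continuous_on_slab_def
  by (auto intro!: continuous_intros has_derivative_add)

lemma has_space_derivative_diff:
  assumes "has_space_derivative F F'" "has_space_derivative G G'"
  shows "has_space_derivative (\<lambda>x t. F x t - G x t) (\<lambda>x t h. F' x t h - G' x t h)"
  using assms unfolding has_space_derivative_def continuous_on_slab_def
  by (auto intro!: continuous_intros has_derivative_diff)

lemma has_space_derivative_scaleR:
  fixes g :: "real^'n \<Rightarrow> real \<Rightarrow> real"
  assumes "has_space_derivative g g'" "has_space_derivative F F'"
  shows "has_space_derivative (\<lambda>x t. g x t *\<^sub>R F x t) (\<lambda>x t h. g x t *\<^sub>R F' x t h + g' x t h *\<^sub>R F x t)"
  using assms unfolding has_space_derivative_def continuous_on_slab_def
  by (auto intro!: continuous_intros has_derivative_scaleR)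

lemma has_space_derivative_cmult:
  fixes c :: real
  assumes "has_space_derivative F F'"
  shows "has_space_derivative (\<lambda>x t. c *\<^sub>R F x t) (\<lambda>x t h. c *\<^sub>R F' x t h)"
  using assms unfolding has_space_derivative_def continuous_on_slab_def
  by (auto intro!: continuous_intros has_derivative_scaleR_right)

lemma has_space_derivative_inner:
  fixes F G :: "real^'n \<Rightarrow> real \<Rightarrow> 'b::real_inner"
  assumes "has_space_derivative F F'" "has_space_derivative G G'"
  shows "has_space_derivative (\<lambda>x t. F x t \<bullet> G x t) (\<lambda>x t h. F x t \<bullet> G' x t h + F' x t h \<bullet> G x t)"
  using assms unfolding has_space_derivative_def continuous_on_slab_def
  by (auto intro!: continuous_intros has_derivative_inner)

lemma has_space_derivative_matrix:
  fixes A :: "real \<Rightarrow> real^'k^'j"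
  assumes "continuous_on {0<..<1} A" "has_space_derivative F F'"
  shows "has_space_derivative (\<lambda>x t. A t *v F x t) (\<lambda>x t h. A t *v F' x t h)"
  using assms(2) continuous_on_slab_time[OF assms(1)] unfolding has_space_derivative_def continuous_on_slab_def
  by (auto intro!: continuous_intros bounded_linear.has_derivative[OF matrix_vector_mul_bounded_linear])

lemma has_space_derivative_inverse:
  fixes g :: "real^'n \<Rightarrow> real \<Rightarrow> real"
  assumes "has_space_derivative g g'" "\<And>x t. t \<in> {0<..<1} \<Longrightarrow> g x t \<noteq> 0"
  shows "has_space_derivative (\<lambda>x t. inverse (g x t)) (\<lambda>x t h. - (inverse (g x t) * g' x t h * inverse (g x t)))"
proof (rule has_space_derivativeI)
  show "((\<lambda>y. inverse (g y t)) has_derivative (\<lambda>h. - (inverse (g x t) * g' x t h * inverse (g x t)))) (at x)"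
    if "t \<in> {0<..<1}" for x t
    by (rule Deriv.has_derivative_inverse[OF assms(2)[OF that] has_space_derivativeD(1)[OF assms(1) that]])
qed (use assms has_space_derivativeD(2,3)[OF assms(1)] in
      \<open>auto simp: continuous_on_slab_def intro!: continuous_intros\<close>)

lemma has_space_derivative_unique:
  assumes "has_space_derivative F F'" "has_space_derivative F F''" "t \<in> {0<..<1}"
  shows "F' x t h = F'' x t h"
  using has_derivative_unique[OF has_space_derivativeD(1)[OF assms(1,3)] has_space_derivativeD(1)[OF assms(2,3)]]
  by metis

lemma C1_in_spaceD:
  assumes "C1_in_space F"
  shows "has_space_derivative F (\<lambda>x t h. jacobian (\<lambda>y. F y t) (at x) *v h)"
  using assms unfolding C1_in_space_def
  by (intro has_space_derivativeI)
     (auto simp: jacobian_works continuous_on_slab_def case_prod_beta intro!: continuous_intros)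

lemma jacobian_eq:
  assumes "(F has_derivative F') (at x)"
  shows "jacobian F (at x) = matrix F'"
  using frechet_derivative_at[OF assms] by (simp add: jacobian_def)

lemma C1_in_spaceI:
  assumes "has_space_derivative F F'"
  shows "C1_in_space F"
proof -
  have "continuous_on slab (\<lambda>(x, t). jacobian (\<lambda>y. F y t) (at x))"
  proof (rule continuous_on_eq)
    show "continuous_on slab (\<lambda>p. \<chi> i j. F' (fst p) (snd p) (axis j 1) $ i)"
      using has_space_derivativeD(3)[OF assms] unfolding continuous_on_slab_def by (intro continuous_intros)
    fix p :: "(real, 'a) vec \<times> real" assume "p \<in> slab"
    then show "(\<chi> i j. F' (fst p) (snd p) (axis j 1) $ i) = (case p of (x, t) \<Rightarrow> jacobian (\<lambda>y. F y t) (at x))"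
      using jacobian_eq[OF has_space_derivativeD(1)[OF assms, of "snd p" "fst p"]]
      by (auto simp: matrix_def case_prod_beta)
  qed
  then show ?thesis
    using has_space_derivativeD(2)[OF assms] differentiableI[OF has_space_derivativeD(1)[OF assms]]
    unfolding C1_in_space_def continuous_on_slab_def by (simp add: case_prod_beta)
qed

lemma gradient_inner:
  assumes "(g has_derivative g') (at x)"
  shows "gradient g x \<bullet> h = g' h"
proof -
  have lin: "linear g'" using assms by (rule has_derivative_linear)
  have "gradient g x \<bullet> h = (\<Sum>i\<in>UNIV. h $ i * g' (axis i 1))"
    using frechet_derivative_at[OF assms] by (simp add: gradient_def inner_vec_def mult.commute)
  also have "\<dots> = g' (\<Sum>i\<in>UNIV. h $ i *\<^sub>R axis i 1)"
    by (simp add: linear_sum[OF lin] linear_scale[OF lin])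
  also have "(\<Sum>i\<in>UNIV. h $ i *\<^sub>R axis i 1) = h" using basis_expansion[of h] by (simp add: scalar_mult_eq_scaleR)
  finally show ?thesis .
qed

lemma gradient_eqI:
  assumes "(g has_derivative (\<lambda>h. G \<bullet> h)) (at x)"
  shows "gradient g x = G"
  using gradient_inner[OF assms] vector_eq_rdot[of "gradient g x" G] vector_eq_ldot[of "gradient g x" G] by (metis inner_commute)

text \<open>
  The trace of a linear map, so that the divergence is the trace of the derivative.
\<close>

definition linear_trace :: "(real^'n \<Rightarrow> real^'n) \<Rightarrow> real" where
  "linear_trace L = (\<Sum>i\<in>UNIV. L (axis i 1) $ i)"

lemma linear_trace_add: "linear_trace (\<lambda>h. L h + M h) = linear_trace L + linear_trace M"
  and linear_trace_diff: "linear_trace (\<lambda>h. L h - M h) = linear_trace L - linear_trace M"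
  and linear_trace_scaleR: "linear_trace (\<lambda>h. c *\<^sub>R L h) = c * linear_trace L"
  by (simp_all add: linear_trace_def sum.distrib sum_subtractf sum_distrib_left)

lemma linear_trace_rank1: "linear_trace (\<lambda>h. (G \<bullet> h) *\<^sub>R F) = G \<bullet> F"
  by (simp add: linear_trace_def inner_axis) (simp add: inner_vec_def)

lemma linear_trace_matrix: "linear_trace (\<lambda>h. A *v h) = trace A"
  by (simp add: linear_trace_def trace_def matrix_vector_mult_basis column_def)

lemma divergence_eq:
  assumes "(F has_derivative F') (at x)"
  shows "divergence F x = linear_trace F'"
  by (simp add: divergence_def jacobian_eq[OF assms] trace_def matrix_def linear_trace_def)

lemma transpose_diffusion: "transpose (diffusion B t) = diffusion B t"
  by (simp add: diffusion_def matrix_transpose_mul transpose_transpose)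

lemma matrix_inner_diffusion:
  "matrix_inner (diffusion B t) H = linear_trace (\<lambda>h. diffusion B t *v (H *v h))"
  by (simp add: matrix_inner_def transpose_diffusion matrix_vector_mul_assoc linear_trace_matrix)

lemma dot_matrix_vector_mul_transpose:
  fixes A :: "real^'m^'n"
  shows "x \<bullet> (transpose A *v y) = (A *v x) \<bullet> y"
  by (metis dot_lmul_matrix transpose_matrix_vector transpose_transpose)

text \<open>
  The second-order operator is the sum of the second derivatives along the columns of \<open>B t\<close>.
\<close>

lemma linear_trace_diffusion:
  fixes B :: "real \<Rightarrow> real^'m^'n"
  shows "linear_trace (\<lambda>h. diffusion B t *v (H *v h))
    = (\<Sum>k\<in>UNIV. (B t *v axis k 1) \<bullet> (H *v (B t *v axis k 1)))"
proof -
  have "linear_trace (\<lambda>h. diffusion B t *v (H *v h)) = trace ((B t ** transpose (B t)) ** H)"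
    by (simp add: matrix_vector_mul_assoc linear_trace_matrix diffusion_def)
  also have "\<dots> = trace (B t ** (transpose (B t) ** H))" by (simp add: matrix_mul_assoc)
  also have "\<dots> = trace ((transpose (B t) ** H) ** B t)" by (rule trace_mul_sym)
  also have "\<dots> = (\<Sum>k\<in>UNIV. ((transpose (B t) ** H ** B t) *v axis k 1) $ k)"
    by (simp add: trace_def matrix_vector_mult_basis column_def)
  also have "\<dots> = (\<Sum>k\<in>UNIV. axis k 1 \<bullet> (transpose (B t) *v (H *v (B t *v axis k 1))))"
    by (simp add: inner_axis' matrix_vector_mul_assoc matrix_mul_assoc)
  also have "\<dots> = (\<Sum>k\<in>UNIV. (B t *v axis k 1) \<bullet> (H *v (B t *v axis k 1)))"
    by (simp only: dot_matrix_vector_mul_transpose)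
  finally show ?thesis .
qed

lemma C2D:
  assumes "C2_in_space_C1_in_time g"
  shows "has_space_derivative g (\<lambda>x t h. gradient (\<lambda>y. g y t) x \<bullet> h)"
    and "has_space_derivative (\<lambda>x t. gradient (\<lambda>y. g y t) x) (\<lambda>x t h. Hess (\<lambda>y. g y t) x *v h)"
    and "t \<in> {0<..<1} \<Longrightarrow> ((\<lambda>s. g x s) has_real_derivative time_deriv g x t) (at t)"
    and "continuous_on_slab (time_deriv g)"
proof -
  have C1: "C1_in_space (\<lambda>x t. gradient (\<lambda>y. g y t) x)"
    using assms unfolding C2_in_space_C1_in_time_def by auto
  from C1_in_spaceD[OF C1] show *: "has_space_derivative (\<lambda>x t. gradient (\<lambda>y. g y t) x) (\<lambda>x t h. Hess (\<lambda>y. g y t) x *v h)"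
    unfolding Hess_def .
  show "has_space_derivative g (\<lambda>x t h. gradient (\<lambda>y. g y t) x \<bullet> h)"
  proof (rule has_space_derivativeI)
    fix x t assume t: "t \<in> {0<..<1::real}"
    then obtain D where D: "((\<lambda>y. g y t) has_derivative D) (at x)"
      using assms unfolding C2_in_space_C1_in_time_def differentiable_def by blast
    then show "((\<lambda>y. g y t) has_derivative (\<bullet>) (gradient (\<lambda>y. g y t) x)) (at x)"
      using gradient_inner[OF D] by (intro has_derivative_eq_rhs[OF D]) (simp add: fun_eq_iff)
  next
    show "continuous_on_slab g" using assms
      unfolding C2_in_space_C1_in_time_def continuous_on_slab_def by (auto simp: case_prod_beta)
    show "continuous_on_slab (\<lambda>x t. gradient (\<lambda>y. g y t) x \<bullet> h)" for h
      using has_space_derivativeD(2)[OF *] unfolding continuous_on_slab_def by (intro continuous_intros)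
  qed
  show "t \<in> {0<..<1} \<Longrightarrow> ((\<lambda>s. g x s) has_real_derivative time_deriv g x t) (at t)"
    using assms unfolding C2_in_space_C1_in_time_def time_deriv_def
    by (metis DERIV_deriv_iff_real_differentiable)
  show "continuous_on_slab (time_deriv g)"
    using assms unfolding C2_in_space_C1_in_time_def continuous_on_slab_def by (auto simp: case_prod_beta)
qed

lemma C2I:
  assumes g: "has_space_derivative g (\<lambda>x t h. G x t \<bullet> h)" and G: "has_space_derivative G G'"
    and gt: "\<And>x t. t \<in> {0<..<1} \<Longrightarrow> ((\<lambda>s. g x s) has_real_derivative gt x t) (at t)"
    and cgt: "continuous_on_slab gt"
  shows "C2_in_space_C1_in_time g"
    and "t \<in> {0<..<1} \<Longrightarrow> gradient (\<lambda>y. g y t) x = G x t"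
    and "t \<in> {0<..<1} \<Longrightarrow> Hess (\<lambda>y. g y t) x *v h = G' x t h"
    and "t \<in> {0<..<1} \<Longrightarrow> time_deriv g x t = gt x t"
proof -
  show grad: "gradient (\<lambda>y. g y t) x = G x t" if "t \<in> {0<..<1}" for x t
    by (rule gradient_eqI[OF has_space_derivativeD(1)[OF g that]])
  show td: "time_deriv g x t = gt x t" if "t \<in> {0<..<1}" for x t
    unfolding time_deriv_def by (rule DERIV_imp_deriv[OF gt[OF that]])
  show "Hess (\<lambda>y. g y t) x *v h = G' x t h" if t: "t \<in> {0<..<1}" for x t h
  proof -
    have "gradient (\<lambda>y. g y t) = (\<lambda>y. G y t)" using grad[OF t] by auto
    then show ?thesis unfolding Hess_def 
      using jacobian_eq[OF has_space_derivativeD(1)[OF G t]]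
        matrix_works[OF has_space_derivativeD(4)[OF G t, folded linear_matrix_vector_mul_eq]] by simp
  qed
  have "has_space_derivative (\<lambda>x t. gradient (\<lambda>y. g y t) x) G'"
    by (rule has_space_derivative_cong[OF G]) (use grad in auto)
  then have "C1_in_space (\<lambda>x t. gradient (\<lambda>y. g y t) x)" by (rule C1_in_spaceI)
  moreover have "continuous_on_slab (time_deriv g)"
    by (rule continuous_on_slab_cong[OF cgt td])
  ultimately show "C2_in_space_C1_in_time g"
    using has_space_derivativeD(2)[OF g] differentiableI[OF has_space_derivativeD(1)[OF g]]
      differentiableI[OF gt[unfolded has_field_derivative_def]]
    unfolding C2_in_space_C1_in_time_def continuous_on_slab_def by (simp add: case_prod_beta)
qed

section \<open>Positivity of solutions of the Fokker-Planck equation\<close>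

lemma local_min_second_derivative:
  fixes \<phi> :: "real \<Rightarrow> real"
  assumes d: "0 < d" and min: "\<And>s. \<bar>s\<bar> < d \<Longrightarrow> \<phi> 0 \<le> \<phi> s"
    and der: "\<And>s. (\<phi> has_real_derivative \<phi>' s) (at s)"
    and der2: "(\<phi>' has_real_derivative l) (at 0)"
  shows "\<phi>' 0 = 0" and "0 \<le> l"
proof -
  show z: "\<phi>' 0 = 0"
    by (rule DERIV_local_min[OF der[of 0] d]) (use min in auto)
  show "0 \<le> l"
  proof (rule ccontr)
    assume "\<not> 0 \<le> l"
    then obtain e where e: "0 < e" "\<And>h. 0 < h \<Longrightarrow> h < e \<Longrightarrow> \<phi>' h < 0"
      using DERIV_neg_dec_right[OF der2] z by auto
    define s where "s = min d e / 2"
    have s: "0 < s" "s < d" "s < e" using d e(1) by (auto simp: s_def)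
    obtain \<xi> where \<xi>: "0 < \<xi>" "\<xi> < s" "\<phi> s - \<phi> 0 = (s - 0) * \<phi>' \<xi>"
      using MVT2[OF s(1), of \<phi> \<phi>'] der by blast
    then have "\<phi> s < \<phi> 0" using e(2)[of \<xi>] s using mult_pos_neg[of s "\<phi>' \<xi>"] by simp
    then show False using min[of s] s by simp
  qed
qed

lemma barrier_quadratic_pos:
  fixes \<alpha> M q :: real
  assumes "0 < \<alpha>"
  shows "0 < \<alpha> - M * q + (M\<^sup>2 / \<alpha>) * q\<^sup>2"
proof -
  have "\<alpha> * (\<alpha> - M * q + (M\<^sup>2 / \<alpha>) * q\<^sup>2) = (M * q - \<alpha> / 2)\<^sup>2 + 3 / 4 * \<alpha>\<^sup>2"
    using assms by (simp add: power2_eq_square field_simps)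
  moreover have "\<dots> > 0" using assms by (intro add_nonneg_pos) auto
  ultimately show ?thesis using assms by (metis zero_less_mult_pos)
qed

text \<open>
  The strong maximum principle: positivity at one point propagates to all later times. If \<open>\<rho>\<close> is
  positive at \<open>(x1, t1)\<close>, then \<open>exp (- K t) \<rho>\<close> dominates the barrier \<open>\<delta> exp (- \<Lambda> t) (r\<^sup>2 - \<bar>x - z t\<bar>\<^sup>2)\<^sup>2\<close>
  on a ball whose centre \<open>z t\<close> moves linearly from \<open>x1\<close> to \<open>x2\<close>. Here \<open>K\<close> makes the zeroth-order
  coefficient nonnegative; the barrier vanishes on the
  lateral boundary and, for large \<open>\<Lambda>\<close>, is a strict subsolution, which excludes a negative minimum of
  the difference.
\<close>

lemma parabolic_positivity:
  fixes \<rho> :: "real^'n \<Rightarrow> real \<Rightarrow> real" and B :: "real \<Rightarrow> real^'m^'n"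
  assumes eps: "0 < \<epsilon>" and C2: "C2_in_space_C1_in_time \<rho>"
    and nonneg: "\<And>x t. t \<in> {0<..<1} \<Longrightarrow> 0 \<le> \<rho> x t"
    and contB: "continuous_on {0<..<1} B"
    and c3: "0 < c3" "\<And>y t. t \<in> {0<..<1} \<Longrightarrow> c3 * (norm y)\<^sup>2 \<le> y \<bullet> (diffusion B t *v y)"
    and contb: "continuous_on_slab b" and contc: "continuous_on_slab c"
    and pde: "\<And>x t. t \<in> {0<..<1} \<Longrightarrow>
        time_deriv \<rho> x t + gradient (\<lambda>y. \<rho> y t) x \<bullet> b x t + c x t * \<rho> x t
        = \<epsilon> * matrix_inner (diffusion B t) (Hess (\<lambda>y. \<rho> y t) x)"
    and t12: "0 < t1" "t1 < t2" "t2 < 1" and start: "0 < \<rho> x1 t1"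
  shows "0 < \<rho> x2 t2"
proof -
  note C2D = C2D[OF C2]
  define G where "G x t = gradient (\<lambda>y. \<rho> y t) x" for x t
  define H where "H x t = Hess (\<lambda>y. \<rho> y t) x" for x t
  have der\<rho>: "((\<lambda>y. \<rho> y t) has_derivative (\<lambda>h. G x t \<bullet> h)) (at x)"
    and derG: "((\<lambda>y. G y t) has_derivative (\<lambda>h. H x t *v h)) (at x)"
    and dert: "((\<lambda>s. \<rho> x s) has_real_derivative time_deriv \<rho> x t) (at t)" if "t \<in> {0<..<1}" for x t
    using has_space_derivativeD(1)[OF C2D(1) that] has_space_derivativeD(1)[OF C2D(2) that] C2D(3)[OF that]
    unfolding G_def H_def by auto
  have I: "t \<in> {0<..<1}" if "t \<in> {t1..t2}" for t using that t12 by auto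
  obtain r where r: "0 < r" "\<And>y. y \<in> cball x1 r \<Longrightarrow> \<rho> x1 t1 / 2 \<le> \<rho> y t1"
  proof -
    have "isCont (\<lambda>y. \<rho> y t1) x1"
      using has_derivative_continuous[OF der\<rho>[OF I]] t12 by auto
    then obtain d where d: "0 < d" "\<And>y. dist y x1 < d \<Longrightarrow> dist (\<rho> y t1) (\<rho> x1 t1) < \<rho> x1 t1 / 2"
      using start unfolding continuous_at_eps_delta by (metis half_gt_zero)
    show thesis
    proof (rule that[of "d / 2"])
      fix y assume "y \<in> cball x1 (d / 2)"
      then have "dist y x1 < d" using d(1) by (simp add: dist_commute)
      then show "\<rho> x1 t1 / 2 \<le> \<rho> y t1" using d(2)[of y] by (auto simp: dist_real_def abs_if field_simps split: if_splits)
    qed (use d in auto)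
  qed
  define w where "w = (1 / (t2 - t1)) *\<^sub>R (x2 - x1)"
  define z where "z t = x1 + (t - t1) *\<^sub>R w" for t
  have z1: "z t1 = x1" by (simp add: z_def)
  have z2: "z t2 = x2" using t12 by (simp add: z_def w_def)
  define q where "q x t = r\<^sup>2 - (x - z t) \<bullet> (x - z t)" for x t
  define Q where "Q = (\<lambda>(y, t). (z t + y, t)) ` (cball 0 r \<times> {t1..t2})"
  have Q_iff: "(x, t) \<in> Q \<longleftrightarrow> t \<in> {t1..t2} \<and> norm (x - z t) \<le> r" for x t
  proof
    show "(x, t) \<in> Q \<Longrightarrow> t \<in> {t1..t2} \<and> norm (x - z t) \<le> r" unfolding Q_def by auto
    assume "t \<in> {t1..t2} \<and> norm (x - z t) \<le> r"
    then have "(\<lambda>(y, t). (z t + y, t)) (x - z t, t) \<in> Q" unfolding Q_def by (intro imageI) auto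
    then show "(x, t) \<in> Q" by simp
  qed
  have cQ: "compact Q" unfolding Q_def z_def
    by (intro compact_continuous_image compact_Times compact_cball compact_Icc)
       (auto simp: case_prod_beta intro!: continuous_intros)
  have Qslab: "Q \<subseteq> slab" using Q_iff I by auto
  define trD where "trD t = (\<Sum>k\<in>UNIV. (B t *v axis k 1) \<bullet> (B t *v axis k 1))" for t
  have cB: "continuous_on slab (\<lambda>p. B (snd p))"
    using continuous_on_slab_time[OF contB] unfolding continuous_on_slab_def .
  have cont_b: "continuous_on slab (\<lambda>p. b (fst p) (snd p))" and cont_c: "continuous_on slab (\<lambda>p. c (fst p) (snd p))"
    and cont_\<rho>: "continuous_on slab (\<lambda>p. \<rho> (fst p) (snd p))"
    using contb contc has_space_derivativeD(2)[OF C2D(1)] unfolding continuous_on_slab_def by auto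
  obtain K where K: "0 < K" "\<And>x t. (x, t) \<in> Q \<Longrightarrow> \<bar>c x t\<bar> \<le> K"
  proof -
    obtain K where "0 < K" "\<And>p. p \<in> Q \<Longrightarrow> \<bar>c (fst p) (snd p)\<bar> \<le> K"
      using compact_continuous_bound[OF cQ continuous_on_subset[OF cont_c Qslab]] by metis
    then show thesis by (intro that[of K]) force+
  qed
  define m where "m x t = \<bar>4 * \<epsilon> * trD t\<bar> + \<bar>4 * ((x - z t) \<bullet> b x t)\<bar> + \<bar>4 * ((x - z t) \<bullet> w)\<bar>" for x t
  obtain M where M: "0 < M" "\<And>x t. (x, t) \<in> Q \<Longrightarrow> m x t \<le> M"
  proof -
    have "continuous_on slab (\<lambda>p. m (fst p) (snd p))"
      unfolding m_def trD_def z_def by (intro continuous_intros cB cont_b)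
    from compact_continuous_bound[OF cQ continuous_on_subset[OF this Qslab]]
    obtain M where "0 < M" "\<And>p. p \<in> Q \<Longrightarrow> \<bar>m (fst p) (snd p)\<bar> \<le> M"
      by metis
    then show thesis by (intro that[of M]) force+
  qed
  \<comment> \<open>\<open>\<Lambda>\<close> makes the quadratic polynomial in \<open>q\<close> of the strict subsolution inequality positive\<close>
  define \<alpha> where "\<alpha> = 8 * \<epsilon> * c3 * r\<^sup>2"
  define M' where "M' = 8 * \<epsilon> * c3 + M"
  define \<Lambda> where "\<Lambda> = 2 * K + M'\<^sup>2 / \<alpha>"
  have \<alpha>: "0 < \<alpha>" unfolding \<alpha>_def using eps c3(1) r(1) by simp
  \<comment> \<open>\<open>\<delta>\<close> makes the barrier lie below the solution at time \<open>t1\<close>\<close>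
  define \<delta> where "\<delta> = exp (- K * t1) * (\<rho> x1 t1 / 2) * exp (\<Lambda> * t1) / r ^ 4"
  have \<delta>: "0 < \<delta>" unfolding \<delta>_def using start r(1) by simp
  define h where "h x t = exp (- K * t) * \<rho> x t - \<delta> * exp (- \<Lambda> * t) * (q x t)\<^sup>2" for x t
  have q_bounds: "0 \<le> q x t" "q x t \<le> r\<^sup>2" if "(x, t) \<in> Q" for x t
  proof -
    have "(norm (x - z t))\<^sup>2 \<le> r\<^sup>2" using that by (intro power_mono) (auto simp: Q_iff)
    then show "0 \<le> q x t" "q x t \<le> r\<^sup>2" by (auto simp: q_def power2_norm_eq_inner)
  qed
  have h_pos: "0 \<le> h x t" if inQ: "(x, t) \<in> Q" for x t
  proof (rule ccontr)
    assume neg: "\<not> 0 \<le> h x t"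
    have "continuous_on Q (\<lambda>p. h (fst p) (snd p))"
      unfolding h_def q_def z_def
      by (intro continuous_intros continuous_on_subset[OF cont_\<rho> Qslab])
    then obtain p where p: "p \<in> Q" "\<And>p'. p' \<in> Q \<Longrightarrow> h (fst p) (snd p) \<le> h (fst p') (snd p')"
      using continuous_attains_inf[OF cQ, of "\<lambda>p. h (fst p) (snd p)"] inQ by blast
    define x0 where "x0 = fst p"
    define t0 where "t0 = snd p"
    have p0: "(x0, t0) \<in> Q" "\<And>x t. (x, t) \<in> Q \<Longrightarrow> h x0 t0 \<le> h x t"
      using p(1) p(2)[of "(_, _)"] unfolding x0_def t0_def by auto
    have h0: "h x0 t0 < 0" using p0(2)[OF inQ] neg by simp
    have t0: "t0 \<in> {t1..t2}" "t0 \<in> {0<..<1}" using p0(1) Q_iff I by auto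
    define y where "y = x0 - z t0"
    define q0 where "q0 = q x0 t0"
    have q0: "0 \<le> q0" using q_bounds[OF p0(1)] unfolding q0_def by simp
    have q0y: "q0 = r\<^sup>2 - y \<bullet> y" by (simp add: q0_def q_def y_def)
    have interior: "norm y < r"
    proof (rule ccontr)
      assume "\<not> norm y < r"
      then have "norm y = r" using p0(1) unfolding Q_iff y_def by simp
      then have "q0 = 0" using q0y by (simp add: power2_norm_eq_inner[symmetric])
      then have "h x0 t0 = exp (- K * t0) * \<rho> x0 t0" unfolding h_def q0_def[symmetric] by simp
      then show False using h0 nonneg[OF t0(2), of x0] by (simp add: mult_less_0_iff)
    qed
    have later: "t1 < t0"
    proof (rule ccontr)
      assume "\<not> t1 < t0"
      then have t01: "t0 = t1" using t0 by simp
      then have "x0 \<in> cball x1 r" using p0(1) z1 unfolding Q_iff by (simp add: dist_norm norm_minus_commute)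
      then have "\<rho> x1 t1 / 2 \<le> \<rho> x0 t1" by (rule r(2))
      moreover have "q0\<^sup>2 \<le> r ^ 4" using power_mono[OF q_bounds(2)[OF p0(1)] q_bounds(1)[OF p0(1)], of 2] unfolding q0_def by simp
      moreover have "\<delta> * exp (- \<Lambda> * t1) * r ^ 4 = exp (- K * t1) * (\<rho> x1 t1 / 2)"
        unfolding \<delta>_def using r(1) by (simp add: exp_minus field_simps)
      ultimately have "\<delta> * exp (- \<Lambda> * t1) * q0\<^sup>2 \<le> exp (- K * t1) * \<rho> x0 t1"
        using \<delta> by (smt (verit) exp_gt_zero mult_left_mono mult_pos_pos)
      then show False using h0 unfolding h_def t01 q0_def by simp
    qed
    define E where "E = \<delta> * exp (- \<Lambda> * t0)"
    define k0 where "k0 = exp (- K * t0)"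
    have E: "0 < E" and k0: "0 < k0" using \<delta> unfolding E_def k0_def by auto
    have spatial: "k0 * (G x0 t0 \<bullet> v) = - 4 * E * q0 * (y \<bullet> v)"
      "E * (8 * (y \<bullet> v)\<^sup>2 - 4 * q0 * (v \<bullet> v)) \<le> k0 * (v \<bullet> (H x0 t0 *v v))" for v
    proof -
      define \<phi> where "\<phi> s = h (x0 + s *\<^sub>R v) t0" for s
      define qs where "qs s = r\<^sup>2 - (y + s *\<^sub>R v) \<bullet> (y + s *\<^sub>R v)" for s :: real
      define \<phi>' where "\<phi>' s = k0 * (G (x0 + s *\<^sub>R v) t0 \<bullet> v) + 4 * E * qs s * ((y + s *\<^sub>R v) \<bullet> v)" for s
      have line: "((\<lambda>s. x0 + s *\<^sub>R v) has_derivative (\<lambda>s. s *\<^sub>R v)) (at s)" for s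
        by (auto intro!: derivative_eq_intros)
      have dqs: "(qs has_real_derivative - 2 * ((y + s *\<^sub>R v) \<bullet> v)) (at s)" for s
        unfolding qs_def has_field_derivative_def
        by (auto intro!: derivative_eq_intros simp: inner_commute algebra_simps fun_eq_iff)
      have \<phi>_eq: "\<phi> s = k0 * \<rho> (x0 + s *\<^sub>R v) t0 - E * (qs s)\<^sup>2" for s
        unfolding \<phi>_def h_def k0_def E_def q_def qs_def y_def by (simp add: algebra_simps)
      have d\<rho>: "((\<lambda>s. \<rho> (x0 + s *\<^sub>R v) t0) has_real_derivative G (x0 + s *\<^sub>R v) t0 \<bullet> v) (at s)" for s
        using has_derivative_compose[OF line der\<rho>[OF t0(2)]] unfolding has_field_derivative_def
        by (rule has_derivative_eq_rhs) (simp add: fun_eq_iff)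
      have dG: "((\<lambda>s. G (x0 + s *\<^sub>R v) t0 \<bullet> v) has_real_derivative v \<bullet> (H x0 t0 *v v)) (at 0)"
      proof -
        have "((\<lambda>s. G (x0 + s *\<^sub>R v) t0) has_derivative (\<lambda>s. H x0 t0 *v (s *\<^sub>R v))) (at 0)"
          using has_derivative_compose[OF line[of 0] derG[OF t0(2)]] by simp
        from has_derivative_inner_left[OF this, of v] show ?thesis
          unfolding has_field_derivative_def
          by (rule has_derivative_eq_rhs) (simp add: fun_eq_iff matrix_vector_mult_scaleR inner_commute)
      qed
      have d\<phi>: "(\<phi> has_real_derivative \<phi>' s) (at s)" for s
        unfolding \<phi>_eq[abs_def] \<phi>'_def
        by (rule derivative_eq_intros d\<rho> dqs refl | simp add: algebra_simps)+
      have dl: "((\<lambda>s. (y + s *\<^sub>R v) \<bullet> v) has_real_derivative v \<bullet> v) (at s)" for s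
        unfolding has_field_derivative_def
        by (auto intro!: derivative_eq_intros simp: fun_eq_iff)
      have d\<phi>': "(\<phi>' has_real_derivative (k0 * (v \<bullet> (H x0 t0 *v v)) - E * (8 * (y \<bullet> v)\<^sup>2 - 4 * q0 * (v \<bullet> v)))) (at 0)"
        unfolding \<phi>'_def
        by (rule derivative_eq_intros dG dqs dl refl
            | simp add: algebra_simps power2_eq_square qs_def q0y)+
      obtain d where d: "0 < d" "\<And>s. \<bar>s\<bar> < d \<Longrightarrow> (x0 + s *\<^sub>R v, t0) \<in> Q"
      proof (rule that[of "(r - norm y) / (norm v + 1)"])
        show "0 < (r - norm y) / (norm v + 1)" using interior by (simp add: add_nonneg_pos)
        fix s :: real assume s: "\<bar>s\<bar> < (r - norm y) / (norm v + 1)"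
        have "\<bar>s\<bar> * norm v \<le> \<bar>s\<bar> * (norm v + 1)" by (intro mult_left_mono) auto
        also have "\<dots> \<le> r - norm y" using s by (simp add: pos_less_divide_eq add_nonneg_pos less_imp_le)
        finally have "norm (y + s *\<^sub>R v) \<le> r" using norm_triangle_ineq[of y "s *\<^sub>R v"] by simp
        then show "(x0 + s *\<^sub>R v, t0) \<in> Q" unfolding Q_iff y_def using t0 by (simp add: algebra_simps)
      qed
      have min: "\<phi> 0 \<le> \<phi> s" if "\<bar>s\<bar> < d" for s
        unfolding \<phi>_def using p0(2)[OF d(2)[OF that]] by simp
      note fin = local_min_second_derivative[OF d(1) min d\<phi> d\<phi>']
      show "k0 * (G x0 t0 \<bullet> v) = - 4 * E * q0 * (y \<bullet> v)"
        using fin(1) unfolding \<phi>'_def qs_def q0y by simp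
      show "E * (8 * (y \<bullet> v)\<^sup>2 - 4 * q0 * (v \<bullet> v)) \<le> k0 * (v \<bullet> (H x0 t0 *v v))"
        using fin(2) by simp
    qed
    \<comment> \<open>only earlier times are used, since the minimum may be attained at \<open>t2\<close>\<close>
    have temporal: "k0 * (time_deriv \<rho> x0 t0 - K * \<rho> x0 t0) \<le> E * (4 * q0 * (y \<bullet> w) - \<Lambda> * q0\<^sup>2)"
    proof -
      have dq: "((\<lambda>s. q x0 s) has_real_derivative 2 * (y \<bullet> w)) (at t0)"
        unfolding q_def z_def y_def has_field_derivative_def
        by (auto intro!: derivative_eq_intros simp: fun_eq_iff inner_commute algebra_simps)
      have dh: "((\<lambda>s. h x0 s) has_real_derivative
          (k0 * (time_deriv \<rho> x0 t0 - K * \<rho> x0 t0) - E * (4 * q0 * (y \<bullet> w) - \<Lambda> * q0\<^sup>2))) (at t0)"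
        unfolding h_def
        by (rule derivative_eq_intros dq dert[OF t0(2)] refl
            | simp add: algebra_simps power2_eq_square k0_def E_def q0_def)+
      have "\<forall>\<^sub>F s in nhds t0. norm (x0 - z s) < r \<and> t1 < s"
      proof (intro eventually_conj)
        have "isCont (\<lambda>s. norm (x0 - z s)) t0" unfolding z_def by (intro continuous_intros)
        then have "((\<lambda>s. norm (x0 - z s)) \<longlongrightarrow> norm (x0 - z t0)) (nhds t0)"
          unfolding continuous_within by (simp add: tendsto_nhds_iff)
        then show "\<forall>\<^sub>F s in nhds t0. norm (x0 - z s) < r"
          by (rule order_tendstoD(2)) (use interior y_def in simp)
        show "\<forall>\<^sub>F s in nhds t0. t1 < s"
          using eventually_nhds_in_open[of "{t1<..}" t0] later by (simp add: eventually_mono)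
      qed
      then obtain d where d: "0 < d" "\<And>s. dist s t0 < d \<Longrightarrow> norm (x0 - z s) < r \<and> t1 < s"
        unfolding eventually_nhds_metric by blast
      show ?thesis
      proof (rule ccontr)
        assume "\<not> ?thesis"
        then obtain e where e: "0 < e" "\<And>u. 0 < u \<Longrightarrow> u < e \<Longrightarrow> h x0 (t0 - u) < h x0 t0"
          using DERIV_pos_inc_left[OF dh] by auto
        define u where "u = min d e / 2"
        have u: "0 < u" "u < d" "u < e" using d(1) e(1) by (auto simp: u_def)
        have "(x0, t0 - u) \<in> Q" using d(2)[of "t0 - u"] u t0 unfolding Q_iff by (auto simp: dist_real_def)
        then show False using p0(2) e(2)[OF u(1,3)] by fastforce
      qed
    qed
    have tr: "E * (8 * (y \<bullet> (diffusion B t0 *v y)) - 4 * q0 * trD t0)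
        \<le> k0 * matrix_inner (diffusion B t0) (H x0 t0)"
    proof -
      have "y \<bullet> (diffusion B t0 *v y) = (transpose (B t0) *v y) \<bullet> (transpose (B t0) *v y)"
        unfolding diffusion_def matrix_vector_mul_assoc[symmetric]
        by (metis dot_matrix_vector_mul_transpose transpose_transpose)
      also have "\<dots> = (\<Sum>k\<in>UNIV. (y \<bullet> (B t0 *v axis k 1))\<^sup>2)"
        unfolding inner_vec_def[of "transpose (B t0) *v y"]
      proof (rule sum.cong[OF refl])
        fix k
        have "(transpose (B t0) *v y) $ k = axis k 1 \<bullet> (transpose (B t0) *v y)" by (simp add: inner_axis')
        also have "\<dots> = y \<bullet> (B t0 *v axis k 1)" by (subst dot_matrix_vector_mul_transpose) (rule inner_commute)
        finally show "(transpose (B t0) *v y) $ k \<bullet> (transpose (B t0) *v y) $ k = (y \<bullet> (B t0 *v axis k 1))\<^sup>2"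
          by (simp add: power2_eq_square)
      qed
      finally have "E * (8 * (y \<bullet> (diffusion B t0 *v y)) - 4 * q0 * trD t0)
          = (\<Sum>k\<in>UNIV. E * (8 * (y \<bullet> (B t0 *v axis k 1))\<^sup>2 - 4 * q0 * ((B t0 *v axis k 1) \<bullet> (B t0 *v axis k 1))))"
        unfolding trD_def by (simp add: sum_distrib_left sum_subtractf right_diff_distrib)
      also have "\<dots> \<le> (\<Sum>k\<in>UNIV. k0 * ((B t0 *v axis k 1) \<bullet> (H x0 t0 *v (B t0 *v axis k 1))))"
        by (intro sum_mono spatial(2))
      also have "\<dots> = k0 * matrix_inner (diffusion B t0) (H x0 t0)"
        by (simp add: matrix_inner_diffusion linear_trace_diffusion sum_distrib_left)
      finally show ?thesis .
    qed
    have "k0 * time_deriv \<rho> x0 t0 + k0 * (G x0 t0 \<bullet> b x0 t0) + k0 * (c x0 t0 * \<rho> x0 t0)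
        = \<epsilon> * (k0 * matrix_inner (diffusion B t0) (H x0 t0))"
      using arg_cong[OF pde[OF t0(2), of x0], of "\<lambda>v. k0 * v"] unfolding G_def H_def by (simp add: algebra_simps)
    moreover have "\<epsilon> * (E * (8 * (c3 * (y \<bullet> y)) - 4 * q0 * trD t0)) \<le> \<epsilon> * (k0 * matrix_inner (diffusion B t0) (H x0 t0))"
    proof (rule mult_left_mono[OF order_trans[OF _ tr]])
      show "E * (8 * (c3 * (y \<bullet> y)) - 4 * q0 * trD t0) \<le> E * (8 * (y \<bullet> (diffusion B t0 *v y)) - 4 * q0 * trD t0)"
        using c3(2)[OF t0(2), of y] E by (simp add: power2_norm_eq_inner)
    qed (use eps in simp)
    moreover have "k0 * (c x0 t0 * \<rho> x0 t0) + k0 * (K * \<rho> x0 t0) \<le> 2 * K * (E * q0\<^sup>2)"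
    proof -
      have "k0 * \<rho> x0 t0 \<le> E * q0\<^sup>2" using h0 unfolding h_def k0_def E_def q0_def by simp
      moreover have "0 \<le> c x0 t0 + K" "c x0 t0 + K \<le> 2 * K" using K(2)[OF p0(1)] by auto
      moreover have "0 \<le> k0 * \<rho> x0 t0" using nonneg[OF t0(2)] k0 by simp
      ultimately have "(c x0 t0 + K) * (k0 * \<rho> x0 t0) \<le> (2 * K) * (E * q0\<^sup>2)"
        using K(1) by (intro mult_mono[of "c x0 t0 + K" "2 * K"]) auto
      then show ?thesis by (simp add: algebra_simps)
    qed
    moreover note temporal spatial(1)[of "b x0 t0"]
    ultimately have "\<epsilon> * (E * (8 * (c3 * (y \<bullet> y)) - 4 * q0 * trD t0)) + 4 * E * q0 * (y \<bullet> b x0 t0)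
        - 2 * K * (E * q0\<^sup>2) \<le> E * (4 * q0 * (y \<bullet> w) - \<Lambda> * q0\<^sup>2)"
      by (simp add: algebra_simps)
    then have "E * (8 * \<epsilon> * c3 * (y \<bullet> y) - q0 * (4 * \<epsilon> * trD t0 - 4 * (y \<bullet> b x0 t0) + 4 * (y \<bullet> w))
        - 2 * K * q0\<^sup>2 + \<Lambda> * q0\<^sup>2) \<le> 0"
      by (simp add: algebra_simps)
    then have "8 * \<epsilon> * c3 * (y \<bullet> y) - q0 * (4 * \<epsilon> * trD t0 - 4 * (y \<bullet> b x0 t0) + 4 * (y \<bullet> w))
        - 2 * K * q0\<^sup>2 + \<Lambda> * q0\<^sup>2 \<le> 0"
      using E by (simp add: mult_le_0_iff)
    moreover have "q0 * (4 * \<epsilon> * trD t0 - 4 * (y \<bullet> b x0 t0) + 4 * (y \<bullet> w)) \<le> q0 * M"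
      using M(2)[OF p0(1)] q0 unfolding m_def y_def[symmetric] by (intro mult_left_mono) auto
    moreover have "y \<bullet> y = r\<^sup>2 - q0" by (simp add: q0y)
    ultimately have "\<alpha> - M' * q0 + (M'\<^sup>2 / \<alpha>) * q0\<^sup>2 \<le> 0"
      unfolding M'_def \<Lambda>_def \<alpha>_def by (simp add: algebra_simps)
    then show False using barrier_quadratic_pos[OF \<alpha>, of M' q0] by simp
  qed
  have "(x2, t2) \<in> Q" using t12 r(1) z2 by (simp add: Q_iff)
  from h_pos[OF this] have "\<delta> * exp (- \<Lambda> * t2) * (q x2 t2)\<^sup>2 \<le> exp (- K * t2) * \<rho> x2 t2" unfolding h_def by simp
  moreover have "0 < \<delta> * exp (- \<Lambda> * t2) * (q x2 t2)\<^sup>2" using \<delta> r(1) by (simp add: q_def z2)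
  ultimately have "0 < exp (- K * t2) * \<rho> x2 t2" by linarith
  then show ?thesis by (simp add: zero_less_mult_iff)
qed

section \<open>Integration over the slab\<close>

text \<open>
  \<open>T\<close> is Lebesgue integrable over the slab with integral \<open>c\<close>. Values of \<open>T\<close> at other times are
  irrelevant.
\<close>

definition has_slab_integral :: "(real^'n \<Rightarrow> real \<Rightarrow> real) \<Rightarrow> real \<Rightarrow> bool" where
  "has_slab_integral T c \<longleftrightarrow>
     has_bochner_integral lborel (\<lambda>p. indicator slab p *\<^sub>R T (fst p) (snd p)) c"

lemma has_slab_integral_cong:
  assumes "has_slab_integral T c" "\<And>x t. t \<in> {0<..<1} \<Longrightarrow> S x t = T x t"
  shows "has_slab_integral S c"
proof -
  have "(\<lambda>p. indicator slab p *\<^sub>R S (fst p) (snd p)) = (\<lambda>p. indicator slab p *\<^sub>R T (fst p) (snd p))"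
    using assms(2) by (auto simp: indicator_def fun_eq_iff)
  then show ?thesis using assms(1) unfolding has_slab_integral_def by simp
qed

lemma has_slab_integral_add:
  "has_slab_integral S a \<Longrightarrow> has_slab_integral T b \<Longrightarrow> has_slab_integral (\<lambda>x t. S x t + T x t) (a + b)"
  unfolding has_slab_integral_def scaleR_add_right by (rule has_bochner_integral_add)

lemma has_slab_integral_diff:
  "has_slab_integral S a \<Longrightarrow> has_slab_integral T b \<Longrightarrow> has_slab_integral (\<lambda>x t. S x t - T x t) (a - b)"
  unfolding has_slab_integral_def scaleR_diff_right by (rule has_bochner_integral_diff)

lemma has_slab_integral_cmult:
  "has_slab_integral T a \<Longrightarrow> has_slab_integral (\<lambda>x t. k * T x t) (k * a)"
  unfolding has_slab_integral_def using has_bochner_integral_mult_right[of k lborel _ a]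
  by (simp add: mult.left_commute)

lemma has_slab_integral_sum:
  assumes "\<And>i. i \<in> A \<Longrightarrow> has_slab_integral (T i) (c i)"
  shows "has_slab_integral (\<lambda>x t. \<Sum>i\<in>A. T i x t) (\<Sum>i\<in>A. c i)"
  using assms unfolding has_slab_integral_def scaleR_sum_right by (intro has_bochner_integral_sum) auto

lemma has_slab_integral_nonneg:
  assumes "has_slab_integral T a" "\<And>x t. t \<in> {0<..<1} \<Longrightarrow> 0 \<le> T x t"
  shows "0 \<le> a"
proof -
  have "a = (LINT p|lborel. indicator slab p *\<^sub>R T (fst p) (snd p))"
    using assms(1) unfolding has_slab_integral_def by (simp add: has_bochner_integral_integral_eq)
  also have "\<dots> \<ge> 0" using assms(2) by (intro Bochner_Integration.integral_nonneg) (auto simp: indicator_def)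
  finally show ?thesis .
qed

lemma has_slab_integral_compact_support:
  assumes "continuous_on_slab T" "compact K" "K \<subseteq> slab"
    "\<And>x t. t \<in> {0<..<1} \<Longrightarrow> (x, t) \<notin> K \<Longrightarrow> T x t = 0"
  obtains c where "has_slab_integral T c"
proof -
  have "integrable lborel (\<lambda>p. indicator slab p *\<^sub>R T (fst p) (snd p))"
    by (rule compact_support_integrable[OF assms(2,3)]) (use assms in \<open>auto simp: continuous_on_slab_def\<close>)
  then show thesis using that unfolding has_slab_integral_def has_bochner_integral_iff by blast
qed

lemma compact_slab_margin:
  fixes K :: "((real^'n) \<times> real) set"
  assumes "compact K" "K \<subseteq> slab"
  obtains d where "0 < d" "\<And>x t. (x, t) \<in> K \<Longrightarrow> d < t \<and> t < 1 - d"
proof (cases "K = {}")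
  case True
  then show thesis using that[of 1] by auto
next
  case False
  have c: "compact (snd ` K)" using assms(1) by (intro compact_continuous_image continuous_intros)
  obtain a where a: "a \<in> snd ` K" "\<And>t. t \<in> snd ` K \<Longrightarrow> a \<le> t"
    using compact_attains_inf[OF c] False by auto
  obtain b where b: "b \<in> snd ` K" "\<And>t. t \<in> snd ` K \<Longrightarrow> t \<le> b"
    using compact_attains_sup[OF c] False by auto
  have ab: "0 < a" "b < 1" using a(1) b(1) assms(2) by auto
  obtain m where m: "0 < m" "m \<le> a" "m \<le> 1 - b"
    using ab by (metis diff_gt_0_iff_gt min.cobounded1 min.cobounded2 min_less_iff_conj)
  show thesis
  proof (rule that[of "m / 2"])
    fix x t assume "(x, t) \<in> K"
    then have "a \<le> t" "t \<le> b" using a(2)[of t] b(2)[of t] by force+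
    then show "m / 2 < t \<and> t < 1 - m / 2" using m by linarith
  qed (use m in auto)
qed

lemma slab_integral_divergence:
  assumes Z: "has_space_derivative Z Z'" and K: "compact K" "K \<subseteq> slab"
    and z: "\<And>x t. t \<in> {0<..<1} \<Longrightarrow> (x, t) \<notin> K \<Longrightarrow> Z x t = 0"
  shows "has_slab_integral (\<lambda>x t. linear_trace (Z' x t)) 0"
proof -
  have "has_slab_integral (\<lambda>x t. Z' x t (axis i 1) $ i) 0" for i
    unfolding has_slab_integral_def
  proof (rule integral_directional_derivative[OF open_slab K, where G = "\<lambda>p. Z (fst p) (snd p) $ i" and v = "(axis i 1, 0)"])
    fix p :: "(real^'a) \<times> real" assume "p \<in> slab"
    then have t: "snd p \<in> {0<..<1}" by auto
    have line: "((\<lambda>s. fst p + s *\<^sub>R axis i 1) has_derivative (\<lambda>s. s *\<^sub>R axis i 1)) (at 0)"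
      by (auto intro!: derivative_eq_intros)
    have "((\<lambda>s. Z (fst p + s *\<^sub>R axis i 1) (snd p)) has_derivative (\<lambda>s. Z' (fst p) (snd p) (s *\<^sub>R axis i 1))) (at 0)"
      using has_derivative_compose[OF line] has_space_derivativeD(1)[OF Z t, of "fst p"] by simp
    from bounded_linear.has_derivative[OF bounded_linear_vec_nth this, of i]
    show "((\<lambda>s. Z (fst (p + s *\<^sub>R (axis i 1, 0))) (snd (p + s *\<^sub>R (axis i 1, 0))) $ i) has_real_derivative
         Z' (fst p) (snd p) (axis i 1) $ i) (at 0)"
      unfolding has_field_derivative_def using has_space_derivativeD(4)[OF Z t, of "fst p"]
      by (auto simp: linear_scale fun_eq_iff intro: has_derivative_eq_rhs)
  qed (use has_space_derivativeD(2,3)[OF Z] z in \<open>auto simp: continuous_on_slab_def intro!: continuous_intros\<close>)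
  from has_slab_integral_sum[of UNIV, OF this] show ?thesis unfolding linear_trace_def by simp
qed

lemma slab_integration_by_parts_space:
  assumes g: "has_space_derivative g (\<lambda>x t h. G x t \<bullet> h)" and Z: "has_space_derivative Z Z'"
    and K: "compact K" "K \<subseteq> slab"
    and z: "\<And>x t. t \<in> {0<..<1} \<Longrightarrow> (x, t) \<notin> K \<Longrightarrow> g x t *\<^sub>R Z x t = 0"
  shows "has_slab_integral (\<lambda>x t. g x t * linear_trace (Z' x t) + G x t \<bullet> Z x t) 0"
  using slab_integral_divergence[OF has_space_derivative_scaleR[OF g Z] K z]
  by (simp add: linear_trace_add linear_trace_scaleR linear_trace_rank1)

lemma slab_integration_by_parts_time:
  assumes g: "\<And>x t. t \<in> {0<..<1} \<Longrightarrow> ((\<lambda>s. g x s) has_real_derivative gt x t) (at t)"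
    and h: "\<And>x t. t \<in> {0<..<1} \<Longrightarrow> ((\<lambda>s. h x s) has_real_derivative ht x t) (at t)"
    and c: "continuous_on_slab g" "continuous_on_slab gt" "continuous_on_slab h" "continuous_on_slab ht"
    and K: "compact K" "K \<subseteq> slab"
    and z: "\<And>x t. t \<in> {0<..<1} \<Longrightarrow> (x, t) \<notin> K \<Longrightarrow> g x t * h x t = 0"
  shows "has_slab_integral (\<lambda>x t. g x t * ht x t + gt x t * h x t) 0"
  unfolding has_slab_integral_def
proof (rule integral_directional_derivative[OF open_slab K, where G = "\<lambda>p. g (fst p) (snd p) * h (fst p) (snd p)" and v = "(0, 1)"])
  fix p :: "(real^'a) \<times> real" assume "p \<in> slab"
  then have t: "snd p \<in> {0<..<1}" by auto
  have shift: "((\<lambda>s. snd p + s) has_real_derivative 1) (at 0)" by (auto intro!: derivative_eq_intros)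
  have "((\<lambda>s. g (fst p) (snd p + s)) has_real_derivative gt (fst p) (snd p) * 1) (at 0)"
    by (rule DERIV_chain2[OF _ shift]) (use g[OF t, of "fst p"] in simp)
  moreover have "((\<lambda>s. h (fst p) (snd p + s)) has_real_derivative ht (fst p) (snd p) * 1) (at 0)"
    by (rule DERIV_chain2[OF _ shift]) (use h[OF t, of "fst p"] in simp)
  ultimately show "((\<lambda>s. g (fst (p + s *\<^sub>R (0, 1))) (snd (p + s *\<^sub>R (0, 1))) * h (fst (p + s *\<^sub>R (0, 1))) (snd (p + s *\<^sub>R (0, 1))))
      has_real_derivative g (fst p) (snd p) * ht (fst p) (snd p) + gt (fst p) (snd p) * h (fst p) (snd p)) (at 0)"
    by (auto intro!: derivative_eq_intros)
qed (use c z in \<open>fastforce simp: continuous_on_slab_def intro!: continuous_intros\<close>)+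

text \<open>
  The iterated integrals in the Lagrangian and in the control cost run over the closed time interval;
  the endpoints are null, so no regularity is needed there.
\<close>

lemma has_slab_integral_iterated:
  assumes "has_slab_integral T c"
  shows "(LINT t:{0..1}|lborel. LINT x|lborel. T x t) = c"
proof -
  define F where "F x t = indicator slab (x, t) *\<^sub>R T x t" for x t
  have "has_bochner_integral (lborel \<Otimes>\<^sub>M lborel) (case_prod F) c"
    using assms unfolding has_slab_integral_def F_def lborel_prod by (simp add: case_prod_beta')
  then have i: "integrable (lborel \<Otimes>\<^sub>M lborel) (case_prod F)" and c: "integral\<^sup>L (lborel \<Otimes>\<^sub>M lborel) (case_prod F) = c"
    by (auto simp: has_bochner_integral_iff)
  have "(LINT t|lborel. LINT x|lborel. F x t) = c"
    using lborel_pair.integral_snd[OF i] c by simp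
  moreover have "(LINT t:{0..1}|lborel. LINT x|lborel. T x t) = (LINT t|lborel. LINT x|lborel. F x t)"
    unfolding set_lebesgue_integral_def
    by (rule integral_discrete_difference[where X = "{0, 1}"])
       (auto simp: F_def indicator_def greaterThanLessThan_def)
  ultimately show ?thesis by simp
qed

lemma nn_slab_integral_iterated:
  assumes "continuous_on_slab T"
  shows "(\<integral>\<^sup>+t\<in>{0..1}. (\<integral>\<^sup>+x. ennreal (T x t) \<partial>lborel) \<partial>lborel)
    = (\<integral>\<^sup>+p. ennreal (indicator slab p *\<^sub>R T (fst p) (snd p)) \<partial>lborel)"
proof -
  have "(\<lambda>p. indicator slab p *\<^sub>R T (fst p) (snd p)) \<in> borel_measurable borel"
    using assms unfolding continuous_on_slab_def by (intro borel_measurable_continuous_on_indicator) auto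
  then have m: "(\<lambda>p. ennreal (indicator slab p *\<^sub>R T (fst p) (snd p))) \<in> borel_measurable (lborel \<Otimes>\<^sub>M lborel)"
    unfolding lborel_prod by measurable
  have "(\<integral>\<^sup>+t\<in>{0..1}. (\<integral>\<^sup>+x. ennreal (T x t) \<partial>lborel) \<partial>lborel)
      = (\<integral>\<^sup>+t. (\<integral>\<^sup>+x. ennreal (indicator slab (x, t) *\<^sub>R T (fst (x, t)) (snd (x, t))) \<partial>lborel) \<partial>lborel)"
  proof (rule nn_integral_cong_AE)
    have "AE t in lborel. t \<noteq> (0::real) \<and> t \<noteq> 1"
      using AE_lborel_singleton[of "0::real"] AE_lborel_singleton[of "1::real"] by eventually_elim auto
    then show "AE t in lborel. (\<integral>\<^sup>+x. ennreal (T x t) \<partial>lborel) * indicator {0..1} t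
        = (\<integral>\<^sup>+x. ennreal (indicator slab (x, t) *\<^sub>R T (fst (x, t)) (snd (x, t))) \<partial>lborel)"
      by eventually_elim (auto simp: indicator_def)
  qed
  also have "\<dots> = (\<integral>\<^sup>+p. ennreal (indicator slab p *\<^sub>R T (fst p) (snd p)) \<partial>(lborel \<Otimes>\<^sub>M lborel))"
    by (rule lborel_pair.nn_integral_snd[OF m])
  finally show ?thesis unfolding lborel_prod .
qed

lemma control_cost_slab:
  assumes u: "continuous_on_slab u" and \<rho>: "continuous_on_slab \<rho>" "\<And>x t. t \<in> {0<..<1} \<Longrightarrow> 0 \<le> \<rho> x t"
  shows "has_slab_integral (\<lambda>x t. (norm (u x t))\<^sup>2 * \<rho> x t) c \<Longrightarrow> control_cost \<rho> u = ennreal (c / 2)"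
    and "control_cost \<rho> u < \<infinity> \<Longrightarrow> \<exists>c. has_slab_integral (\<lambda>x t. (norm (u x t))\<^sup>2 * \<rho> x t) c"
proof -
  define T where "T x t = (norm (u x t))\<^sup>2 * \<rho> x t" for x t
  have cT: "continuous_on_slab T"
    using u \<rho>(1) unfolding T_def continuous_on_slab_def by (intro continuous_intros)
  have nonneg: "0 \<le> indicator slab p *\<^sub>R T (fst p) (snd p)" for p
    using \<rho>(2) unfolding T_def by (auto simp: indicator_def)
  have cost: "control_cost \<rho> u = 1 / 2 * (\<integral>\<^sup>+p. ennreal (indicator slab p *\<^sub>R T (fst p) (snd p)) \<partial>lborel)"
    unfolding control_cost_def nn_slab_integral_iterated[OF cT, symmetric] unfolding T_def ..
  have half: "1 / 2 * ennreal c = ennreal (c / 2)" if "0 \<le> c" for c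
  proof -
    have "1 / 2 * ennreal c = ennreal c * 1 / 2" by (subst mult.commute) (rule ennreal_times_divide)
    also have "\<dots> = ennreal (c / 2)" using ennreal_divide_numeral[OF that] by simp
    finally show ?thesis .
  qed
  show "control_cost \<rho> u = ennreal (c / 2)" if "has_slab_integral (\<lambda>x t. (norm (u x t))\<^sup>2 * \<rho> x t) c"
  proof -
    have h: "has_slab_integral T c" using that unfolding T_def .
    have "0 \<le> c" by (rule has_slab_integral_nonneg[OF h]) (use \<rho>(2) in \<open>auto simp: T_def\<close>)
    have "(\<integral>\<^sup>+p. ennreal (indicator slab p *\<^sub>R T (fst p) (snd p)) \<partial>lborel) = ennreal c"
      using h unfolding has_slab_integral_def has_bochner_integral_iff
      by (subst nn_integral_eq_integral[OF _ AE_I2[OF nonneg]]) auto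
    then show ?thesis unfolding cost using half[OF \<open>0 \<le> c\<close>] by simp
  qed
  show "\<exists>c. has_slab_integral (\<lambda>x t. (norm (u x t))\<^sup>2 * \<rho> x t) c" if "control_cost \<rho> u < \<infinity>"
  proof -
    have fin: "(\<integral>\<^sup>+p. ennreal (indicator slab p *\<^sub>R T (fst p) (snd p)) \<partial>lborel) < \<infinity>"
      using that unfolding cost by (auto simp: ennreal_mult_less_top ennreal_mult_eq_top_iff less_top)
    have "integrable lborel (\<lambda>p. indicator slab p *\<^sub>R T (fst p) (snd p))"
    proof (rule integrableI_nonneg)
      show "(\<lambda>p. indicator slab p *\<^sub>R T (fst p) (snd p)) \<in> borel_measurable lborel"
        using borel_measurable_continuous_on_indicator[of slab "\<lambda>p. T (fst p) (snd p)"] cT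
        unfolding continuous_on_slab_def by (simp add: open_slab borel_open)
    qed (use nonneg fin in auto)
    then show ?thesis unfolding has_slab_integral_def T_def has_bochner_integral_iff by blast
  qed
qed

section \<open>The first variation of the control energy\<close>

text \<open>
  The data of the control problem: noise strength, drift and input matrix, with uniformly positive
  definite diffusion. Everything is required on the open time interval only.
\<close>

locale controlled_diffusion =
  fixes \<epsilon> c3 :: real and f :: "real^'n \<Rightarrow> real \<Rightarrow> real^'n" and B :: "real \<Rightarrow> real^'m^'n"
  assumes eps: "0 < \<epsilon>"
    and C1f: "C1_in_space f"
    and contB: "continuous_on {0<..<1} B"
    and c3: "0 < c3" "\<And>y t. t \<in> {0<..<1} \<Longrightarrow> c3 * (norm y)\<^sup>2 \<le> y \<bullet> (diffusion B t *v y)"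
begin

lemma contD: "continuous_on {0<..<1} (diffusion B)"
  unfolding diffusion_def[abs_def] by (intro continuous_intros contB)

text \<open>
  The probability flux as a function of the density \<open>\<rho>\<close> and the momentum \<open>w\<close>, that is, \<open>\<rho>\<close> times the
  control. In these variables the Fokker-Planck equation is linear: the time derivative of \<open>\<rho>\<close> plus
  the divergence of the flux is zero.
\<close>

definition flux :: "(real^'n \<Rightarrow> real \<Rightarrow> real) \<Rightarrow> (real^'n \<Rightarrow> real \<Rightarrow> real^'m) \<Rightarrow> real^'n \<Rightarrow> real \<Rightarrow> real^'n" where
  "flux \<rho> w x t = \<rho> x t *\<^sub>R f x t + B t *v w x t - \<epsilon> *\<^sub>R (diffusion B t *v gradient (\<lambda>y. \<rho> y t) x)"

lemma flux_has_space_derivative: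
  assumes "C2_in_space_C1_in_time \<rho>" "has_space_derivative w w'"
  obtains Z' where "has_space_derivative (flux \<rho> w) Z'"
  by (rule that, unfold flux_def[abs_def], rule has_space_derivative_diff[OF has_space_derivative_add[OF
      has_space_derivative_scaleR[OF C2D(1)[OF assms(1)] C1_in_spaceD[OF C1f]]
      has_space_derivative_matrix[OF contB assms(2)]]
      has_space_derivative_cmult[OF has_space_derivative_matrix[OF contD C2D(2)[OF assms(1)]], of \<epsilon>]])

lemma fokker_planck_residual:
  assumes \<rho>: "C2_in_space_C1_in_time \<rho>" and u: "has_space_derivative u u'"
    and Z: "has_space_derivative (flux \<rho> (\<lambda>x t. \<rho> x t *\<^sub>R u x t)) Z'" and t: "t \<in> {0<..<1}"
  shows "divergence (\<lambda>y. \<rho> y t *\<^sub>R (f y t + B t *v u y t)) x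
      - \<epsilon> * matrix_inner (diffusion B t) (Hess (\<lambda>y. \<rho> y t) x) = linear_trace (Z' x t)"
proof -
  have S: "has_space_derivative (\<lambda>x t. f x t + B t *v u x t)
      (\<lambda>x t h. jacobian (\<lambda>y. f y t) (at x) *v h + B t *v u' x t h)"
    by (rule has_space_derivative_add[OF C1_in_spaceD[OF C1f] has_space_derivative_matrix[OF contB u]])
  define P' where "P' x t h = \<rho> x t *\<^sub>R (jacobian (\<lambda>y. f y t) (at x) *v h + B t *v u' x t h)
      + (gradient (\<lambda>y. \<rho> y t) x \<bullet> h) *\<^sub>R (f x t + B t *v u x t)" for x t h
  have P: "has_space_derivative (\<lambda>x t. \<rho> x t *\<^sub>R (f x t + B t *v u x t)) P'"
    using has_space_derivative_scaleR[OF C2D(1)[OF \<rho>] S] unfolding P'_def[abs_def] .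
  have "has_space_derivative (flux \<rho> (\<lambda>x t. \<rho> x t *\<^sub>R u x t))
      (\<lambda>x t h. P' x t h - \<epsilon> *\<^sub>R (diffusion B t *v (Hess (\<lambda>y. \<rho> y t) x *v h)))"
    by (rule has_space_derivative_cong[OF has_space_derivative_diff[OF P
        has_space_derivative_cmult[OF has_space_derivative_matrix[OF contD C2D(2)[OF \<rho>]], of \<epsilon>]]])
       (simp_all add: flux_def matrix_vector_mult_scaleR scaleR_add_right)
  from has_space_derivative_unique[OF Z this t]
  have "Z' x t = (\<lambda>h. P' x t h - \<epsilon> *\<^sub>R (diffusion B t *v (Hess (\<lambda>y. \<rho> y t) x *v h)))" by auto
  then show ?thesis
    by (simp add: divergence_eq[OF has_space_derivativeD(1)[OF P t]] linear_trace_diff linear_trace_scaleR matrix_inner_diffusion)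
qed

lemma fokker_planck_iff:
  assumes \<rho>: "C2_in_space_C1_in_time \<rho>" and u: "has_space_derivative u u'"
    and Z: "has_space_derivative (flux \<rho> (\<lambda>x t. \<rho> x t *\<^sub>R u x t)) Z'"
  shows "fokker_planck \<epsilon> f B \<rho> u \<longleftrightarrow> (\<forall>x. \<forall>t\<in>{0<..<1}. time_deriv \<rho> x t + linear_trace (Z' x t) = 0)"
proof -
  have "time_deriv \<rho> x t + divergence (\<lambda>y. \<rho> y t *\<^sub>R (f y t + B t *v u y t)) x
        = \<epsilon> * matrix_inner (diffusion B t) (Hess (\<lambda>y. \<rho> y t) x)
      \<longleftrightarrow> time_deriv \<rho> x t + linear_trace (Z' x t) = 0" if "t \<in> {0<..<1}" for x t
    unfolding fokker_planck_residual[OF assms that, symmetric] by linarith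
  then show ?thesis unfolding fokker_planck_def by blast
qed

lemma density_positive:
  assumes adm: "admissible \<rho>0 \<rho>1 \<rho> u" and fp: "fokker_planck \<epsilon> f B \<rho> u" and t: "t \<in> {0<..<1}"
  shows "0 < \<rho> x t"
proof -
  have C2: "C2_in_space_C1_in_time \<rho>" and pdf: "\<And>s. s \<in> {0..1} \<Longrightarrow> is_pdf (\<lambda>x. \<rho> x s)" and u: "C1_in_space u"
    using adm unfolding admissible_def density_path_def finite_energy_input_def by auto
  \<comment> \<open>the density at the earlier time \<open>t / 2\<close> has mass one, hence is positive somewhere\<close>
  have "\<exists>x1. 0 < \<rho> x1 (t / 2)"
  proof (rule ccontr)
    assume "\<nexists>x1. 0 < \<rho> x1 (t / 2)"
    then have "(\<lambda>x. \<rho> x (t / 2)) = (\<lambda>x. 0)"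
      using pdf[of "t / 2"] t unfolding is_pdf_def by (auto simp: fun_eq_iff not_less intro: antisym)
    moreover have "has_bochner_integral lborel (\<lambda>x. \<rho> x (t / 2)) 1"
      using pdf[of "t / 2"] t unfolding is_pdf_def by auto
    ultimately have "has_bochner_integral lborel (\<lambda>x::real^'n. 0::real) 1" by simp
    then show False using has_bochner_integral_eq[OF has_bochner_integral_zero] by fastforce
  qed
  then obtain x1 where x1: "0 < \<rho> x1 (t / 2)" by blast
  define b where "b x t = f x t + B t *v u x t" for x t
  define b' where "b' x t h = jacobian (\<lambda>y. f y t) (at x) *v h + B t *v (jacobian (\<lambda>y. u y t) (at x) *v h)" for x t h
  have b: "has_space_derivative b b'"
    using has_space_derivative_add[OF C1_in_spaceD[OF C1f] has_space_derivative_matrix[OF contB C1_in_spaceD[OF u]]]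
    unfolding b_def[abs_def, symmetric] b'_def[abs_def, symmetric] .
  show ?thesis
  proof (rule parabolic_positivity[OF eps C2 _ contB c3, where b = b and c = "\<lambda>x t. linear_trace (b' x t)" and ?t1.0 = "t / 2" and ?x1.0 = x1])
    show "0 \<le> \<rho> x s" if "s \<in> {0<..<1}" for x s using pdf[of s] that unfolding is_pdf_def by auto
    show "continuous_on_slab b" by (rule has_space_derivativeD(2)[OF b])
    show "continuous_on_slab (\<lambda>x t. linear_trace (b' x t))"
      using has_space_derivativeD(3)[OF b] unfolding linear_trace_def continuous_on_slab_def
      by (intro continuous_intros)
    show "time_deriv \<rho> x s + gradient (\<lambda>y. \<rho> y s) x \<bullet> b x s + linear_trace (b' x s) * \<rho> x s
        = \<epsilon> * matrix_inner (diffusion B s) (Hess (\<lambda>y. \<rho> y s) x)" if s: "s \<in> {0<..<1}" for x s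
    proof -
      have "divergence (\<lambda>y. \<rho> y s *\<^sub>R b y s) x = gradient (\<lambda>y. \<rho> y s) x \<bullet> b x s + linear_trace (b' x s) * \<rho> x s"
        using divergence_eq[OF has_space_derivativeD(1)[OF has_space_derivative_scaleR[OF C2D(1)[OF C2] b] s], of x]
        by (simp add: linear_trace_add linear_trace_scaleR linear_trace_rank1)
      moreover have "time_deriv \<rho> x s + divergence (\<lambda>y. \<rho> y s *\<^sub>R b y s) x
          = \<epsilon> * matrix_inner (diffusion B s) (Hess (\<lambda>y. \<rho> y s) x)"
        using fp s unfolding fokker_planck_def b_def by blast
      ultimately show ?thesis by (simp add: add.assoc)
    qed
  qed (use t x1 in auto)
qed

end

text \<open>
  Up to a factor 2, the energy density is the squared norm of the momentum divided by the density. Along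
  a linear perturbation of density and momentum its second-order remainder is explicit, and
  nonnegative where the perturbed density is positive. The
  perturbed control is written so that it equals \<open>u\<close> where the perturbation vanishes.
\<close>

lemma perturbed_energy:
  fixes u \<xi> :: "'a::real_inner" and \<rho> \<eta> s :: real
  assumes "\<rho> + s * \<eta> \<noteq> 0"
  shows "(norm (u + (s * inverse (\<rho> + s * \<eta>)) *\<^sub>R (\<xi> - \<eta> *\<^sub>R u)))\<^sup>2 * (\<rho> + s * \<eta>)
    = (norm u)\<^sup>2 * \<rho> + s * (2 * (u \<bullet> \<xi>) - (norm u)\<^sup>2 * \<eta>)
      + s\<^sup>2 * ((norm (\<xi> - \<eta> *\<^sub>R u))\<^sup>2 * inverse (\<rho> + s * \<eta>))"
proof -
  define r where "r = \<rho> + s * \<eta>"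
  define v where "v = \<xi> - \<eta> *\<^sub>R u"
  have uv: "u \<bullet> v = u \<bullet> \<xi> - \<eta> * (norm u)\<^sup>2" unfolding v_def by (simp add: inner_diff_right power2_norm_eq_inner)
  have sq: "(norm (u + k *\<^sub>R v))\<^sup>2 = (norm u)\<^sup>2 + 2 * k * (u \<bullet> v) + k\<^sup>2 * (norm v)\<^sup>2" for k
    by (simp add: power2_norm_eq_inner inner_add_left inner_add_right inner_commute[of v u])
       (simp add: power2_eq_square algebra_simps)
  have "(norm (u + (s * inverse r) *\<^sub>R v))\<^sup>2 * r
      = (norm u)\<^sup>2 * r + 2 * s * (inverse r * r) * (u \<bullet> v) + s\<^sup>2 * (norm v)\<^sup>2 * inverse r * (inverse r * r)"
    unfolding sq by (simp only: power2_eq_square ring_distribs mult_ac)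
  also have "inverse r * r = 1" using assms r_def by simp
  finally show ?thesis unfolding v_def[symmetric] r_def[symmetric] uv by (simp add: r_def algebra_simps)
qed

lemma linear_term_zero:
  fixes a c s0 :: real
  assumes "0 < s0" "0 \<le> c" "\<And>s. \<bar>s\<bar> \<le> s0 \<Longrightarrow> 0 \<le> s * a + s\<^sup>2 * c"
  shows "a = 0"
proof (rule ccontr)
  assume a: "a \<noteq> 0"
  define \<tau> where "\<tau> = min s0 (\<bar>a\<bar> / (2 * (c + 1)))"
  have \<tau>: "0 < \<tau>" "\<tau> \<le> s0" unfolding \<tau>_def using assms(1,2) a by auto
  have "\<tau> * (c + 1) \<le> \<bar>a\<bar> / (2 * (c + 1)) * (c + 1)" unfolding \<tau>_def using assms(2) by (intro mult_right_mono) auto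
  also have "\<dots> = \<bar>a\<bar> / 2" using assms(2) by (simp add: field_simps)
  finally have le: "\<tau> * c < \<bar>a\<bar>" using a \<tau>(1) by (simp add: distrib_left)
  have "\<bar>- sgn a * \<tau>\<bar> \<le> s0" using \<tau> a by (simp add: abs_mult abs_sgn_eq)
  from assms(3)[OF this] have "0 \<le> - (sgn a * a) * \<tau> + (sgn a)\<^sup>2 * \<tau>\<^sup>2 * c" by (simp add: power_mult_distrib mult_ac)
  also have "sgn a * a = \<bar>a\<bar>" by (simp add: abs_sgn mult.commute)
  also have "(sgn a)\<^sup>2 = 1" using a by (simp add: sgn_if)
  finally have "\<tau> * \<bar>a\<bar> \<le> \<tau> * (\<tau> * c)" by (simp add: power2_eq_square mult_ac)
  then show False using le \<tau>(1) by simp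
qed

context controlled_diffusion
begin

text \<open>
  Perturbing density and momentum by a compactly supported solution \<open>(\<eta>, \<xi>)\<close> of the linear
  Fokker-Planck equation with mass zero at each time gives admissible competitors, because the optimal density is
  bounded away from zero on compact sets; so the linear term of the energy vanishes.
\<close>

lemma first_variation:
  assumes opt: "solves_variational_problem \<epsilon> f B \<rho>0 \<rho>1 \<rho> u"
    and \<eta>: "C2_in_space_C1_in_time \<eta>" and \<xi>: "has_space_derivative \<xi> \<xi>'"
    and K: "compact K" "K \<subseteq> slab" "\<And>x t. (x, t) \<notin> K \<Longrightarrow> \<eta> x t = 0" "\<And>x t. (x, t) \<notin> K \<Longrightarrow> \<xi> x t = 0"
    and mass: "\<And>t. t \<in> {0<..<1} \<Longrightarrow> has_bochner_integral lborel (\<lambda>x. \<eta> x t) 0"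
    and Z: "has_space_derivative (flux \<eta> \<xi>) Z'"
    and lin: "\<And>x t. t \<in> {0<..<1} \<Longrightarrow> time_deriv \<eta> x t + linear_trace (Z' x t) = 0"
  shows "has_slab_integral (\<lambda>x t. 2 * (u x t \<bullet> \<xi> x t) - (norm (u x t))\<^sup>2 * \<eta> x t) 0"
proof -
  have adm: "admissible \<rho>0 \<rho>1 \<rho> u" and fp: "fokker_planck \<epsilon> f B \<rho> u"
    and min: "\<And>\<rho>' u'. admissible \<rho>0 \<rho>1 \<rho>' u' \<Longrightarrow> fokker_planck \<epsilon> f B \<rho>' u' \<Longrightarrow> \<not> control_cost \<rho>' u' < control_cost \<rho> u"
    using opt unfolding solves_variational_problem_def is_arg_min_def by auto
  have C2\<rho>: "C2_in_space_C1_in_time \<rho>" and C1u: "C1_in_space u" and fin: "control_cost \<rho> u < \<infinity>"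
    and pdf: "\<And>t. t \<in> {0..1} \<Longrightarrow> is_pdf (\<lambda>x. \<rho> x t)"
    and ends: "\<And>x. \<rho> x 0 = \<rho>0 x" "\<And>x. \<rho> x 1 = \<rho>1 x"
    and lim: "((\<lambda>t. LINT x|lborel. \<bar>\<rho> x t - \<rho> x 0\<bar>) \<longlongrightarrow> 0) (at_right 0)"
      "((\<lambda>t. LINT x|lborel. \<bar>\<rho> x t - \<rho> x 1\<bar>) \<longlongrightarrow> 0) (at_left 1)"
    using adm unfolding admissible_def density_path_def finite_energy_input_def by auto
  have pos: "0 < \<rho> x t" if "t \<in> {0<..<1}" for x t by (rule density_positive[OF adm fp that])
  note u = C1_in_spaceD[OF C1u]
  have c\<rho>: "continuous_on_slab \<rho>" and cu: "continuous_on_slab u"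
    and c\<eta>: "continuous_on_slab \<eta>" and c\<xi>: "continuous_on_slab \<xi>"
    using has_space_derivativeD(2) C2D(1)[OF C2\<rho>] u C2D(1)[OF \<eta>] \<xi> by blast+
  obtain s0 where s0: "0 < s0" "\<And>s x t. \<bar>s\<bar> \<le> s0 \<Longrightarrow> t \<in> {0<..<1} \<Longrightarrow> \<rho> x t / 2 \<le> \<rho> x t + s * \<eta> x t"
  proof -
    have "continuous_on slab (\<lambda>p. \<eta> (fst p) (snd p) * inverse (\<rho> (fst p) (snd p)))"
      using c\<rho> c\<eta> pos unfolding continuous_on_slab_def by (intro continuous_intros) (auto simp: less_le)
    from compact_continuous_bound[OF K(1) continuous_on_subset[OF this K(2)]]
    obtain M where M: "0 < M" "\<And>p. p \<in> K \<Longrightarrow> \<bar>\<eta> (fst p) (snd p) * inverse (\<rho> (fst p) (snd p))\<bar> \<le> M" by metis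
    show thesis
    proof (rule that[of "1 / (2 * M)"])
      fix s x t assume s: "\<bar>s\<bar> \<le> 1 / (2 * M)" and t: "t \<in> {0<..<1::real}"
      show "\<rho> x t / 2 \<le> \<rho> x t + s * \<eta> x t"
      proof (cases "(x, t) \<in> K")
        case True
        have "\<bar>s\<bar> * \<bar>\<eta> x t * inverse (\<rho> x t)\<bar> \<le> 1 / (2 * M) * M"
          using s M(1) M(2)[OF True] by (intro mult_mono) auto
        then have "\<bar>s * \<eta> x t\<bar> * inverse (\<rho> x t) \<le> 1 / 2" using M(1) pos[OF t, of x] by (simp add: abs_mult mult_ac)
        then have "\<bar>s * \<eta> x t\<bar> \<le> \<rho> x t / 2" using pos[OF t, of x] by (simp add: field_simps)
        then show ?thesis by linarith
      qed (use K(3) pos[OF t, of x] in auto)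
    qed (use M in auto)
  qed
  define A where "A x t = 2 * (u x t \<bullet> \<xi> x t) - (norm (u x t))\<^sup>2 * \<eta> x t" for x t
  define C where "C x t = 2 * ((norm (\<xi> x t - \<eta> x t *\<^sub>R u x t))\<^sup>2 * inverse (\<rho> x t))" for x t
  obtain e where e: "has_slab_integral (\<lambda>x t. (norm (u x t))\<^sup>2 * \<rho> x t) e"
    using control_cost_slab(2)[OF cu c\<rho> _ fin] pos less_imp_le by blast
  obtain a where a: "has_slab_integral A a"
    by (rule has_slab_integral_compact_support[of A, OF _ K(1,2)])
       (use cu c\<eta> c\<xi> K(3,4) in \<open>auto simp: A_def continuous_on_slab_def intro!: continuous_intros\<close>)
  have rpos: "\<rho> x t \<noteq> 0" if "t \<in> {0<..<1}" for x t using pos[OF that, of x] by simp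
  obtain c where c: "has_slab_integral C c"
    by (rule has_slab_integral_compact_support[of C, OF _ K(1,2)])
       (use cu c\<eta> c\<xi> c\<rho> K(3,4) rpos in \<open>auto simp: C_def continuous_on_slab_def intro!: continuous_intros\<close>)
  have c0: "0 \<le> c" by (rule has_slab_integral_nonneg[OF c]) (use pos in \<open>auto simp: C_def less_imp_le intro!: mult_nonneg_nonneg\<close>)
  obtain Zr where Zr: "has_space_derivative (flux \<rho> (\<lambda>x t. \<rho> x t *\<^sub>R u x t)) Zr"
    by (rule flux_has_space_derivative[OF C2\<rho> has_space_derivative_scaleR[OF C2D(1)[OF C2\<rho>] u]])
  have fpr: "time_deriv \<rho> x t + linear_trace (Zr x t) = 0" if "t \<in> {0<..<1}" for x t
    using fp that unfolding fokker_planck_iff[OF C2\<rho> u Zr] by blast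
  obtain d where d: "0 < d" "\<And>x t. (x, t) \<in> K \<Longrightarrow> d < t \<and> t < 1 - d"
    using compact_slab_margin[OF K(1,2)] by metis
  have key: "0 \<le> s * a + s\<^sup>2 * c" if s: "\<bar>s\<bar> \<le> s0" for s
  proof -
    define \<rho>s where "\<rho>s x t = \<rho> x t + s * \<eta> x t" for x t
    define us where "us x t = u x t + (s * inverse (\<rho>s x t)) *\<^sub>R (\<xi> x t - \<eta> x t *\<^sub>R u x t)" for x t
    have half: "\<rho> x t / 2 \<le> \<rho>s x t" if "t \<in> {0<..<1}" for x t unfolding \<rho>s_def by (rule s0(2)[OF s that])
    have \<rho>spos: "0 < \<rho>s x t" if "t \<in> {0<..<1}" for x t using half[OF that, of x] pos[OF that, of x] by linarith
    have \<rho>sne: "\<rho>s x t \<noteq> 0" if "t \<in> {0<..<1}" for x t using \<rho>spos[OF that, of x] by simp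
    have sd\<rho>s: "has_space_derivative \<rho>s (\<lambda>x t h. (gradient (\<lambda>y. \<rho> y t) x + s *\<^sub>R gradient (\<lambda>y. \<eta> y t) x) \<bullet> h)"
      by (rule has_space_derivative_cong[OF has_space_derivative_add[OF C2D(1)[OF C2\<rho>] has_space_derivative_cmult[OF C2D(1)[OF \<eta>], of s]]])
         (simp_all add: \<rho>s_def inner_add_left)
    have sdG: "has_space_derivative (\<lambda>x t. gradient (\<lambda>y. \<rho> y t) x + s *\<^sub>R gradient (\<lambda>y. \<eta> y t) x)
        (\<lambda>x t h. Hess (\<lambda>y. \<rho> y t) x *v h + s *\<^sub>R (Hess (\<lambda>y. \<eta> y t) x *v h))"
      by (rule has_space_derivative_add[OF C2D(2)[OF C2\<rho>] has_space_derivative_cmult[OF C2D(2)[OF \<eta>]]])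
    have tds: "((\<lambda>r. \<rho>s x r) has_real_derivative time_deriv \<rho> x t + s * time_deriv \<eta> x t) (at t)" if "t \<in> {0<..<1}" for x t
      unfolding \<rho>s_def using C2D(3)[OF C2\<rho> that] C2D(3)[OF \<eta> that] by (auto intro!: derivative_eq_intros)
    have ctd: "continuous_on_slab (\<lambda>x t. time_deriv \<rho> x t + s * time_deriv \<eta> x t)"
      using C2D(4)[OF C2\<rho>] C2D(4)[OF \<eta>] unfolding continuous_on_slab_def by (intro continuous_intros)
    have C2s: "C2_in_space_C1_in_time \<rho>s"
      "\<And>x t. t \<in> {0<..<1} \<Longrightarrow> gradient (\<lambda>y. \<rho>s y t) x = gradient (\<lambda>y. \<rho> y t) x + s *\<^sub>R gradient (\<lambda>y. \<eta> y t) x"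
      "\<And>x t. t \<in> {0<..<1} \<Longrightarrow> time_deriv \<rho>s x t = time_deriv \<rho> x t + s * time_deriv \<eta> x t"
      using C2I(1,2,4)[OF sd\<rho>s sdG _ ctd] tds by blast+
    have c\<rho>s: "continuous_on_slab \<rho>s" by (rule has_space_derivativeD(2)[OF sd\<rho>s])
    obtain us' where us': "has_space_derivative us us'"
    proof -
      obtain ri where "has_space_derivative (\<lambda>x t. inverse (\<rho>s x t)) ri"
        using has_space_derivative_inverse[OF sd\<rho>s] \<rho>sne by blast
      note i = has_space_derivative_cmult[OF this, of s]
      note v = has_space_derivative_diff[OF \<xi> has_space_derivative_scaleR[OF C2D(1)[OF \<eta>] u]]
      show thesis
        by (rule that, unfold us_def[abs_def],
            rule has_space_derivative_add[OF u has_space_derivative_scaleR[OF i v], unfolded real_scaleR_def])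
    qed
    have mom: "\<rho>s x t *\<^sub>R us x t = \<rho> x t *\<^sub>R u x t + s *\<^sub>R \<xi> x t" if "t \<in> {0<..<1}" for x t
    proof -
      have "\<rho>s x t *\<^sub>R us x t = \<rho>s x t *\<^sub>R u x t + (s * (\<rho>s x t * inverse (\<rho>s x t))) *\<^sub>R (\<xi> x t - \<eta> x t *\<^sub>R u x t)"
        unfolding us_def by (simp add: scaleR_add_right mult_ac)
      also have "\<rho>s x t * inverse (\<rho>s x t) = 1" using \<rho>sne[OF that] by simp
      finally show ?thesis unfolding \<rho>s_def by (simp add: algebra_simps)
    qed
    have fps: "fokker_planck \<epsilon> f B \<rho>s us"
    proof -
      have Zs: "has_space_derivative (flux \<rho>s (\<lambda>x t. \<rho>s x t *\<^sub>R us x t)) (\<lambda>x t h. Zr x t h + s *\<^sub>R Z' x t h)"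
      proof (rule has_space_derivative_cong[OF has_space_derivative_add[OF Zr has_space_derivative_cmult[OF Z, of s]]])
        fix x t assume t: "t \<in> {0<..<1::real}"
        show "flux \<rho>s (\<lambda>x t. \<rho>s x t *\<^sub>R us x t) x t = flux \<rho> (\<lambda>x t. \<rho> x t *\<^sub>R u x t) x t + s *\<^sub>R flux \<eta> \<xi> x t"
          unfolding flux_def mom[OF t] C2s(2)[OF t] unfolding \<rho>s_def
          by (simp add: matrix_vector_right_distrib matrix_vector_mult_scaleR algebra_simps)
      qed simp
      show ?thesis unfolding fokker_planck_iff[OF C2s(1) us' Zs]
      proof (intro allI ballI)
        fix x t assume t: "t \<in> {0<..<1::real}"
        show "time_deriv \<rho>s x t + linear_trace (\<lambda>h. Zr x t h + s *\<^sub>R Z' x t h) = 0"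
          using fpr[OF t, of x] lin[OF t, of x] unfolding C2s(3)[OF t] linear_trace_add linear_trace_scaleR
          by (metis (no_types, lifting) add.assoc add.commute add.left_neutral distrib_left mult_zero_right)
      qed
    qed
    have dens: "(norm (us x t))\<^sup>2 * \<rho>s x t = (norm (u x t))\<^sup>2 * \<rho> x t + s * A x t
        + s\<^sup>2 * ((norm (\<xi> x t - \<eta> x t *\<^sub>R u x t))\<^sup>2 * inverse (\<rho>s x t))" if "t \<in> {0<..<1}" for x t
      using perturbed_energy[of "\<rho> x t" s "\<eta> x t" "u x t" "\<xi> x t"] \<rho>sne[OF that, of x]
      unfolding us_def \<rho>s_def A_def by simp
    define R where "R x t = (norm (\<xi> x t - \<eta> x t *\<^sub>R u x t))\<^sup>2 * inverse (\<rho>s x t)" for x t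
    obtain r where r: "has_slab_integral R r"
      by (rule has_slab_integral_compact_support[of R, OF _ K(1,2)])
         (use cu c\<eta> c\<xi> c\<rho>s K(3,4) \<rho>sne in \<open>auto simp: R_def continuous_on_slab_def intro!: continuous_intros\<close>)
    have rc: "r \<le> c"
    proof -
      have "0 \<le> C x t - R x t" if t: "t \<in> {0<..<1}" for x t
      proof -
        have "inverse (\<rho>s x t) \<le> inverse (\<rho> x t / 2)"
          using half[OF t, of x] pos[OF t, of x] by (intro le_imp_inverse_le) auto
        also have "inverse (\<rho> x t / 2) = 2 * inverse (\<rho> x t)"
          by (simp only: divide_inverse inverse_mult_distrib inverse_inverse_eq mult.commute)
        finally have "inverse (\<rho>s x t) \<le> 2 * inverse (\<rho> x t)" .
        then have "R x t \<le> (norm (\<xi> x t - \<eta> x t *\<^sub>R u x t))\<^sup>2 * (2 * inverse (\<rho> x t))"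
          unfolding R_def by (intro mult_left_mono) auto
        then show ?thesis unfolding C_def by simp
      qed
      from has_slab_integral_nonneg[OF has_slab_integral_diff[OF c r] this] show ?thesis by simp
    qed
    have es: "has_slab_integral (\<lambda>x t. (norm (us x t))\<^sup>2 * \<rho>s x t) (e + s * a + s\<^sup>2 * r)"
      by (rule has_slab_integral_cong[OF has_slab_integral_add[OF has_slab_integral_add[OF e
            has_slab_integral_cmult[OF a]] has_slab_integral_cmult[OF r]]])
         (use dens R_def in auto)
    have costs: "control_cost \<rho>s us = ennreal ((e + s * a + s\<^sup>2 * r) / 2)"
      by (rule control_cost_slab(1)[OF has_space_derivativeD(2)[OF us'] c\<rho>s _ es]) (simp add: \<rho>spos less_imp_le)
    have adms: "admissible \<rho>0 \<rho>1 \<rho>s us"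
      unfolding admissible_def density_path_def finite_energy_input_def
    proof (intro conjI ballI allI)
      have out: "\<rho>s x t = \<rho> x t" if "t \<le> d \<or> 1 - d \<le> t" for x t
        using d(2)[of x t] K(3)[of x t] that unfolding \<rho>s_def by force
      show "is_pdf (\<lambda>x. \<rho>s x t)" if t: "t \<in> {0..1}" for t
      proof (cases "t \<in> {0<..<1}")
        case True
        have "has_bochner_integral lborel (\<lambda>x. \<rho> x t + s * \<eta> x t) (1 + s * 0)"
          using pdf[OF t] unfolding is_pdf_def
          by (intro has_bochner_integral_add has_bochner_integral_mult_right mass[OF True]) auto
        then show ?thesis using \<rho>spos[OF True] unfolding is_pdf_def \<rho>s_def by (auto simp: less_imp_le)
      next
        case False
        then have "(\<lambda>x. \<rho>s x t) = (\<lambda>x. \<rho> x t)" using out t d(1) by force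
        then show ?thesis using pdf[OF t] by simp
      qed
      show "C2_in_space_C1_in_time \<rho>s" by (rule C2s(1))
      show "\<rho>s x 0 = \<rho>0 x" "\<rho>s x 1 = \<rho>1 x" for x using out ends d(1) by auto
      have "\<forall>\<^sub>F t in at_right 0. (LINT x|lborel. \<bar>\<rho> x t - \<rho> x 0\<bar>) = (LINT x|lborel. \<bar>\<rho>s x t - \<rho>s x 0\<bar>)"
        using eventually_at_right_less[of 0] eventually_at_right_real[OF d(1)]
        by eventually_elim (use out d(1) in auto)
      then show "((\<lambda>t. LINT x|lborel. \<bar>\<rho>s x t - \<rho>s x 0\<bar>) \<longlongrightarrow> 0) (at_right 0)"
        by (rule Lim_transform_eventually[OF lim(1)])
      have "1 - d < 1" using d(1) by simp
      from eventually_at_left_real[OF this]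
      have "\<forall>\<^sub>F t in at_left 1. (LINT x|lborel. \<bar>\<rho> x t - \<rho> x 1\<bar>) = (LINT x|lborel. \<bar>\<rho>s x t - \<rho>s x 1\<bar>)"
        by eventually_elim (use out d(1) in auto)
      then show "((\<lambda>t. LINT x|lborel. \<bar>\<rho>s x t - \<rho>s x 1\<bar>) \<longlongrightarrow> 0) (at_left 1)"
        by (rule Lim_transform_eventually[OF lim(2)])
      show "C1_in_space us" by (rule C1_in_spaceI[OF us'])
      show "control_cost \<rho>s us < \<infinity>" unfolding costs by simp
    qed
    have "control_cost \<rho> u = ennreal (e / 2)"
      by (rule control_cost_slab(1)[OF cu c\<rho> _ e]) (simp add: pos less_imp_le)
    then have "\<not> ennreal ((e + s * a + s\<^sup>2 * r) / 2) < ennreal (e / 2)"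
      using min[OF adms fps] costs by simp
    moreover have "0 \<le> e + s * a + s\<^sup>2 * r"
      by (rule has_slab_integral_nonneg[OF es]) (simp add: \<rho>spos less_imp_le)
    ultimately have "e \<le> e + s * a + s\<^sup>2 * r" by (simp add: ennreal_less_iff)
    moreover have "s\<^sup>2 * r \<le> s\<^sup>2 * c" using rc by (intro mult_left_mono) auto
    ultimately show ?thesis by simp
  qed
  have "a = 0" by (rule linear_term_zero[OF s0(1) c0 key])
  then show ?thesis using a unfolding A_def by simp
qed

end

section \<open>Test perturbations and the potential\<close>

lemma has_slab_integral_Lebesgue:
  assumes "has_slab_integral T c" "\<And>x t. t \<notin> {0<..<1} \<Longrightarrow> T x t = 0"
  shows "(LINT p|lborel. T (fst p) (snd p)) = c"
proof -
  have "(\<lambda>p. indicator slab p *\<^sub>R T (fst p) (snd p)) = (\<lambda>p. T (fst p) (snd p))"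
    using assms(2) by (auto simp: fun_eq_iff indicator_def)
  then show ?thesis using assms(1) unfolding has_slab_integral_def by (simp add: has_bochner_integral_iff)
qed

text \<open>
  The bump on space-time as a curried function.
\<close>

abbreviation slab_bump :: "nat \<Rightarrow> real^'n \<Rightarrow> real \<Rightarrow> real \<Rightarrow> real^'n \<Rightarrow> real \<Rightarrow> real" where
  "slab_bump k a \<tau> r x t \<equiv> bump k (a, \<tau>) r (x, t)"

lemma slab_bump_has_space_derivative:
  fixes a :: "real^'n"
  shows "has_space_derivative (slab_bump (Suc (Suc k)) a \<tau> r)
     (\<lambda>x t h. - 2 * real (Suc (Suc k)) * ((x - a) \<bullet> h) * slab_bump (Suc k) a \<tau> r x t)"
proof (rule has_space_derivativeI)
  fix x :: "real^'n" and t :: real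
  have "((\<lambda>y. (y, t)) has_derivative (\<lambda>h. (h, 0))) (at x)"
    by (auto intro!: derivative_eq_intros)
  from has_derivative_compose[OF this bump_has_derivative[of k "(a, \<tau>)" r "(x, t)"]]
  show "((\<lambda>y. slab_bump (Suc (Suc k)) a \<tau> r y t) has_derivative
      (\<lambda>h. - 2 * real (Suc (Suc k)) * ((x - a) \<bullet> h) * slab_bump (Suc k) a \<tau> r x t)) (at x)"
    by simp
qed (auto simp: continuous_on_slab_def intro!: continuous_intros)

lemma slab_bump_time_derivative:
  "((\<lambda>s. slab_bump (Suc (Suc k)) a \<tau> r x s) has_real_derivative
     - 2 * real (Suc (Suc k)) * (t - \<tau>) * slab_bump (Suc k) a \<tau> r x t) (at t)"
  using bump_line_derivative[of k "(a, \<tau>)" r "(x, 0)" "(0, 1)" t] by simp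

lemma slab_bump_eq_0:
  "0 < r \<Longrightarrow> 0 < k \<Longrightarrow> (x, t) \<notin> cball (a, \<tau>) r \<Longrightarrow> slab_bump k a \<tau> r x t = 0"
  by (rule bump_eq_0)

lemma has_space_derivative_id: "has_space_derivative (\<lambda>x t. x - a) (\<lambda>x t h. h)"
  by (rule has_space_derivativeI) (auto simp: continuous_on_slab_def intro!: derivative_eq_intros continuous_intros)

lemma C2_zero: "C2_in_space_C1_in_time (\<lambda>x t. 0)"
  and gradient_zero: "gradient (\<lambda>y. 0) x = 0"
  and time_deriv_zero: "time_deriv (\<lambda>x t. 0) x t = 0"
proof -
  show "C2_in_space_C1_in_time (\<lambda>(x::real^'n) t. 0)"
    by (rule C2I(1)[where G = "\<lambda>x t. 0" and G' = "\<lambda>x t h. 0" and gt = "\<lambda>x t. 0"])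
       (auto intro!: has_space_derivative_time continuous_on_slab_const)
  show "gradient (\<lambda>y. 0) x = 0" by (rule gradient_eqI) simp
  show "time_deriv (\<lambda>x t. 0) x t = 0" by (simp add: time_deriv_def)
qed

context controlled_diffusion
begin

text \<open>
  The inverse of the diffusion matrix, which exists on the open time interval by coercivity.
\<close>

definition Dinv :: "real \<Rightarrow> real^'n^'n" where
  "Dinv t = matrix_inv (diffusion B t)"

lemma diffusion_lower_bound:
  assumes "t \<in> {0<..<1}"
  shows "c3 * norm y \<le> norm (diffusion B t *v y)"
proof (cases "y = 0")
  case False
  have "norm y * (c3 * norm y) \<le> y \<bullet> (diffusion B t *v y)"
    using c3(2)[OF assms, of y] by (simp add: power2_eq_square mult_ac)
  also have "\<dots> \<le> norm y * norm (diffusion B t *v y)" by (rule norm_cauchy_schwarz)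
  finally show ?thesis using False by simp
qed simp

lemma Dinv:
  assumes t: "t \<in> {0<..<1}"
  shows "diffusion B t ** Dinv t = mat 1" "Dinv t ** diffusion B t = mat 1"
proof -
  have "y = 0" if "diffusion B t *v y = 0" for y
    using diffusion_lower_bound[OF t, of y] c3(1) that by (simp add: mult_le_0_iff)
  then have "\<exists>C. C ** diffusion B t = mat 1" unfolding matrix_left_invertible_ker by blast
  then have "invertible (diffusion B t)" unfolding invertible_left_inverse .
  then have "\<exists>A'. diffusion B t ** A' = mat 1 \<and> A' ** diffusion B t = mat 1" unfolding invertible_def .
  from someI_ex[OF this]
  show "diffusion B t ** Dinv t = mat 1" "Dinv t ** diffusion B t = mat 1"
    unfolding Dinv_def matrix_inv_def by auto
qed

lemma Dinv_mult [simp]: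
  assumes t: "t \<in> {0<..<1}"
  shows "diffusion B t *v (Dinv t *v y) = y" "Dinv t *v (diffusion B t *v y) = y"
  using Dinv[OF t] by (auto simp: matrix_vector_mul_assoc)

lemma continuous_on_Dinv: "continuous_on {0<..<1} Dinv"
proof -
  have vec: "continuous_on {0<..<1} (\<lambda>t. Dinv t *v y)" for y
    unfolding continuous_on_def
  proof
    fix t assume t: "t \<in> {0<..<1::real}"
    have bound: "norm (Dinv s *v y - Dinv t *v y) \<le> norm (y - diffusion B s *v (Dinv t *v y)) / c3" if s: "s \<in> {0<..<1}" for s
      using diffusion_lower_bound[OF s, of "Dinv s *v y - Dinv t *v y"] c3(1) s
      by (simp add: matrix_vector_mult_diff_distrib pos_le_divide_eq mult.commute)
    have "((\<lambda>s. diffusion B s *v (Dinv t *v y)) \<longlongrightarrow> diffusion B t *v (Dinv t *v y)) (at t within {0<..<1})"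
      using continuous_on_matrix_vector_mult[OF contD continuous_on_const[of _ "Dinv t *v y"]] t
      unfolding continuous_on_def by blast
    from tendsto_diff[OF tendsto_const[of y] this]
    have "((\<lambda>s. y - diffusion B s *v (Dinv t *v y)) \<longlongrightarrow> 0) (at t within {0<..<1})" using t by simp
    from tendsto_divide[OF tendsto_norm[OF this] tendsto_const[of c3]]
    have lim: "((\<lambda>s. norm (y - diffusion B s *v (Dinv t *v y)) / c3) \<longlongrightarrow> 0) (at t within {0<..<1})"
      using c3(1) by simp
    have "((\<lambda>s. Dinv s *v y - Dinv t *v y) \<longlongrightarrow> 0) (at t within {0<..<1})"
      by (rule Lim_null_comparison[OF _ lim]) (auto simp: eventually_at_filter intro!: always_eventually bound)
    then show "((\<lambda>t. Dinv t *v y) \<longlongrightarrow> Dinv t *v y) (at t within {0<..<1})"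
      by (rule LIM_zero_cancel)
  qed
  have "Dinv = (\<lambda>t. \<chi> i j. (Dinv t *v axis j 1) $ i)"
    by (simp add: fun_eq_iff vec_eq_iff matrix_vector_mult_basis column_def)
  moreover have "continuous_on {0<..<1} (\<lambda>t. \<chi> i j. (Dinv t *v axis j 1) $ i)"
    by (intro continuous_intros vec)
  ultimately show ?thesis by (rule ssubst[where P = "continuous_on {0<..<1}"])
qed

text \<open>
  The field \<open>v\<close> with \<open>u = B\<^sup>T v\<close>, provided that \<open>u\<close> takes values in the range of \<open>B\<^sup>T\<close>. It turns out to be
  the gradient of the Lagrange multiplier.
\<close>

definition control_covector :: "(real^'n \<Rightarrow> real \<Rightarrow> real^'m) \<Rightarrow> real^'n \<Rightarrow> real \<Rightarrow> real^'n" where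
  "control_covector u x t = Dinv t *v (B t *v u x t)"

text \<open>
  Perturbations of the momentum alone: \<open>\<xi>\<close> is allowed if \<open>B \<xi>\<close> has divergence zero.
\<close>

lemma first_variation_stationary:
  assumes opt: "solves_variational_problem \<epsilon> f B \<rho>0 \<rho>1 \<rho> u"
    and \<xi>: "has_space_derivative \<xi> \<xi>'" and S: "has_space_derivative \<sigma> \<sigma>'"
    and K: "compact K" "K \<subseteq> slab" "\<And>x t. (x, t) \<notin> K \<Longrightarrow> \<xi> x t = 0"
    and B\<xi>: "\<And>x t. t \<in> {0<..<1} \<Longrightarrow> B t *v \<xi> x t = \<sigma> x t"
    and div: "\<And>x t. t \<in> {0<..<1} \<Longrightarrow> linear_trace (\<sigma>' x t) = 0"
  shows "has_slab_integral (\<lambda>x t. u x t \<bullet> \<xi> x t) 0"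
proof -
  have "has_slab_integral (\<lambda>x t. 2 * (u x t \<bullet> \<xi> x t) - (norm (u x t))\<^sup>2 * 0) 0"
  proof (rule first_variation[OF opt C2_zero \<xi> K(1,2)])
    show "has_space_derivative (flux (\<lambda>x t. 0) \<xi>) \<sigma>'"
      by (rule has_space_derivative_cong[OF S]) (simp_all add: flux_def gradient_zero B\<xi>)
  qed (use K(3) div time_deriv_zero has_bochner_integral_zero in auto)
  from has_slab_integral_cmult[OF this, of "1/2"] show ?thesis by simp
qed

text \<open>
  Momenta in the kernel of \<open>B\<close> do not act on the density, so the optimal control is orthogonal to this
  kernel, that is, in the range of \<open>B\<^sup>T\<close>.
\<close>

lemma optimal_control_range:
  assumes opt: "solves_variational_problem \<epsilon> f B \<rho>0 \<rho>1 \<rho> u" and u: "has_space_derivative u u'"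
    and t: "t \<in> {0<..<1}"
  shows "u x t = transpose (B t) *v control_covector u x t"
proof -
  define N where "N t y = y - transpose (B t) *v (Dinv t *v (B t *v y))" for t y
  have BN: "B t *v N t y = 0" if "t \<in> {0<..<1}" for t y
    using Dinv_mult(1)[OF that, of "B t *v y"]
    unfolding N_def diffusion_def by (simp add: matrix_vector_mult_diff_distrib matrix_vector_mul_assoc matrix_mul_assoc)
  have contN: "continuous_on {0<..<1} (\<lambda>t. N t y)" for y
    unfolding N_def by (intro continuous_intros contB continuous_on_Dinv)
  have orth: "u x t \<bullet> N t y = 0" if t: "t \<in> {0<..<1}" for x t y
  proof -
    have "(\<lambda>p. u (fst p) (snd p) \<bullet> N (snd p) y) (x, t) = 0"
    proof (rule fundamental_lemma_bump[OF open_slab, where k = 4])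
      show "continuous_on slab (\<lambda>p. u (fst p) (snd p) \<bullet> N (snd p) y)"
        using has_space_derivativeD(2)[OF u] continuous_on_slab_time[OF contN]
        unfolding continuous_on_slab_def by (intro continuous_intros)
      fix c :: "(real^'n) \<times> real" and r :: real
      assume r: "0 < r" "cball c r \<subseteq> slab"
      obtain a \<tau> where c: "c = (a, \<tau>)" by (cases c)
      have bd: "has_space_derivative (slab_bump 4 a \<tau> r) (\<lambda>x t h. - 8 * ((x - a) \<bullet> h) * slab_bump 3 a \<tau> r x t)"
        using slab_bump_has_space_derivative[of 2 a \<tau> r] by (simp add: numeral_eq_Suc)
      have "has_slab_integral (\<lambda>x t. u x t \<bullet> (slab_bump 4 a \<tau> r x t *\<^sub>R N t y)) 0"
      proof (rule first_variation_stationary[OF opt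
              has_space_derivative_scaleR[OF bd has_space_derivative_time[OF contN]]
              has_space_derivative_time[OF continuous_on_const, of 0] compact_cball r(2)])
        show "(x, t) \<notin> cball c r \<Longrightarrow> slab_bump 4 a \<tau> r x t *\<^sub>R N t y = 0" for x t
          using slab_bump_eq_0[OF r(1), of 4 x t a \<tau>] c by simp
        show "B t *v (slab_bump 4 a \<tau> r x t *\<^sub>R N t y) = 0" if "t \<in> {0<..<1}" for x t
          by (simp add: matrix_vector_mult_scaleR BN[OF that])
      qed (simp add: linear_trace_def)
      from has_slab_integral_Lebesgue[OF this]
      have "(LINT p|lborel. u (fst p) (snd p) \<bullet> (slab_bump 4 a \<tau> r (fst p) (snd p) *\<^sub>R N (snd p) y)) = 0"
        using slab_bump_eq_0[OF r(1), of 4 _ _ a \<tau>] r(2) c by force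
      then show "(LINT p|lborel. bump 4 c r p * (u (fst p) (snd p) \<bullet> N (snd p) y)) = 0"
        by (simp add: c)
    qed (use t in auto)
    then show ?thesis by simp
  qed
  define q where "q = u x t - transpose (B t) *v control_covector u x t"
  have q: "q = N t (u x t)" unfolding q_def N_def control_covector_def ..
  have "q \<bullet> q = u x t \<bullet> N t (u x t) - (transpose (B t) *v control_covector u x t) \<bullet> q"
    by (subst (1) q_def) (simp add: inner_diff_left q)
  also have "(transpose (B t) *v control_covector u x t) \<bullet> q = (B t *v q) \<bullet> control_covector u x t"
    by (metis dot_matrix_vector_mul_transpose inner_commute)
  finally have "q \<bullet> q = 0" using orth[OF t] BN[OF t] q by simp
  then show ?thesis unfolding q_def by simp
qed

lemma lift_inner:
  assumes "t \<in> {0<..<1}"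
  shows "(transpose (B t) *v w) \<bullet> (transpose (B t) *v (Dinv t *v y)) = w \<bullet> y"
    and "B t *v (transpose (B t) *v (Dinv t *v y)) = y"
proof -
  show *: "B t *v (transpose (B t) *v (Dinv t *v y)) = y"
    using Dinv_mult(1)[OF assms, of y] unfolding diffusion_def by (simp add: matrix_vector_mul_assoc matrix_mul_assoc)
  show "(transpose (B t) *v w) \<bullet> (transpose (B t) *v (Dinv t *v y)) = w \<bullet> y"
    using dot_matrix_vector_mul_transpose[of "transpose (B t) *v (Dinv t *v y)" "B t" w] *
    by (metis inner_commute)
qed

lemma control_covector_has_space_derivative:
  assumes "has_space_derivative u u'"
  shows "has_space_derivative (control_covector u) (\<lambda>x t h. Dinv t *v (B t *v u' x t h))"
  unfolding control_covector_def[abs_def]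
  by (intro has_space_derivative_matrix continuous_on_Dinv contB assms)

text \<open>
  Testing with the divergence-free flux obtained by rotating the gradient of a bump in the plane of
  \<open>p\<close> and \<open>q\<close> shows that the control covector is weakly curl-free in space.
\<close>

lemma weak_curl_space:
  assumes opt: "solves_variational_problem \<epsilon> f B \<rho>0 \<rho>1 \<rho> u" and u: "has_space_derivative u u'"
    and r: "0 < r" "cball (a, \<tau>) r \<subseteq> slab"
  shows "has_slab_integral (\<lambda>x t. ((control_covector u x t \<bullet> p) * ((x - a) \<bullet> q)
      - (control_covector u x t \<bullet> q) * ((x - a) \<bullet> p)) * slab_bump 3 a \<tau> r x t) 0"
proof -
  define \<sigma> where "\<sigma> x t = slab_bump 3 a \<tau> r x t *\<^sub>R (((x - a) \<bullet> q) *\<^sub>R p - ((x - a) \<bullet> p) *\<^sub>R q)" for x t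
  have bd: "has_space_derivative (slab_bump 3 a \<tau> r) (\<lambda>x t h. - 6 * ((x - a) \<bullet> h) * slab_bump 2 a \<tau> r x t)"
    using slab_bump_has_space_derivative[of 1 a \<tau> r] by (simp add: numeral_eq_Suc)
  have const: "has_space_derivative (\<lambda>x t. c) (\<lambda>x t h. 0)" for c :: "real^'n"
    by (rule has_space_derivative_time) (rule continuous_on_const)
  have ip: "has_space_derivative (\<lambda>x t. (x - a) \<bullet> c) (\<lambda>x t h. h \<bullet> c)" for c
    using has_space_derivative_inner[OF has_space_derivative_id const[of c]] by simp
  define \<sigma>' where "\<sigma>' x t h = slab_bump 3 a \<tau> r x t *\<^sub>R ((q \<bullet> h) *\<^sub>R p - (p \<bullet> h) *\<^sub>R q)
      + ((- 6 * slab_bump 2 a \<tau> r x t) * ((x - a) \<bullet> h)) *\<^sub>R (((x - a) \<bullet> q) *\<^sub>R p - ((x - a) \<bullet> p) *\<^sub>R q)" for x t h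
  have S: "has_space_derivative \<sigma> \<sigma>'"
    by (rule has_space_derivative_cong[OF has_space_derivative_scaleR[OF bd
          has_space_derivative_diff[OF has_space_derivative_scaleR[OF ip[of q] const[of p]]
            has_space_derivative_scaleR[OF ip[of p] const[of q]]]]])
       (simp_all add: \<sigma>_def \<sigma>'_def inner_commute mult_ac)
  have tr: "linear_trace (\<sigma>' x t) = 0" for x t
  proof -
    define w where "w = ((x - a) \<bullet> q) *\<^sub>R p - ((x - a) \<bullet> p) *\<^sub>R q"
    have "\<sigma>' x t = (\<lambda>h. slab_bump 3 a \<tau> r x t *\<^sub>R ((q \<bullet> h) *\<^sub>R p - (p \<bullet> h) *\<^sub>R q)
        + (- 6 * slab_bump 2 a \<tau> r x t) *\<^sub>R (((x - a) \<bullet> h) *\<^sub>R w))"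
      by (simp add: fun_eq_iff \<sigma>'_def w_def)
    then have "linear_trace (\<sigma>' x t) = slab_bump 3 a \<tau> r x t * (q \<bullet> p - p \<bullet> q) + (- 6 * slab_bump 2 a \<tau> r x t) * ((x - a) \<bullet> w)"
      by (simp only: linear_trace_add linear_trace_diff linear_trace_scaleR linear_trace_rank1)
    also have "(x - a) \<bullet> w = 0" unfolding w_def by (simp add: inner_diff_right)
    finally show ?thesis by (simp add: inner_commute)
  qed
  have "has_slab_integral (\<lambda>x t. u x t \<bullet> (transpose (B t) *v (Dinv t *v \<sigma> x t))) 0"
  proof (rule first_variation_stationary[OF opt
        has_space_derivative_matrix[OF continuous_on_transpose[OF contB] has_space_derivative_matrix[OF continuous_on_Dinv S]] S compact_cball r(2)])
    show "transpose (B t) *v (Dinv t *v \<sigma> x t) = 0" if "(x, t) \<notin> cball (a, \<tau>) r" for x t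
      using slab_bump_eq_0[OF r(1) _ that, of 3] by (simp add: \<sigma>_def)
  qed (use lift_inner(2) tr in auto)
  then show ?thesis
  proof (rule has_slab_integral_cong)
    fix x t assume t: "t \<in> {0<..<1::real}"
    have "u x t \<bullet> (transpose (B t) *v (Dinv t *v \<sigma> x t)) = control_covector u x t \<bullet> \<sigma> x t"
      by (subst optimal_control_range[OF opt u t]) (rule lift_inner(1)[OF t])
    then show "((control_covector u x t \<bullet> p) * ((x - a) \<bullet> q) - (control_covector u x t \<bullet> q) * ((x - a) \<bullet> p)) * slab_bump 3 a \<tau> r x t
        = u x t \<bullet> (transpose (B t) *v (Dinv t *v \<sigma> x t))"
      by (simp add: \<sigma>_def inner_diff_right algebra_simps)
  qed
qed

end

context controlled_diffusion
begin

text \<open>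
  The terms of the Hamilton-Jacobi-Bellman equation other than the time derivative, with the gradient
  of the unknown replaced by the control covector.
\<close>

definition hamiltonian :: "(real^'n \<Rightarrow> real \<Rightarrow> real^'m) \<Rightarrow> real^'n \<Rightarrow> real \<Rightarrow> real" where
  "hamiltonian u x t = control_covector u x t \<bullet> f x t + 1 / 2 * (norm (u x t))\<^sup>2
     + \<epsilon> * divergence (\<lambda>y. diffusion B t *v control_covector u y t) x"

lemma dot_diffusion_commute: "(diffusion B t *v x) \<bullet> y = x \<bullet> (diffusion B t *v y)"
  by (metis dot_matrix_vector_mul_transpose transpose_diffusion inner_commute)

text \<open>
  The remaining components of the space-time curl of the field \<open>(v, - H)\<close>, where \<open>v\<close> is the control
  covector and \<open>H\<close> the Hamiltonian. The density is perturbed by the derivative in direction \<open>p\<close> of a bump,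
  up to a constant factor; the momentum compensates the drift and diffusion of this perturbation and its change in time.
\<close>

lemma weak_curl_time:
  assumes opt: "solves_variational_problem \<epsilon> f B \<rho>0 \<rho>1 \<rho> u" and u: "has_space_derivative u u'"
    and r: "0 < r" "cball (a, \<tau>) r \<subseteq> slab"
  shows "has_slab_integral (\<lambda>x t. ((control_covector u x t \<bullet> p) * (t - \<tau>)
      + hamiltonian u x t * ((x - a) \<bullet> p)) * slab_bump 3 a \<tau> r x t) 0"
proof -
  define v where "v = control_covector u"
  define K where "K = cball (a, \<tau>) r"
  have K: "compact K" "K \<subseteq> slab" unfolding K_def using r by auto
  have b0: "slab_bump k a \<tau> r x t = 0" if "(x, t) \<notin> K" "0 < k" for k x t
    using slab_bump_eq_0[OF r(1) that(2)] that(1) unfolding K_def by simp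
  have b3: "has_space_derivative (slab_bump 3 a \<tau> r) (\<lambda>x t h. - 6 * ((x - a) \<bullet> h) * slab_bump 2 a \<tau> r x t)"
    using slab_bump_has_space_derivative[of 1 a \<tau> r] by (simp add: numeral_eq_Suc)
  have b2: "has_space_derivative (slab_bump 2 a \<tau> r) (\<lambda>x t h. - 4 * ((x - a) \<bullet> h) * slab_bump 1 a \<tau> r x t)"
    using slab_bump_has_space_derivative[of 0 a \<tau> r] by (simp add: numeral_eq_Suc)
  have const: "has_space_derivative (\<lambda>x t. c) (\<lambda>x t h. 0)" for c :: "real^'n"
    by (rule has_space_derivative_time) (rule continuous_on_const)
  have ip: "has_space_derivative (\<lambda>x t. (x - a) \<bullet> p) (\<lambda>x t h. h \<bullet> p)"
    using has_space_derivative_inner[OF has_space_derivative_id const[of p]] by simp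
  define \<eta> where "\<eta> x t = slab_bump 3 a \<tau> r x t * ((x - a) \<bullet> p)" for x t
  define G where "G x t = slab_bump 3 a \<tau> r x t *\<^sub>R p + slab_bump 2 a \<tau> r x t *\<^sub>R ((- 6 * ((x - a) \<bullet> p)) *\<^sub>R (x - a))" for x t
  have sd\<eta>: "has_space_derivative \<eta> (\<lambda>x t h. G x t \<bullet> h)"
    by (rule has_space_derivative_cong[OF has_space_derivative_scaleR[OF b3 ip]])
       (simp_all add: \<eta>_def G_def inner_add_left inner_commute[of p] algebra_simps)
  obtain G' where sdG: "has_space_derivative G G'"
    by (rule that, unfold G_def[abs_def], rule has_space_derivative_add[OF has_space_derivative_scaleR[OF b3 const]
        has_space_derivative_scaleR[OF b2 has_space_derivative_scaleR[OF
          has_space_derivative_cmult[OF ip, of "-6", unfolded real_scaleR_def] has_space_derivative_id]]])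
  have dt: "((\<lambda>s. \<eta> x s) has_real_derivative - 6 * (t - \<tau>) * slab_bump 2 a \<tau> r x t * ((x - a) \<bullet> p)) (at t)" for x t
    unfolding \<eta>_def using slab_bump_time_derivative[of 1 a \<tau> r x t]
    by (auto intro!: derivative_eq_intros simp: numeral_eq_Suc)
  have cdt: "continuous_on_slab (\<lambda>x t. - 6 * (t - \<tau>) * slab_bump 2 a \<tau> r x t * ((x - a) \<bullet> p))"
    unfolding continuous_on_slab_def by (intro continuous_intros)
  note C2\<eta> = C2I[OF sd\<eta> sdG dt cdt]
  \<comment> \<open>chosen so that the flux of the perturbation is the last term alone, whose divergence cancels
    the time derivative of \<open>\<eta>\<close>\<close>
  define \<sigma> where "\<sigma> x t = \<epsilon> *\<^sub>R (diffusion B t *v G x t) - \<eta> x t *\<^sub>R f x t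
      - slab_bump 3 a \<tau> r x t *\<^sub>R ((t - \<tau>) *\<^sub>R p)" for x t
  obtain \<sigma>' where S: "has_space_derivative \<sigma> \<sigma>'"
  proof (rule that, unfold \<sigma>_def[abs_def], rule has_space_derivative_diff[OF has_space_derivative_diff[OF
        has_space_derivative_cmult[OF has_space_derivative_matrix[OF contD sdG]]
        has_space_derivative_scaleR[OF sd\<eta> C1_in_spaceD[OF C1f]]]
        has_space_derivative_scaleR[OF b3 has_space_derivative_time]])
    show "continuous_on {0<..<1} (\<lambda>t. (t - \<tau>) *\<^sub>R p)" by (intro continuous_intros)
  qed
  define \<xi> where "\<xi> x t = transpose (B t) *v (Dinv t *v \<sigma> x t)" for x t
  have sd\<xi>: "has_space_derivative \<xi> (\<lambda>x t h. transpose (B t) *v (Dinv t *v \<sigma>' x t h))"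
    unfolding \<xi>_def[abs_def]
    by (intro has_space_derivative_matrix continuous_on_transpose contB continuous_on_Dinv S)
  have G0: "G x t = 0" if "(x, t) \<notin> K" for x t using b0[OF that] by (simp add: G_def)
  have \<eta>0: "\<eta> x t = 0" if "(x, t) \<notin> K" for x t using b0[OF that] by (simp add: \<eta>_def)
  have "has_slab_integral (\<lambda>x t. 2 * (u x t \<bullet> \<xi> x t) - (norm (u x t))\<^sup>2 * \<eta> x t) 0"
  proof (rule first_variation[OF opt C2\<eta>(1) sd\<xi> K \<eta>0])
    show "\<xi> x t = 0" if "(x, t) \<notin> K" for x t
      using G0[OF that] \<eta>0[OF that] b0[OF that, of 3] by (simp add: \<xi>_def \<sigma>_def)
    show "has_bochner_integral lborel (\<lambda>x. \<eta> x t) 0" for t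
    proof -
      have z: "slab_bump k a \<tau> r x t = 0" if "x \<notin> cball a r" "0 < k" for x k
      proof (rule b0[OF _ that(2)])
        show "(x, t) \<notin> K" using that(1) dist_fst_le[of "(a, \<tau>)" "(x, t)"] unfolding K_def by auto
      qed
      \<comment> \<open>\<open>- 8 * \<eta>\<close> is the derivative of the bump of exponent 4 in direction \<open>p\<close>\<close>
      have "(LINT x|lborel. - 8 * \<eta> x t) = 0"
      proof (rule integral_directional_derivative_UNIV[OF compact_cball[of a r], where g = "\<lambda>x. slab_bump 4 a \<tau> r x t" and v = p])
        show "((\<lambda>s. slab_bump 4 a \<tau> r (x + s *\<^sub>R p) t) has_real_derivative - 8 * \<eta> x t) (at 0)" for x
          using bump_line_derivative[of 2 "(a, \<tau>)" r "(x, t)" "(p, 0)" 0]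
          by (simp add: numeral_eq_Suc \<eta>_def mult_ac)
      qed (auto simp: \<eta>_def z intro!: continuous_intros)
      moreover have "integrable lborel (\<lambda>x. \<eta> x t)"
      proof -
        have "continuous_on UNIV (\<lambda>x. \<eta> x t)" unfolding \<eta>_def by (intro continuous_intros)
        from compact_support_integrable[OF compact_cball[of a r] _ this] show ?thesis
          by (simp add: \<eta>_def z)
      qed
      ultimately show ?thesis by (simp add: has_bochner_integral_iff)
    qed
    define Z' where "Z' x t h = slab_bump 3 a \<tau> r x t *\<^sub>R (0::real^'n) + (6 * (t - \<tau>) * slab_bump 2 a \<tau> r x t) *\<^sub>R (((x - a) \<bullet> h) *\<^sub>R p)" for x t h
    have "has_space_derivative (\<lambda>x t. slab_bump 3 a \<tau> r x t *\<^sub>R ((\<tau> - t) *\<^sub>R p)) Z'"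
      by (rule has_space_derivative_cong[OF has_space_derivative_scaleR[OF b3 has_space_derivative_time[of "\<lambda>t. (\<tau> - t) *\<^sub>R p"]]])
         (auto simp: Z'_def algebra_simps intro!: continuous_intros)
    then show "has_space_derivative (flux \<eta> \<xi>) Z'"
    proof (rule has_space_derivative_cong)
      fix x t assume t: "t \<in> {0<..<1::real}"
      show "flux \<eta> \<xi> x t = slab_bump 3 a \<tau> r x t *\<^sub>R ((\<tau> - t) *\<^sub>R p)"
        unfolding flux_def C2\<eta>(2)[OF t] \<xi>_def lift_inner(2)[OF t] \<sigma>_def
        by (simp add: algebra_simps)
    qed simp
    fix x t assume t: "t \<in> {0<..<1::real}"
    have "linear_trace (Z' x t) = (6 * (t - \<tau>) * slab_bump 2 a \<tau> r x t) * ((x - a) \<bullet> p)"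
      unfolding Z'_def scaleR_zero_right add_0_left linear_trace_scaleR linear_trace_rank1 ..
    then show "time_deriv \<eta> x t + linear_trace (Z' x t) = 0"
      unfolding C2\<eta>(4)[OF t] by (simp add: algebra_simps)
  qed
  from has_slab_integral_cmult[OF this, of "-1/2", unfolded mult_zero_right]
  have 1: "has_slab_integral (\<lambda>x t. - (u x t \<bullet> \<xi> x t) + 1/2 * (norm (u x t))\<^sup>2 * \<eta> x t) 0"
    by (rule has_slab_integral_cong) (simp add: algebra_simps)
  have sdDv: "has_space_derivative (\<lambda>x t. diffusion B t *v v x t) (\<lambda>x t h. diffusion B t *v (Dinv t *v (B t *v u' x t h)))"
    unfolding v_def by (rule has_space_derivative_matrix[OF contD control_covector_has_space_derivative[OF u]])
  have 2: "has_slab_integral (\<lambda>x t. \<epsilon> * (\<eta> x t * linear_trace (\<lambda>h. diffusion B t *v (Dinv t *v (B t *v u' x t h)))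
      + G x t \<bullet> (diffusion B t *v v x t))) (\<epsilon> * 0)"
    by (rule has_slab_integral_cmult[OF slab_integration_by_parts_space[OF sd\<eta> sdDv K]]) (simp add: \<eta>0)
  from has_slab_integral_add[OF 1 2, unfolded mult_zero_right add_0_left] show ?thesis
  proof (rule has_slab_integral_cong)
    fix x t assume t': "t \<in> {0<..<1::real}"
    define s where "s = (x - a) \<bullet> p"
    have "u x t \<bullet> \<xi> x t = v x t \<bullet> \<sigma> x t"
      unfolding \<xi>_def v_def by (subst optimal_control_range[OF opt u t']) (rule lift_inner(1)[OF t'])
    also have "\<dots> = \<epsilon> * (v x t \<bullet> (diffusion B t *v G x t)) - slab_bump 3 a \<tau> r x t * (s * (v x t \<bullet> f x t))
        - slab_bump 3 a \<tau> r x t * ((t - \<tau>) * (v x t \<bullet> p))"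
      unfolding \<sigma>_def \<eta>_def s_def[symmetric] by (simp add: inner_diff_right mult_ac)
    finally have "u x t \<bullet> \<xi> x t = \<epsilon> * (v x t \<bullet> (diffusion B t *v G x t)) - slab_bump 3 a \<tau> r x t * (s * (v x t \<bullet> f x t))
        - slab_bump 3 a \<tau> r x t * ((t - \<tau>) * (v x t \<bullet> p))" .
    moreover have "G x t \<bullet> (diffusion B t *v v x t) = v x t \<bullet> (diffusion B t *v G x t)"
      by (metis dot_diffusion_commute inner_commute)
    moreover have "divergence (\<lambda>y. diffusion B t *v v y t) x = linear_trace (\<lambda>h. diffusion B t *v (Dinv t *v (B t *v u' x t h)))"
      by (rule divergence_eq[OF has_space_derivativeD(1)[OF sdDv t']])
    ultimately show "(control_covector u x t \<bullet> p * (t - \<tau>) + hamiltonian u x t * ((x - a) \<bullet> p)) * slab_bump 3 a \<tau> r x t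
        = - (u x t \<bullet> \<xi> x t) + 1/2 * (norm (u x t))\<^sup>2 * \<eta> x t + \<epsilon> * (\<eta> x t * linear_trace (\<lambda>h. diffusion B t *v (Dinv t *v (B t *v u' x t h)))
          + G x t \<bullet> (diffusion B t *v v x t))"
      unfolding hamiltonian_def v_def[symmetric] \<eta>_def s_def[symmetric]
      by (simp add: field_simps)
  qed
qed

lemma slab_box:
  fixes x0 x :: "real^'n" and t0 t :: real
  assumes "t0 \<in> {0<..<1}" "t \<in> {0<..<1}"
  shows "\<exists>a b. (x0, t0) \<in> box a b \<and> (x, t) \<in> box a b \<and> cbox a b \<subseteq> slab"
proof -
  obtain c where c: "{x0, x} \<subseteq> box (- c) c"
    using bounded_subset_box_symmetric[of "{x0, x}"] by auto
  define s where "s = min t0 t / 2"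
  define s' where "s' = (max t0 t + 1) / 2"
  have box: "(y, r) \<in> box (- c, s) (c, s')" if "y \<in> box (- c) c" "s < r" "r < s'" for y r
    using that unfolding mem_box by (auto simp: Basis_prod_def)
  have s: "0 < s" "s' < 1" "s < t0" "s < t" "t0 < s'" "t < s'"
    using assms unfolding s_def s'_def by (auto simp: min_def max_def)
  show ?thesis
    by (intro exI[of _ "(- c, s)"] exI[of _ "(c, s')"] conjI box) (use c s in \<open>auto simp: cbox_Pair_eq\<close>)
qed

text \<open>
  The space-time field \<open>(v, - H)\<close> is continuous and weakly curl-free, hence the gradient of some \<open>\<psi>\<close>.
  The spatial part of this says that the optimal control is \<open>B\<^sup>T\<close> applied to the gradient of \<open>\<psi>\<close>, and
  the time component is the Hamilton-Jacobi-Bellman equation.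
\<close>

lemma optimal_control_potential:
  assumes opt: "solves_variational_problem \<epsilon> f B \<rho>0 \<rho>1 \<rho> u"
  obtains \<psi> where "C2_in_space_C1_in_time \<psi>"
    and "\<And>x t. t \<in> {0<..<1} \<Longrightarrow> u x t = transpose (B t) *v gradient (\<lambda>y. \<psi> y t) x"
    and "\<And>x t. t \<in> {0<..<1} \<Longrightarrow> time_deriv \<psi> x t
       + 1 / 2 * (norm (transpose (B t) *v gradient (\<lambda>y. \<psi> y t) x))\<^sup>2
       + gradient (\<lambda>y. \<psi> y t) x \<bullet> f x t
       = - \<epsilon> * matrix_inner (diffusion B t) (Hess (\<lambda>y. \<psi> y t) x)"
proof -
  have "C1_in_space u"
    using opt unfolding solves_variational_problem_def is_arg_min_def admissible_def finite_energy_input_def by auto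
  note u = C1_in_spaceD[OF this]
  define v where "v = control_covector u"
  define u' where "u' x t h = jacobian (\<lambda>y. u y t) (at x) *v h" for x t h
  define v' where "v' x t h = Dinv t *v (B t *v u' x t h)" for x t h
  have sdv: "has_space_derivative v v'"
    using control_covector_has_space_derivative[OF u] unfolding v_def v'_def[abs_def] u'_def .
  have sdDv: "has_space_derivative (\<lambda>x t. diffusion B t *v v x t) (\<lambda>x t h. diffusion B t *v v' x t h)"
    by (rule has_space_derivative_matrix[OF contD sdv])
  have ham: "hamiltonian u x t = v x t \<bullet> f x t + 1 / 2 * (norm (u x t))\<^sup>2
      + \<epsilon> * linear_trace (\<lambda>h. diffusion B t *v v' x t h)" if "t \<in> {0<..<1}" for x t
    unfolding hamiltonian_def v_def[symmetric] divergence_eq[OF has_space_derivativeD(1)[OF sdDv that]] ..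
  have contH: "continuous_on_slab (hamiltonian u)"
  proof (rule continuous_on_slab_cong[OF _ ham])
    have "continuous_on_slab (\<lambda>x t. linear_trace (\<lambda>h. diffusion B t *v v' x t h))"
      using has_space_derivativeD(3)[OF sdDv]
      unfolding continuous_on_slab_def linear_trace_def by (intro continuous_on_sum continuous_on_component)
    then
    show "continuous_on_slab (\<lambda>x t. v x t \<bullet> f x t + 1 / 2 * (norm (u x t))\<^sup>2 + \<epsilon> * linear_trace (\<lambda>h. diffusion B t *v v' x t h))"
      using has_space_derivativeD(2)[OF sdv] has_space_derivativeD(2)[OF u]
        has_space_derivativeD(2)[OF C1_in_spaceD[OF C1f]]
      unfolding continuous_on_slab_def by (intro continuous_intros)
  qed
  define W where "W p = (v (fst p) (snd p), - hamiltonian u (fst p) (snd p))" for p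
  define \<psi> where "\<psi> x t = line_integral W (0, 1/2) (x, t)" for x t
  have der: "((\<lambda>p. line_integral W (0, 1/2) p) has_derivative (\<lambda>h. W p \<bullet> h)) (at p)" if p: "p \<in> slab" for p
  proof (rule weak_Poincare[OF _ _ _ p])
    show "continuous_on slab W"
      using has_space_derivativeD(2)[OF sdv] contH unfolding W_def continuous_on_slab_def
      by (intro continuous_intros)
    show "\<exists>a b. (0, 1/2) \<in> box a b \<and> p \<in> box a b \<and> cbox a b \<subseteq> slab" if "p \<in> slab" for p :: "(real^'n) \<times> real"
      using slab_box[of "1/2" "snd p" 0 "fst p"] that by auto
    fix c P Q :: "(real^'n) \<times> real" and r :: real
    assume r: "0 < r" "cball c r \<subseteq> slab"
    obtain a \<tau> where c: "c = (a, \<tau>)" by (cases c)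
    note r' = r[unfolded c]
    \<comment> \<open>the curl in the plane of \<open>P\<close> and \<open>Q\<close>, expanded into spatial and mixed components\<close>
    define X where "X x t = ((v x t \<bullet> fst P) * ((x - a) \<bullet> fst Q) - (v x t \<bullet> fst Q) * ((x - a) \<bullet> fst P)) * slab_bump 3 a \<tau> r x t
        + snd Q * (((v x t \<bullet> fst P) * (t - \<tau>) + hamiltonian u x t * ((x - a) \<bullet> fst P)) * slab_bump 3 a \<tau> r x t)
        - snd P * (((v x t \<bullet> fst Q) * (t - \<tau>) + hamiltonian u x t * ((x - a) \<bullet> fst Q)) * slab_bump 3 a \<tau> r x t)" for x t
    have "has_slab_integral X (0 + snd Q * 0 - snd P * 0)"
      unfolding X_def v_def
      by (intro has_slab_integral_diff has_slab_integral_add has_slab_integral_cmult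
            weak_curl_space[OF opt u r'] weak_curl_time[OF opt u r'])
    then have "(LINT p|lborel. X (fst p) (snd p)) = 0 + snd Q * 0 - snd P * 0"
    proof (rule has_slab_integral_Lebesgue)
      fix x t assume "t \<notin> {0<..<1::real}"
      then have "(x, t) \<notin> cball (a, \<tau>) r" for x using r'(2) by blast
      from slab_bump_eq_0[OF r(1) _ this, of 3] show "X x t = 0" unfolding X_def by simp
    qed
    moreover have "X (fst p) (snd p) = ((W p \<bullet> P) * ((p - c) \<bullet> Q) - (W p \<bullet> Q) * ((p - c) \<bullet> P)) * bump 3 c r p" for p
      unfolding X_def W_def c inner_prod_def by (simp add: algebra_simps)
    ultimately show "(LINT p|lborel. ((W p \<bullet> P) * ((p - c) \<bullet> Q) - (W p \<bullet> Q) * ((p - c) \<bullet> P)) * bump 3 c r p) = 0"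
      by simp
  qed
  have dx: "((\<lambda>y. \<psi> y t) has_derivative (\<lambda>h. v x t \<bullet> h)) (at x)" if t: "t \<in> {0<..<1}" for x t
  proof -
    have "((\<lambda>y. (y, t)) has_derivative (\<lambda>h. (h, 0))) (at x)" by (auto intro!: derivative_eq_intros)
    from has_derivative_compose[OF this der[of "(x, t)"]] t show ?thesis
      unfolding \<psi>_def W_def by simp
  qed
  have dt: "((\<lambda>s. \<psi> x s) has_real_derivative - hamiltonian u x t) (at t)" if t: "t \<in> {0<..<1}" for x t
  proof -
    have "((\<lambda>s. (x, s)) has_derivative (\<lambda>h. (0, h))) (at t)" by (auto intro!: derivative_eq_intros)
    from has_derivative_compose[OF this der[of "(x, t)"]] t
    have "((\<lambda>s. \<psi> x s) has_derivative (\<lambda>h. - (hamiltonian u x t * h))) (at t)"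
      unfolding \<psi>_def W_def by simp
    then show ?thesis
      unfolding has_field_derivative_def by (rule has_derivative_eq_rhs) (simp add: fun_eq_iff)
  qed
  have c\<psi>: "continuous_on_slab \<psi>"
    unfolding continuous_on_slab_def \<psi>_def
    using der has_derivative_continuous by (intro continuous_at_imp_continuous_on) force
  have sd\<psi>: "has_space_derivative \<psi> (\<lambda>x t h. v x t \<bullet> h)"
    using dx c\<psi> has_space_derivativeD(2)[OF sdv]
    by (intro has_space_derivativeI) (auto simp: continuous_on_slab_def intro!: continuous_intros)
  have cH': "continuous_on_slab (\<lambda>x t. - hamiltonian u x t)"
    using contH unfolding continuous_on_slab_def by (intro continuous_intros)
  have C2\<psi>: "C2_in_space_C1_in_time \<psi>"
      "\<And>x t. t \<in> {0<..<1} \<Longrightarrow> gradient (\<lambda>y. \<psi> y t) x = v x t"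
      "\<And>x t h. t \<in> {0<..<1} \<Longrightarrow> Hess (\<lambda>y. \<psi> y t) x *v h = v' x t h"
      "\<And>x t. t \<in> {0<..<1} \<Longrightarrow> time_deriv \<psi> x t = - hamiltonian u x t"
    using C2I[OF sd\<psi> sdv _ cH'] dt by blast+
  have range: "u x t = transpose (B t) *v v x t" if "t \<in> {0<..<1}" for x t
    unfolding v_def by (rule optimal_control_range[OF opt u that])
  show thesis
  proof (rule that[OF C2\<psi>(1)])
    fix x t assume t: "t \<in> {0<..<1::real}"
    show "u x t = transpose (B t) *v gradient (\<lambda>y. \<psi> y t) x" unfolding C2\<psi>(2)[OF t] by (rule range[OF t])
    show "time_deriv \<psi> x t + 1 / 2 * (norm (transpose (B t) *v gradient (\<lambda>y. \<psi> y t) x))\<^sup>2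
       + gradient (\<lambda>y. \<psi> y t) x \<bullet> f x t = - \<epsilon> * matrix_inner (diffusion B t) (Hess (\<lambda>y. \<psi> y t) x)"
      unfolding C2\<psi>(2)[OF t] C2\<psi>(4)[OF t] matrix_inner_diffusion C2\<psi>(3)[OF t] range[OF t, symmetric] ham[OF t]
      by simp
  qed
qed

end

section \<open>The potential is a Lagrange multiplier\<close>

lemma space_derivative_zero_off_closed:
  assumes g: "has_space_derivative g (\<lambda>x t h. G x t \<bullet> h)" and K: "closed K"
    and z: "\<And>x t. t \<in> {0<..<1} \<Longrightarrow> (x, t) \<notin> K \<Longrightarrow> g x t = 0"
    and xt: "t \<in> {0<..<1}" "(x, t) \<notin> K"
  shows "G x t = 0"
proof -
  define U where "U = (\<lambda>y. (y, t)) -` (- K)"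
  have "open U" unfolding U_def
    by (rule open_vimage) (use K in \<open>auto intro!: continuous_intros simp: open_Compl\<close>)
  moreover have "x \<in> U" using xt(2) by (simp add: U_def)
  moreover have "g y t = 0" if "y \<in> U" for y using z[OF xt(1)] that by (simp add: U_def)
  ultimately have "((\<lambda>y. 0) has_derivative (\<lambda>h. G x t \<bullet> h)) (at x)"
    by (rule has_derivative_transform_within_open[OF has_space_derivativeD(1)[OF g xt(1)]])
  from has_derivative_unique[OF this has_derivative_const[of 0]] have "G x t \<bullet> G x t = 0" by metis
  then show ?thesis by simp
qed

context controlled_diffusion
begin

text \<open>
  Integrating by parts in the Lagrangian and using the Hamilton-Jacobi-Bellman equation, the
  difference of the Lagrangian at a competitor \<open>(\<rho>', w)\<close> and at \<open>(\<rho>, u)\<close> is the integral of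
  \<open>\<rho>' \<bar>w - u\<bar>\<^sup>2 / 2\<close>.
\<close>

lemma potential_is_lagrange_multiplier:
  assumes opt: "solves_variational_problem \<epsilon> f B \<rho>0 \<rho>1 \<rho> u"
    and \<psi>: "C2_in_space_C1_in_time \<psi>"
    and ctrl: "\<And>x t. t \<in> {0<..<1} \<Longrightarrow> u x t = transpose (B t) *v gradient (\<lambda>y. \<psi> y t) x"
    and hjb: "\<And>x t. t \<in> {0<..<1} \<Longrightarrow> time_deriv \<psi> x t
       + 1 / 2 * (norm (transpose (B t) *v gradient (\<lambda>y. \<psi> y t) x))\<^sup>2
       + gradient (\<lambda>y. \<psi> y t) x \<bullet> f x t
       = - \<epsilon> * matrix_inner (diffusion B t) (Hess (\<lambda>y. \<psi> y t) x)"
  shows "lagrange_multiplier \<epsilon> f B \<rho>0 \<rho>1 \<rho> u \<psi>"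
proof -
  define v where "v x t = gradient (\<lambda>y. \<psi> y t) x" for x t
  define v' where "v' x t h = Hess (\<lambda>y. \<psi> y t) x *v h" for x t h
  have sd\<psi>: "has_space_derivative \<psi> (\<lambda>x t h. v x t \<bullet> h)" and sdv: "has_space_derivative v v'"
    using C2D(1,2)[OF \<psi>] unfolding v_def[abs_def] v'_def[abs_def] by auto
  have adm: "admissible \<rho>0 \<rho>1 \<rho> u" and fp: "fokker_planck \<epsilon> f B \<rho> u"
    using opt unfolding solves_variational_problem_def is_arg_min_def by auto
  have regular: "C2_in_space_C1_in_time r" "C1_in_space w" "\<And>x t. t \<in> {0<..<1} \<Longrightarrow> 0 \<le> r x t"
      "\<exists>e. has_slab_integral (\<lambda>x t. (norm (w x t))\<^sup>2 * r x t) e" if a: "admissible \<rho>0 \<rho>1 r w" for r w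
  proof -
    show 1: "C2_in_space_C1_in_time r" "C1_in_space w"
      using a unfolding admissible_def density_path_def finite_energy_input_def by auto
    show 2: "0 \<le> r x t" if "t \<in> {0<..<1}" for x t
      using a that unfolding admissible_def density_path_def is_pdf_def by auto
    show "\<exists>e. has_slab_integral (\<lambda>x t. (norm (w x t))\<^sup>2 * r x t) e"
      by (rule control_cost_slab(2)[OF has_space_derivativeD(2)[OF C1_in_spaceD[OF 1(2)]]
            has_space_derivativeD(2)[OF C2D(1)[OF 1(1)]] 2])
         (use a in \<open>auto simp: admissible_def finite_energy_input_def\<close>)
  qed
  note C2\<rho> = regular(1)[OF adm] and u = C1_in_spaceD[OF regular(2)[OF adm]]
  obtain e where e: "has_slab_integral (\<lambda>x t. (norm (u x t))\<^sup>2 * \<rho> x t) e"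
    using regular(4)[OF adm] by blast
  have l: "lagrangian \<epsilon> f B \<rho> u \<psi> = 1 / 2 * e"
    unfolding lagrangian_def
  proof (rule has_slab_integral_iterated, rule has_slab_integral_cong[OF has_slab_integral_cmult[OF e, of "1/2"]])
    fix x t assume "t \<in> {0<..<1::real}"
    then show "1 / 2 * (norm (u x t))\<^sup>2 * \<rho> x t + \<psi> x t * (time_deriv \<rho> x t
          + divergence (\<lambda>y. \<rho> y t *\<^sub>R (f y t + B t *v u y t)) x
          - \<epsilon> * matrix_inner (diffusion B t) (Hess (\<lambda>y. \<rho> y t) x)) = 1 / 2 * ((norm (u x t))\<^sup>2 * \<rho> x t)"
      using fp unfolding fokker_planck_def by simp
  qed
  have min: "lagrangian \<epsilon> f B \<rho> u \<psi> \<le> lagrangian \<epsilon> f B \<rho>' w \<psi>"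
    if adm': "admissible \<rho>0 \<rho>1 \<rho>' w" and off: "equal_off_compact \<rho> u \<rho>' w" for \<rho>' w
  proof -
    obtain K where K: "compact K" "K \<subseteq> slab"
      and eq: "\<And>x t. t \<in> {0..1} \<Longrightarrow> (x, t) \<notin> K \<Longrightarrow> \<rho>' x t = \<rho> x t \<and> w x t = u x t"
      using off unfolding equal_off_compact_def by blast
    note C2\<rho>' = regular(1)[OF adm'] and w = C1_in_spaceD[OF regular(2)[OF adm']]
    obtain e' where e': "has_slab_integral (\<lambda>x t. (norm (w x t))\<^sup>2 * \<rho>' x t) e'"
      using regular(4)[OF adm'] by blast
    obtain Z where Z: "has_space_derivative (flux \<rho> (\<lambda>x t. \<rho> x t *\<^sub>R u x t)) Z"
      by (rule flux_has_space_derivative[OF C2\<rho> has_space_derivative_scaleR[OF C2D(1)[OF C2\<rho>] u]])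
    obtain Z' where Z': "has_space_derivative (flux \<rho>' (\<lambda>x t. \<rho>' x t *\<^sub>R w x t)) Z'"
      by (rule flux_has_space_derivative[OF C2\<rho>' has_space_derivative_scaleR[OF C2D(1)[OF C2\<rho>'] w]])
    define \<eta> where "\<eta> x t = \<rho>' x t - \<rho> x t" for x t
    define \<omega> where "\<omega> x t = \<rho>' x t *\<^sub>R w x t - \<rho> x t *\<^sub>R u x t" for x t
    define G where "G x t = gradient (\<lambda>y. \<rho>' y t) x - gradient (\<lambda>y. \<rho> y t) x" for x t
    define \<eta>t where "\<eta>t x t = time_deriv \<rho>' x t - time_deriv \<rho> x t" for x t
    define F where "F x t = flux \<rho>' (\<lambda>x t. \<rho>' x t *\<^sub>R w x t) x t - flux \<rho> (\<lambda>x t. \<rho> x t *\<^sub>R u x t) x t" for x t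
    define F' where "F' x t h = Z' x t h - Z x t h" for x t h
    have F: "F x t = \<eta> x t *\<^sub>R f x t + B t *v \<omega> x t - \<epsilon> *\<^sub>R (diffusion B t *v G x t)" for x t
      unfolding F_def flux_def \<eta>_def \<omega>_def G_def
      by (simp add: matrix_vector_mult_diff_distrib algebra_simps)
    have sdF: "has_space_derivative F F'"
      unfolding F_def[abs_def] F'_def[abs_def] by (rule has_space_derivative_diff[OF Z' Z])
    have sd\<eta>: "has_space_derivative \<eta> (\<lambda>x t h. G x t \<bullet> h)"
      by (rule has_space_derivative_cong[OF has_space_derivative_diff[OF C2D(1)[OF C2\<rho>'] C2D(1)[OF C2\<rho>]]])
         (simp_all add: \<eta>_def G_def inner_diff_left)
    have d\<eta>: "((\<lambda>s. \<eta> x s) has_real_derivative \<eta>t x t) (at t)" if "t \<in> {0<..<1}" for x t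
      unfolding \<eta>_def \<eta>t_def using C2D(3)[OF C2\<rho>' that] C2D(3)[OF C2\<rho> that] by (rule DERIV_diff)
    have c\<eta>t: "continuous_on_slab \<eta>t"
      using C2D(4)[OF C2\<rho>'] C2D(4)[OF C2\<rho>] unfolding \<eta>t_def continuous_on_slab_def by (intro continuous_intros)
    have off0: "\<eta> x t = 0" "\<omega> x t = 0" if "t \<in> {0<..<1}" "(x, t) \<notin> K" for x t
      using eq[of t x] that by (auto simp: \<eta>_def \<omega>_def)
    have G0: "G x t = 0" if "t \<in> {0<..<1}" "(x, t) \<notin> K" for x t
      by (rule space_derivative_zero_off_closed[OF sd\<eta> compact_imp_closed[OF K(1)] off0(1) that])
    have F0: "F x t = 0" if "t \<in> {0<..<1}" "(x, t) \<notin> K" for x t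
      unfolding F using off0[OF that] G0[OF that] by simp
    have c\<psi>t: "continuous_on_slab (time_deriv \<psi>)" by (rule C2D(4)[OF \<psi>])
    note conts = has_space_derivativeD(2)[OF sd\<psi>] has_space_derivativeD(2)[OF sdv]
      has_space_derivativeD(2)[OF sd\<eta>] has_space_derivativeD(2)[OF sdF]
    have I1: "has_slab_integral (\<lambda>x t. \<psi> x t * \<eta>t x t + time_deriv \<psi> x t * \<eta> x t) 0"
      by (rule slab_integration_by_parts_time[OF C2D(3)[OF \<psi>] d\<eta> conts(1) c\<psi>t conts(3) c\<eta>t K])
         (simp_all add: off0)
    have I2: "has_slab_integral (\<lambda>x t. \<psi> x t * linear_trace (F' x t) + v x t \<bullet> F x t) 0"
      by (rule slab_integration_by_parts_space[OF sd\<psi> sdF K]) (simp add: F0)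
    have I3: "has_slab_integral (\<lambda>x t. \<eta> x t * linear_trace (\<lambda>h. diffusion B t *v v' x t h)
        + G x t \<bullet> (diffusion B t *v v x t)) 0"
      by (rule slab_integration_by_parts_space[OF sd\<eta> has_space_derivative_matrix[OF contD sdv] K]) (simp add: off0)
    define R where "R x t = time_deriv \<psi> x t * \<eta> x t + v x t \<bullet> F x t" for x t
    obtain i where i: "has_slab_integral R i"
      by (rule has_slab_integral_compact_support[of R, OF _ K])
         (use conts c\<psi>t off0 F0 in \<open>auto simp: R_def continuous_on_slab_def intro!: continuous_intros\<close>)
    define E where "E x t = \<psi> x t * (\<eta>t x t + linear_trace (F' x t))" for x t
    have IE: "has_slab_integral E (0 + 0 - i)"
      by (rule has_slab_integral_cong[OF has_slab_integral_diff[OF has_slab_integral_add[OF I1 I2] i]])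
         (simp add: E_def R_def algebra_simps)
    have res: "time_deriv \<rho>' x t + divergence (\<lambda>y. \<rho>' y t *\<^sub>R (f y t + B t *v w y t)) x
          - \<epsilon> * matrix_inner (diffusion B t) (Hess (\<lambda>y. \<rho>' y t) x) = \<eta>t x t + linear_trace (F' x t)" if t: "t \<in> {0<..<1}" for x t
    proof -
      have "time_deriv \<rho> x t + linear_trace (Z x t) = 0"
        using fp t unfolding fokker_planck_iff[OF C2\<rho> u Z] by blast
      then show ?thesis using fokker_planck_residual[OF C2\<rho>' w Z' t, of x]
        unfolding \<eta>t_def F'_def linear_trace_diff by linarith
    qed
    have L': "has_slab_integral (\<lambda>x t. 1 / 2 * (norm (w x t))\<^sup>2 * \<rho>' x t + \<psi> x t * (time_deriv \<rho>' x t
          + divergence (\<lambda>y. \<rho>' y t *\<^sub>R (f y t + B t *v w y t)) x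
          - \<epsilon> * matrix_inner (diffusion B t) (Hess (\<lambda>y. \<rho>' y t) x))) (1 / 2 * e' + (0 + 0 - i))"
      by (rule has_slab_integral_cong[OF has_slab_integral_add[OF has_slab_integral_cmult[OF e'] IE]])
         (simp add: res E_def)
    have l': "lagrangian \<epsilon> f B \<rho>' w \<psi> = 1 / 2 * e' + (0 + 0 - i)"
      unfolding lagrangian_def by (rule has_slab_integral_iterated[OF L'])
    have "has_slab_integral (\<lambda>x t. 1 / 2 * ((norm (w x t))\<^sup>2 * \<rho>' x t) + (0 - R x t)
        - \<epsilon> * (\<eta> x t * linear_trace (\<lambda>h. diffusion B t *v v' x t h) + G x t \<bullet> (diffusion B t *v v x t))
        - 1 / 2 * ((norm (u x t))\<^sup>2 * \<rho> x t)) (1 / 2 * e' + (0 - i) - \<epsilon> * 0 - 1 / 2 * e)"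
      by (intro has_slab_integral_diff has_slab_integral_add has_slab_integral_cmult e e' i I3)
         (simp add: has_slab_integral_def has_bochner_integral_zero)
    then have "0 \<le> 1 / 2 * e' + (0 - i) - \<epsilon> * 0 - 1 / 2 * e"
    proof (rule has_slab_integral_nonneg)
      fix x t assume t: "t \<in> {0<..<1::real}"
      define tr where "tr = linear_trace (\<lambda>h. diffusion B t *v v' x t h)"
      have h: "time_deriv \<psi> x t = - 1 / 2 * (norm (u x t))\<^sup>2 - v x t \<bullet> f x t - \<epsilon> * tr"
        using hjb[OF t, of x] unfolding ctrl[OF t, symmetric] matrix_inner_diffusion v_def tr_def v'_def by linarith
      have "v x t \<bullet> (B t *v \<omega> x t) = u x t \<bullet> \<omega> x t"
        unfolding ctrl[OF t] v_def using dot_matrix_vector_mul_transpose by (metis inner_commute)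
      moreover have "v x t \<bullet> (diffusion B t *v G x t) = G x t \<bullet> (diffusion B t *v v x t)"
        by (metis dot_diffusion_commute inner_commute)
      ultimately have vF: "v x t \<bullet> F x t = \<eta> x t * (v x t \<bullet> f x t) + u x t \<bullet> \<omega> x t
          - \<epsilon> * (G x t \<bullet> (diffusion B t *v v x t))"
        unfolding F by (simp add: inner_add_right inner_diff_right)
      have u\<omega>: "u x t \<bullet> \<omega> x t = \<rho>' x t * (u x t \<bullet> w x t) - \<rho> x t * (norm (u x t))\<^sup>2"
        unfolding \<omega>_def by (simp add: inner_diff_right power2_norm_eq_inner)
      have sq: "(norm (w x t - u x t))\<^sup>2 = (norm (w x t))\<^sup>2 - 2 * (u x t \<bullet> w x t) + (norm (u x t))\<^sup>2"
        by (simp add: power2_norm_eq_inner inner_diff_left inner_diff_right inner_commute)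
      have "1 / 2 * ((norm (w x t))\<^sup>2 * \<rho>' x t) + (0 - R x t)
          - \<epsilon> * (\<eta> x t * tr + G x t \<bullet> (diffusion B t *v v x t)) - 1 / 2 * ((norm (u x t))\<^sup>2 * \<rho> x t)
        = 1 / 2 * (\<rho>' x t * (norm (w x t - u x t))\<^sup>2)"
        unfolding R_def h vF u\<omega> sq \<eta>_def by (simp add: field_simps)
      also have "\<dots> \<ge> 0" using regular(3)[OF adm' t] by simp
      finally show "0 \<le> 1 / 2 * ((norm (w x t))\<^sup>2 * \<rho>' x t) + (0 - R x t)
          - \<epsilon> * (\<eta> x t * linear_trace (\<lambda>h. diffusion B t *v v' x t h) + G x t \<bullet> (diffusion B t *v v x t))
          - 1 / 2 * ((norm (u x t))\<^sup>2 * \<rho> x t)" unfolding tr_def .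
    qed
    then show ?thesis unfolding l l' by simp
  qed
  have "equal_off_compact \<rho> u \<rho> u"
    unfolding equal_off_compact_def by (rule exI[of _ "{}"]) simp
  then show ?thesis
    unfolding lagrange_multiplier_def is_arg_min_def using adm min by (auto simp: not_less)
qed

end

theorem proposition1:
  fixes \<epsilon> c3 :: real
    and f :: "real^'n \<Rightarrow> real \<Rightarrow> real^'n"
    and B :: "real \<Rightarrow> real^'m^'n"
    and \<rho>0 \<rho>1 :: "real^'n \<Rightarrow> real"
    and \<rho>opt :: "real^'n \<Rightarrow> real \<Rightarrow> real"
    and uopt :: "real^'n \<Rightarrow> real \<Rightarrow> real^'m"
  assumes "\<epsilon> > 0"
    and "is_pdf \<rho>0" and "is_pdf \<rho>1"
    and "C1_in_space f"
    and "continuous_on {0<..<1} B"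
    and "\<exists>c1. \<forall>x. \<forall>t\<in>{0..1}. norm (f x t) + spectral_norm (B t) \<le> c1 * (1 + norm x)"
    and "\<exists>c2. \<forall>x y. \<forall>t\<in>{0..1}. norm (f x t - f y t) \<le> c2 * norm (x - y)"
    and "c3 > 0"
    and "\<forall>x. \<forall>t\<in>{0..1}. x \<bullet> (diffusion B t *v x) \<ge> c3 * (norm x)\<^sup>2"
    and "solves_variational_problem \<epsilon> f B \<rho>0 \<rho>1 \<rho>opt uopt"
  shows "\<exists>\<psi> :: real^'n \<Rightarrow> real \<Rightarrow> real.
    C2_in_space_C1_in_time \<psi> \<and>
    lagrange_multiplier \<epsilon> f B \<rho>0 \<rho>1 \<rho>opt uopt \<psi> \<and>
    (\<forall>x. \<forall>t\<in>{0<..<1}.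
       time_deriv \<psi> x t
       + 1 / 2 * (norm (transpose (B t) *v gradient (\<lambda>y. \<psi> y t) x))\<^sup>2
       + gradient (\<lambda>y. \<psi> y t) x \<bullet> f x t
       = - \<epsilon> * matrix_inner (diffusion B t) (Hess (\<lambda>y. \<psi> y t) x)) \<and>
    (\<forall>x. \<forall>t\<in>{0<..<1}.
       time_deriv \<rho>opt x t
       + divergence (\<lambda>y. \<rho>opt y t *\<^sub>R
           (f y t + (B t ** transpose (B t)) *v gradient (\<lambda>z. \<psi> z t) y)) x
       = \<epsilon> * matrix_inner (diffusion B t) (Hess (\<lambda>y. \<rho>opt y t) x)) \<and>
    (\<forall>x. \<rho>opt x 0 = \<rho>0 x) \<and> (\<forall>x. \<rho>opt x 1 = \<rho>1 x) \<and>
    (\<forall>x. \<forall>t\<in>{0<..<1}. uopt x t = transpose (B t) *v gradient (\<lambda>y. \<psi> y t) x)"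
proof -
  interpret controlled_diffusion \<epsilon> c3 f B
    by unfold_locales (use assms in auto)
  note opt = assms(10)
  obtain \<psi> where \<psi>: "C2_in_space_C1_in_time \<psi>"
    and ctrl: "\<And>x t. t \<in> {0<..<1} \<Longrightarrow> uopt x t = transpose (B t) *v gradient (\<lambda>y. \<psi> y t) x"
    and hjb: "\<And>x t. t \<in> {0<..<1} \<Longrightarrow> time_deriv \<psi> x t
       + 1 / 2 * (norm (transpose (B t) *v gradient (\<lambda>y. \<psi> y t) x))\<^sup>2
       + gradient (\<lambda>y. \<psi> y t) x \<bullet> f x t
       = - \<epsilon> * matrix_inner (diffusion B t) (Hess (\<lambda>y. \<psi> y t) x)"
    using optimal_control_potential[OF opt] by blast
  have adm: "admissible \<rho>0 \<rho>1 \<rho>opt uopt" and fp: "fokker_planck \<epsilon> f B \<rho>opt uopt"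
    using opt unfolding solves_variational_problem_def is_arg_min_def by auto
  have "lagrange_multiplier \<epsilon> f B \<rho>0 \<rho>1 \<rho>opt uopt \<psi>"
    by (rule potential_is_lagrange_multiplier[OF opt \<psi> ctrl hjb])
  moreover have "time_deriv \<rho>opt x t
       + divergence (\<lambda>y. \<rho>opt y t *\<^sub>R
           (f y t + (B t ** transpose (B t)) *v gradient (\<lambda>z. \<psi> z t) y)) x
       = \<epsilon> * matrix_inner (diffusion B t) (Hess (\<lambda>y. \<rho>opt y t) x)" if t: "t \<in> {0<..<1}" for x t
    using fp t unfolding fokker_planck_def matrix_vector_mul_assoc[symmetric] ctrl[OF t, symmetric] by blast
  moreover have "\<rho>opt x 0 = \<rho>0 x" "\<rho>opt x 1 = \<rho>1 x" for x
    using adm unfolding admissible_def density_path_def by auto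
  ultimately show ?thesis
    using \<psi> ctrl hjb by (intro exI[of _ \<psi>] conjI allI ballI)
qed

end
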